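(* Let $(X_k)_{k\ge 0}$ be a Markov chain on $\Omega$ with transition kernel $\mathsf{M}$ and arbitrary initial law $\mu$, where $\mathsf{M}$, $\mathscr{X}$, $\mu_0$, $\delta_0$ are as in the context. Let $\varphi\in\mathscr{X}$ be real-valued with dynamical variance $\sigma^2(\varphi)>0$ (defined in the context), and let $\tilde\varphi:=\frac{\varphi-\mu_0(\varphi)}{\sigma(\varphi)}$, where $\sigma(\varphi)=\sqrt{\sigma^2(\varphi)}$. Let $G$ be the distribution function of the reduced centered normal law $\mathcal{N}(0,1)$ and let $F_n$ be the distribution function of $\frac{1}{\sqrt n}\big(\tilde\varphi(X_1)+\dots+\tilde\varphi(X_n)\big)$. Then for all $n\ge1$, \[\lVert F_n-G\rVert_\infty\le\frac{(148+285\,\delta_0^{-1}+123\,\delta_0^{-2})\,\max\{\lVert\tilde\varphi\rVert,\lVert\tilde\varphi\rVert^3\}}{\sqrt n}.\]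
   Context: $\Omega$ is a Polish metric space with its Borel $\sigma$-algebra; $\mathsf{M}=(m_x)_{x\in\Omega}$ is a transition kernel on $\Omega$ (each $m_x$ is a Borel probability measure); a Markov chain $(X_k)_{k\ge0}$ follows $\mathsf{M}$ if, conditionally on $X_k=x$, $X_{k+1}$ has law $m_x$. We write $\nu(f)=\int f\,d\nu$. $\mathscr{X}$ is a Banach space of (Borel measurable) functions $\Omega\to\mathbb{R}$ (or $\Omega\to\mathbb{C}$) with norm $\lVert\cdot\rVert$ such that: (1) $\lVert f\rVert\ge\lVert f\rVert_\infty$ (uniform norm) for all $f\in\mathscr{X}$; (2) $\mathscr{X}$ is a Banach algebra: $\lVert fg\rVert\le\lVert f\rVert\lVert g\rVert$; (3) $\mathscr{X}$ contains the constant functions and $\lVert\mathbf{1}\rVert=1$, where $\mathbf{1}$ is the constant function $1$. The averaging operator is $L_0f(x)=\int_\Omega f(y)\,dm_x(y)$. It is assumed that $L_0$ is a bounded operator $\mathscr{X}\to\mathscr{X}$ of operator norm $\lVert L_0\rVert=1$, and that it is contracting with gap $\delta_0\in(0,1]$: there is a closed hyperplane $G_0\subset\mathscr{X}$ with $\lVert L_0f\rVert\le(1-\delta_0)\lVert f\rVert$ for all $f\in G_0$. $\mu_0$ denotes a stationary probability measure of $\mathsf{M}$ (so $\mu_0(L_0f)=\mu_0(f)$ for $f\in\mathscr{X}$), which exists and is unique as a linear form on $\mathscr{X}$, and $G_0=\{f\in\mathscr{X}:\mu_0(f)=0\}$. With $\bar\varphi=\varphi-\mu_0(\varphi)$, the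 dynamical variance is \[\sigma^2(\varphi)=\mu_0(\varphi^2)-(\mu_0(\varphi))^2+2\sum_{k\ge1}\mu_0(\varphi\,L_0^k\bar\varphi).\] *)

theory Defs
  imports "HOL-Probability.Probability"
begin

text \<open>
  The scalar type \<open>'k\<close> below ranges over the separable complete real normed fields. Its instances
  \<open>real\<close> and \<open>complex\<close> give the spaces of real-valued and of complex-valued functions; by
  Gelfand--Mazur there are no others up to isometric isomorphism.
\<close>

locale banach_function_algebra =
  fixes X :: "('a::polish_space \<Rightarrow> 'k::{real_normed_field, banach, second_countable_topology}) set"
    and N :: "('a \<Rightarrow> 'k) \<Rightarrow> real"
  assumes measurable: "X \<subseteq> borel_measurable borel"
    and add_closed: "f \<in> X \<Longrightarrow> g \<in> X \<Longrightarrow> (\<lambda>x. f x + g x) \<in> X"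
    and scale_closed: "f \<in> X \<Longrightarrow> (\<lambda>x. c * f x) \<in> X"
    and mult_closed: "f \<in> X \<Longrightarrow> g \<in> X \<Longrightarrow> (\<lambda>x. f x * g x) \<in> X"
    and const_closed: "(\<lambda>x. c) \<in> X"
    and norm_triangle: "f \<in> X \<Longrightarrow> g \<in> X \<Longrightarrow> N (\<lambda>x. f x + g x) \<le> N f + N g"
    and norm_scale: "f \<in> X \<Longrightarrow> N (\<lambda>x. c * f x) = norm c * N f"
    \<comment> \<open>Domination of the uniform norm, written pointwise because a real-valued supremum of an
      unbounded function would carry no information. It makes \<open>N\<close> nonnegative and definite on \<open>X\<close>.\<close>
    and norm_ge_uniform: "f \<in> X \<Longrightarrow> norm (f x) \<le> N f"
    and norm_mult_le: "f \<in> X \<Longrightarrow> g \<in> X \<Longrightarrow> N (\<lambda>x. f x * g x) \<le> N f * N g"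
    and norm_one: "N (\<lambda>x. 1) = 1"
    and complete:
      "\<lbrakk>\<And>n. s n \<in> X; \<forall>e>0. \<exists>n0. \<forall>m\<ge>n0. \<forall>n\<ge>n0. N (\<lambda>x. s m x - s n x) < e\<rbrakk>
        \<Longrightarrow> \<exists>f\<in>X. (\<lambda>n. N (\<lambda>x. s n x - f x)) \<longlonglongrightarrow> 0"

definition bounded_operator_on :: "('a \<Rightarrow> 'k) set \<Rightarrow> (('a \<Rightarrow> 'k) \<Rightarrow> real) \<Rightarrow>
    (('a \<Rightarrow> 'k) \<Rightarrow> 'a \<Rightarrow> 'k) \<Rightarrow> bool" where
  "bounded_operator_on X N T \<longleftrightarrow> (\<forall>f\<in>X. T f \<in> X) \<and> (\<exists>C. \<forall>f\<in>X. N (T f) \<le> C * N f)"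

text \<open>As for \<^const>\<open>onorm\<close>, the zero function contributes the value \<open>0 / 0 = 0\<close>.\<close>

definition operator_norm_on :: "('a \<Rightarrow> 'k) set \<Rightarrow> (('a \<Rightarrow> 'k) \<Rightarrow> real) \<Rightarrow>
    (('a \<Rightarrow> 'k) \<Rightarrow> 'a \<Rightarrow> 'k) \<Rightarrow> real" where
  "operator_norm_on X N T = (SUP f\<in>X. N (T f) / N f)"

definition closed_hyperplane_in :: "('a \<Rightarrow> 'k::real_normed_field) set \<Rightarrow> (('a \<Rightarrow> 'k) \<Rightarrow> real) \<Rightarrow>
    ('a \<Rightarrow> 'k) set \<Rightarrow> bool" where
  "closed_hyperplane_in X N G \<longleftrightarrow>
     G \<subseteq> X \<and> (\<lambda>x. 0) \<in> G
     \<and> (\<forall>f\<in>G. \<forall>g\<in>G. (\<lambda>x. f x + g x) \<in> G)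
     \<and> (\<forall>c. \<forall>f\<in>G. (\<lambda>x. c * f x) \<in> G)
     \<and> (\<exists>e\<in>X - G. \<forall>f\<in>X. \<exists>c. \<exists>g\<in>G. f = (\<lambda>x. c * e x + g x))
     \<and> (\<forall>s. \<forall>f\<in>X. (\<forall>n. s n \<in> G) \<longrightarrow> (\<lambda>n. N (\<lambda>x. s n x - f x)) \<longlonglongrightarrow> 0 \<longrightarrow> f \<in> G)"

definition averaging_op :: "('a \<Rightarrow> 'a measure) \<Rightarrow>
    ('a \<Rightarrow> 'b::{banach, second_countable_topology}) \<Rightarrow> 'a \<Rightarrow> 'b" where
  "averaging_op M f x = (\<integral>y. f y \<partial>M x)"

locale transition_kernel =
  fixes M :: "'a::polish_space \<Rightarrow> 'a measure"
  assumes kernel: "M \<in> borel \<rightarrow>\<^sub>M prob_algebra borel"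

locale spectral_gap_setting = transition_kernel M + banach_function_algebra X N
  for M :: "'a::polish_space \<Rightarrow> 'a measure"
    and X :: "('a \<Rightarrow> 'k::{real_normed_field, banach, second_countable_topology}) set"
    and N :: "('a \<Rightarrow> 'k) \<Rightarrow> real" +
  fixes \<mu>0 :: "'a measure" and G0 :: "('a \<Rightarrow> 'k) set" and \<delta>0 :: real
  assumes bounded: "bounded_operator_on X N (averaging_op M)"
    and operator_norm: "operator_norm_on X N (averaging_op M) = 1"
    and gap: "0 < \<delta>0" "\<delta>0 \<le> 1"
    and hyperplane: "closed_hyperplane_in X N G0"
    and contracting: "f \<in> G0 \<Longrightarrow> N (averaging_op M f) \<le> (1 - \<delta>0) * N f"
    and prob: "\<mu>0 \<in> space (prob_algebra borel)"
    and stationary: "\<mu>0 \<bind> M = \<mu>0"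
    and hyperplane_eq: "G0 = {f \<in> X. (\<integral>x. f x \<partial>\<mu>0) = 0}"

definition dynamical_variance :: "('a \<Rightarrow> 'a measure) \<Rightarrow> 'a measure \<Rightarrow> ('a \<Rightarrow> real) \<Rightarrow> real" where
  "dynamical_variance M \<mu>0 \<phi> =
     (\<integral>x. (\<phi> x)\<^sup>2 \<partial>\<mu>0) - (\<integral>x. \<phi> x \<partial>\<mu>0)\<^sup>2
     + 2 * (\<Sum>k. \<integral>x. \<phi> x * (averaging_op M ^^ Suc k) (\<lambda>y. \<phi> y - (\<integral>z. \<phi> z \<partial>\<mu>0)) x \<partial>\<mu>0)"

definition normalized :: "('a \<Rightarrow> 'a measure) \<Rightarrow> 'a measure \<Rightarrow> ('a \<Rightarrow> real) \<Rightarrow> 'a \<Rightarrow> real" where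
  "normalized M \<mu>0 \<phi> x = (\<phi> x - (\<integral>z. \<phi> z \<partial>\<mu>0)) / sqrt (dynamical_variance M \<mu>0 \<phi>)"

definition past_algebra :: "'w measure \<Rightarrow> (nat \<Rightarrow> 'w \<Rightarrow> 'a::topological_space) \<Rightarrow> nat \<Rightarrow> 'w measure" where
  "past_algebra P \<xi> k =
     sigma (space P) {\<xi> i -` A \<inter> space P |i A. i \<le> k \<and> A \<in> sets borel}"

locale markov_chain = prob_space P + transition_kernel M
  for P :: "'w measure"
    and M :: "'a::polish_space \<Rightarrow> 'a measure" +
  fixes \<mu> :: "'a measure" and \<xi> :: "nat \<Rightarrow> 'w \<Rightarrow> 'a"
  assumes random_variable: "random_variable borel (\<xi> k)"
    and initial_law: "distr P borel (\<xi> 0) = \<mu>"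
    and transition: "B \<in> sets borel \<Longrightarrow>
      AE w in P. real_cond_exp P (past_algebra P \<xi> k) (indicator (\<xi> (Suc k) -` B \<inter> space P)) w
        = measure (M (\<xi> k w)) B"

end

theory Submission
  imports Defs "HOL-Real_Asymp.Real_Asymp"
begin

text \<open>
  Replace \<open>\<phi>\<close> by its normalisation, write \<open>a\<close> for its norm and put
  \<open>s = t / sqrt n\<close>. By the Markov property the characteristic function at \<open>t\<close> of the normalised
  sum is the integral, against the initial law, of the \<open>n\<close>-fold iterate on the constant \<open>1\<close> of the
  tilted operator \<open>h \<mapsto> L0 (exp (i s \<phi>) h)\<close>. For small \<open>s\<close> this operator is a perturbation of the
  averaging operator \<open>L0\<close>, which fixes the constants and contracts the functions of mean zero by the
  factor \<open>1 - \<delta>0\<close>; so the iterates are governed by a single multiplier close to \<open>1 - s\<^sup>2 / 2\<close>.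

  Instead of computing an eigenvalue, follow the iterates themselves. Write the \<open>k\<close>-th iterate as a
  scalar times \<open>1 + r\<close> with \<open>r\<close> of mean zero under \<open>\<mu>0\<close>. One application of the operator multiplies
  the scalar by the mean of \<open>exp (i s \<phi>) (1 + r)\<close> and transforms \<open>r\<close>
  by a Riccati type map (\<open>riccati\<close>). With \<open>u = \<bar>s\<bar> a\<close> of size at most \<open>\<delta>0\<^sup>2 / 25\<close>, the gap makes a
  ball of radius \<open>6/5 u / \<delta>0\<close> invariant (\<open>riccati_step\<close>), and, up to an error of order
  \<open>u\<^sup>2 / \<delta>0\<^sup>2\<close>, the defect \<open>r\<close> is \<open>i s\<close> times the sum of the first iterates of \<open>L0\<close> on \<open>\<phi>\<close>
  (\<open>defect_expansion\<close>). Inserting this in the mean of \<open>exp (i s \<phi>) (1 + r)\<close> produces the partial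
  sums of the series for the dynamical variance, which is \<open>1\<close>; hence the \<open>k\<close>-th multiplier is
  \<open>1 - s\<^sup>2 / 2\<close> up to \<open>5 u\<^sup>3 / \<delta>0\<^sup>2\<close> and a term that decays geometrically in \<open>k\<close>
  (\<open>multiplier_expansion\<close>). Multiplying \<open>n\<close> of them gives \<open>exp (- t\<^sup>2 / 2)\<close> up to a relative error
  of order \<open>1 / sqrt n\<close> (\<open>prod_multiplier_approx\<close>), whatever the initial law.

  This holds for \<open>0 < t \<le> T = sqrt n \<delta>0\<^sup>2 / (25 max {a, a\<^sup>3})\<close>. Esseen's smoothing inequality
  (\<open>esseen_smoothing\<close>) turns it into a bound for distribution functions: the frequencies up to \<open>T\<close>
  contribute at most \<open>34\<close> and the truncation at \<open>T\<close> at most \<open>82\<close>, both in units of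
  \<open>max {a, a\<^sup>3} / (sqrt n \<delta>0\<^sup>2)\<close>, in total less than \<open>123\<close>.

  The functions in the algebra may be real valued, whereas \<open>exp (i s \<phi>)\<close> is complex. Complex functions
  are therefore measured by the norms of the real parts of all their rotations (\<open>bounded_by\<close>). The
  resulting norm need not be submultiplicative, but multiplication by a real function of the algebra,
  the operator \<open>L0\<close> and its contraction on functions of mean zero obey the same bounds as in the
  algebra, and the exponential is reached from them through its power series.
\<close>

section \<open>The Fejer kernel\<close>

text \<open>
  The probability density \<open>(1 - cos (T x)) / (\<pi> T x\<^sup>2)\<close>, in a form that is also correct at \<open>0\<close>. Its
  Fourier transform is the triangle \<open>max 0 (1 - \<bar>t\<bar> / T)\<close>: smoothing by it removes all
  frequencies beyond \<open>T\<close>, which is why only \<open>\<bar>t\<bar> \<le> T\<close> matters later.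
\<close>

definition fejer :: "real \<Rightarrow> real \<Rightarrow> real" where
  "fejer T x = T / (2 * pi) * (sinc (T * x / 2))\<^sup>2"

lemma fejer_nonneg: "T > 0 \<Longrightarrow> 0 \<le> fejer T x"
  by (simp add: fejer_def)

lemma fejer_even: "fejer T (- x) = fejer T x"
  by (simp add: fejer_def)

lemma fejer_measurable [measurable]: "fejer T \<in> borel_measurable borel"
  unfolding fejer_def by measurable

lemma fejer_eq:
  assumes "T > 0" "x \<noteq> 0"
  shows "fejer T x = (1 - cos (T * x)) / (pi * T * x\<^sup>2)"
proof -
  have "1 - cos (T * x) = 2 * (sin (T * x / 2))\<^sup>2"
    using cos_double_sin[of "T * x / 2"] by simp
  thus ?thesis using assms by (simp add: fejer_def field_simps power2_eq_square)
qed

lemma fejer_le: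
  assumes "T > 0" "x \<noteq> 0"
  shows "fejer T x \<le> 2 / (pi * T * x\<^sup>2)"
  unfolding fejer_eq[OF assms] using assms cos_ge_minus_one[of "T * x"]
  by (intro divide_right_mono) (auto simp del: cos_ge_minus_one)

lemma isCont_fejer: "isCont (fejer T) x"
proof -
  have "isCont (\<lambda>x. sinc (T * x / 2)) x"
    by (rule isCont_o2[where g=sinc, OF _ isCont_sinc]) (auto intro!: continuous_intros)
  thus ?thesis unfolding fejer_def by (auto intro!: continuous_intros)
qed

text \<open>
  An antiderivative on \<open>x > 0\<close> is \<open>(Si (T x) - (1 - cos (T x)) / (T x)) / \<pi>\<close>, and the sine integral
  tends to \<open>\<pi> / 2\<close>.
\<close>

lemma fejer_has_integral_1:
  assumes T: "T > 0"
  shows "has_bochner_integral lborel (fejer T) 1"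
proof -
  define F where "F = (\<lambda>x. inverse pi * (Si (T * x) - (1 - cos (T * x)) / (T * x)))"
  have 0: "DERIV F x :> fejer T x" if "x > 0" for x
  proof -
    have [derivative_intros]: "DERIV (\<lambda>x. Si (T * x)) x :> sinc (T * x) * T"
      by (rule DERIV_chain2[OF DERIV_Si]) (auto intro!: derivative_eq_intros)
    show ?thesis unfolding F_def
      apply (rule derivative_eq_intros | simp)+
      using that T apply (simp_all add: fejer_eq)
      apply (simp add: field_simps power2_eq_square)
      done
  qed
  have A: "((F \<circ> real_of_ereal) \<longlongrightarrow> 0) (at_right 0)"
  proof -
    have 1: "((\<lambda>x. Si (T * x)) \<longlongrightarrow> Si 0) (at_right 0)"
      by (rule isCont_tendsto_compose[OF isCont_Si]) (auto intro!: tendsto_eq_intros)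
    have 2: "((\<lambda>x. (1 - cos (T * x)) / (T * x)) \<longlongrightarrow> 0) (at_right 0)"
      using T by real_asymp
    have "(F \<longlongrightarrow> inverse pi * (Si 0 - 0)) (at_right 0)"
      unfolding F_def by (intro tendsto_intros 1 2) auto
    moreover have "Si 0 = 0" by (simp add: Si_def zero_ereal_def)
    ultimately show ?thesis by (simp add: zero_ereal_def ereal_tendsto_simps)
  qed
  have B: "((F \<circ> real_of_ereal) \<longlongrightarrow> 1/2) (at_left \<infinity>)"
  proof -
    have 1: "((\<lambda>x. Si (T * x)) \<longlongrightarrow> pi / 2) at_top"
      by (rule filterlim_compose[OF Si_at_top]) (use T in real_asymp)
    have 2: "((\<lambda>x. (1 - cos (T * x)) / (T * x)) \<longlongrightarrow> 0) at_top"
      using T by real_asymp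
    have "(F \<longlongrightarrow> inverse pi * (pi/2 - 0)) at_top"
      unfolding F_def by (intro tendsto_intros 1 2) auto
    thus ?thesis by (simp add: ereal_tendsto_simps)
  qed
  note FTC = interval_integral_FTC_nonneg[of 0 \<infinity> F "fejer T" 0 "1/2",
      OF _ _ _ _ A B]
  have i: "set_integrable lborel (einterval 0 \<infinity>) (fejer T)"
    by (rule FTC(1)) (auto simp: zero_ereal_def 0 isCont_fejer fejer_nonneg T)
  have v: "(LBINT x=0..\<infinity>. fejer T x) = 1/2"
    by (subst FTC(2)) (auto simp: zero_ereal_def 0 isCont_fejer fejer_nonneg T)
  have e: "einterval 0 \<infinity> = {0<..}" by (auto simp: einterval_def zero_ereal_def)
  have "has_bochner_integral lborel (\<lambda>x. indicator {0<..} x *\<^sub>R fejer T x) (1/2)"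
    using i v unfolding has_bochner_integral_iff interval_lebesgue_integral_def set_integrable_def
      set_lebesgue_integral_def e by simp
  also have "?this \<longleftrightarrow> has_bochner_integral lborel (\<lambda>x. indicator {0..} x *\<^sub>R fejer T x) (1/2)"
  proof (rule has_bochner_integral_cong_AE)
    show "AE x in lborel. indicator {0<..} x *\<^sub>R fejer T x = indicator {0..} x *\<^sub>R fejer T x"
      using AE_lborel_singleton[of 0] by eventually_elim (auto simp: indicator_def)
  qed auto
  finally show ?thesis
    using has_bochner_integral_even_function[of "fejer T" "1/2"] by (simp add: fejer_even)
qed

lemma fejer_tail:
  assumes T: "T > 0" and h: "h > 0"
  shows "(\<integral>y. indicator {y. \<bar>y\<bar> > h} y * fejer T y \<partial>lborel) \<le> 4 / (pi * T * h)"
proof -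
  define F where "F = (\<lambda>x. - 2 / (pi * T * x))"
  define g where "g = (\<lambda>x. 2 / (pi * T * x\<^sup>2))"
  have 0: "DERIV F x :> g x" if "x > 0" for x
    unfolding F_def g_def using that T
    by (auto intro!: derivative_eq_intros simp: field_simps power2_eq_square)
  have A: "((F \<circ> real_of_ereal) \<longlongrightarrow> - 2 / (pi * T * h)) (at_right (ereal h))"
    unfolding F_def using T h by (simp add: ereal_tendsto_simps) (auto intro!: tendsto_eq_intros)
  have B: "((F \<circ> real_of_ereal) \<longlongrightarrow> 0) (at_left \<infinity>)"
    unfolding F_def using T by (simp add: ereal_tendsto_simps) real_asymp
  note FTC = interval_integral_FTC_nonneg[of "ereal h" \<infinity> F g _ 0, OF _ _ _ _ A B]
  have c: "isCont g x" if "x > 0" for x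
    unfolding g_def using that T by (auto intro!: continuous_intros)
  have nn: "0 \<le> g x" for x unfolding g_def using T by simp
  have i: "set_integrable lborel (einterval h \<infinity>) g"
    by (rule FTC(1)) (use h in \<open>auto simp: 0 c nn\<close>)
  have v: "(LBINT x=h..\<infinity>. g x) = 2 / (pi * T * h)"
    by (subst FTC(2)) (use h in \<open>auto simp: 0 c nn\<close>)
  have e: "einterval h \<infinity> = {h<..}" by (auto simp: einterval_def)
  have P: "has_bochner_integral lborel (\<lambda>x. indicator {h<..} x * g x) (2 / (pi * T * h))"
    using i v unfolding has_bochner_integral_iff interval_lebesgue_integral_def set_integrable_def
      set_lebesgue_integral_def e by simp
  have "has_bochner_integral lborel (\<lambda>x. indicator {y. \<bar>y\<bar> > h} x * g x) (2 *\<^sub>R (2 / (pi * T * h)))"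
    by (rule has_bochner_integral_even_function, rule has_bochner_integral_cong[THEN iffD2, OF _ _ _ P])
       (use h in \<open>auto simp: indicator_def g_def\<close>)
  hence Q: "has_bochner_integral lborel (\<lambda>x. indicator {y. \<bar>y\<bar> > h} x * g x) (4 / (pi * T * h))"
    by simp
  have "(\<integral>y. indicator {y. \<bar>y\<bar> > h} y * fejer T y \<partial>lborel) \<le> (\<integral>y. indicator {y. \<bar>y\<bar> > h} y * g y \<partial>lborel)"
  proof (rule integral_mono_AE')
    show "integrable lborel (\<lambda>x. indicator {y. \<bar>y\<bar> > h} x * g x)" using Q by (simp add: has_bochner_integral_iff)
  qed (use h T fejer_nonneg fejer_le in \<open>auto simp: indicator_def g_def\<close>)
  thus ?thesis using Q by (simp add: has_bochner_integral_iff)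
qed

text \<open>
  Lebesgue measure on a bounded interval, taken as a measure on the whole line so that measurability
  always refers to the Borel sets. All applications of Fubini below are then between finite measures.
\<close>

definition unif :: "real \<Rightarrow> real \<Rightarrow> real measure" where
  "unif a b = density lborel (\<lambda>t. ennreal (indicator {a<..b} t))"

lemma sets_unif [measurable_cong, simp]: "sets (unif a b) = sets borel"
  by (simp add: unif_def)

lemma space_unif [simp]: "space (unif a b) = UNIV"
  by (simp add: unif_def)

lemma finite_unif: "finite_measure (unif a b)"
proof (rule finite_measureI)
  have "emeasure lborel {a<..b} < \<infinity>"
    by (cases "a \<le> b") auto
  thus "emeasure (unif a b) (space (unif a b)) \<noteq> \<infinity>"
    by (simp add: unif_def emeasure_density ennreal_indicator)
qed

lemma integral_unif: 
  fixes f :: "real \<Rightarrow> real"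
  assumes [measurable]: "f \<in> borel_measurable borel"
  shows "integral\<^sup>L (unif a b) f = (\<integral>t. indicator {a<..b} t * f t \<partial>lborel)"
  unfolding unif_def by (subst integral_density) auto

lemma integral_unif_interval: 
  fixes f :: "real \<Rightarrow> real"
  assumes [measurable]: "f \<in> borel_measurable borel" and "a \<le> b"
  shows "integral\<^sup>L (unif a b) f = (LBINT t=a..b. f t)"
  using assms by (simp add: integral_unif interval_integral_Ioc set_lebesgue_integral_def)

text \<open>
  The kernel is the Fourier transform of its triangular transform. In this direction the inversion is an
  elementary integral over a bounded set of frequencies.
\<close>

lemma fejer_fourier:
  assumes T: "T > 0"
  shows "fejer T y = (\<integral>t. (1 - t / T) * cos (t * y) \<partial>unif 0 T) / pi"
proof -
  have "(\<integral>t. (1 - t / T) * cos (t * y) \<partial>unif 0 T) = (LBINT t=0..T. (1 - t / T) * cos (t * y))"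
    using T by (subst integral_unif_interval) (auto simp: zero_ereal_def)
  also have "\<dots> = pi * fejer T y"
  proof (cases "y = 0")
    case True
    have "(LBINT t=ereal 0..ereal T. (1 - t / T)) = (T - T^2/(2*T)) - (0 - 0^2/(2*T))"
      using T by (intro interval_integral_FTC_finite)
       (auto intro!: continuous_intros derivative_eq_intros simp: has_real_derivative_iff_has_vector_derivative[symmetric])
    thus ?thesis using True T by (simp add: fejer_def field_simps power2_eq_square zero_ereal_def)
  next
    case False
    define F where "F = (\<lambda>t. (1 - t / T) * sin (t * y) / y - cos (t * y) / (T * y^2))"
    have "(LBINT t=ereal 0..ereal T. (1 - t / T) * cos (t * y)) = F T - F 0"
      unfolding F_def using T False by (intro interval_integral_FTC_finite)
       (auto intro!: continuous_intros derivative_eq_intros simp: has_real_derivative_iff_has_vector_derivative[symmetric] field_simps power2_eq_square)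
    also have "F T - F 0 = pi * fejer T y"
      using False T by (simp add: fejer_eq F_def field_simps power2_eq_square)
    finally show ?thesis by (simp add: zero_ereal_def)
  qed
  finally show ?thesis by simp
qed

lemma integral_unif_cos:
  assumes "a \<le> b" "t \<noteq> 0"
  shows "(\<integral>y. cos (t * y) \<partial>unif a b) = (sin (t * b) - sin (t * a)) / t"
proof -
  have "(LBINT y=ereal a..ereal b. cos (t * y)) = sin (t * b) / t - sin (t * a) / t"
    using assms by (intro interval_integral_FTC_finite)
       (auto intro!: continuous_intros derivative_eq_intros simp: has_real_derivative_iff_has_vector_derivative[symmetric] field_simps power2_eq_square)
  thus ?thesis using assms by (simp add: integral_unif_interval diff_divide_distrib)
qed

lemma integral_swap_bounded:
  fixes f :: "'a \<Rightarrow> 'b \<Rightarrow> real"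
  assumes "finite_measure A" "finite_measure B"
    and [measurable]: "(\<lambda>(x, y). f x y) \<in> borel_measurable (A \<Otimes>\<^sub>M B)"
    and bd: "\<And>x y. x \<in> space A \<Longrightarrow> y \<in> space B \<Longrightarrow> \<bar>f x y\<bar> \<le> C"
  shows "(\<integral>x. \<integral>y. f x y \<partial>B \<partial>A) = (\<integral>y. \<integral>x. f x y \<partial>A \<partial>B)"
proof -
  interpret A: finite_measure A by fact
  interpret B: finite_measure B by fact
  interpret pair_sigma_finite A B ..
  interpret AB: finite_measure "A \<Otimes>\<^sub>M B" by (rule finite_measure_pair_measure) fact+
  have "integrable (A \<Otimes>\<^sub>M B) (\<lambda>(x, y). f x y)"
    by (rule AB.integrable_const_bound[where B=C]) (auto simp: space_pair_measure bd)
  thus ?thesis by (rule Fubini_integral[symmetric])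
qed

lemma integral_unif_indicator:
  fixes f :: "real \<Rightarrow> real"
  assumes [measurable]: "f \<in> borel_measurable borel"
  shows "(\<integral>t. indicator {a<..b} t * f t \<partial>unif a b) = integral\<^sup>L (unif a b) f"
  by (subst (1 2) integral_unif) (auto intro!: Bochner_Integration.integral_cong simp: indicator_def)

lemma integral_unif_cong:
  fixes f g :: "real \<Rightarrow> real"
  assumes "f \<in> borel_measurable borel" "g \<in> borel_measurable borel"
    and "\<And>t. a < t \<Longrightarrow> t \<le> b \<Longrightarrow> f t = g t"
  shows "integral\<^sup>L (unif a b) f = integral\<^sup>L (unif a b) g"
  using assms by (auto intro!: Bochner_Integration.integral_cong simp: indicator_def integral_unif)

definition fejer_measure :: "real \<Rightarrow> real measure" where
  "fejer_measure T = density lborel (\<lambda>y. ennreal (fejer T y))"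

lemma sets_fejer_measure [measurable_cong, simp]: "sets (fejer_measure T) = sets borel"
  by (simp add: fejer_measure_def)

lemma space_fejer_measure [simp]: "space (fejer_measure T) = UNIV"
  by (simp add: fejer_measure_def)

lemma prob_fejer_measure:
  assumes T: "T > 0"
  shows "prob_space (fejer_measure T)"
proof (rule prob_spaceI)
  have "(\<integral>\<^sup>+ x. ennreal (fejer T x) \<partial>lborel) = ennreal 1"
    using nn_integral_eq_integral[of lborel "fejer T"] fejer_nonneg[OF T] fejer_has_integral_1[OF T]
    by (auto simp: has_bochner_integral_iff)
  thus "emeasure (fejer_measure T) (space (fejer_measure T)) = 1"
    by (simp add: fejer_measure_def emeasure_density)
qed

lemma integral_fejer_measure:
  fixes f :: "real \<Rightarrow> real"
  assumes [measurable]: "f \<in> borel_measurable borel" and T: "T > 0"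
  shows "integral\<^sup>L (fejer_measure T) f = (\<integral>y. fejer T y * f y \<partial>lborel)"
  unfolding fejer_measure_def by (subst integral_density) (auto simp: fejer_nonneg T)

lemma cdf_measurable [measurable]:
  assumes "real_distribution M"
  shows "cdf M \<in> borel_measurable borel"
proof -
  interpret real_distribution M by fact
  show ?thesis by (rule borel_measurable_mono) (auto simp: mono_def cdf_nondecreasing)
qed

text \<open>
  Integrating the cosine representation of the kernel over an interval, with the two integrations
  exchanged.
\<close>

lemma fejer_measure_interval:
  assumes T: "T > 0" and ab: "a \<le> b"
  shows "(\<integral>y. indicator {a<..b} y \<partial>fejer_measure T) = 
    (\<integral>t. (1 - t / T) * ((sin (t * b) - sin (t * a)) / t) \<partial>unif 0 T) / pi"
proof -
  have "(\<integral>y. indicator {a<..b} y \<partial>fejer_measure T) = (\<integral>y. fejer T y \<partial>unif a b)"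
    by (subst integral_fejer_measure) (auto simp: T integral_unif mult.commute)
  also have "\<dots> = (\<integral>y. (\<integral>t. (1 - t / T) * cos (t * y) \<partial>unif 0 T) \<partial>unif a b) / pi"
    by (subst fejer_fourier[OF T]) simp
  also have "(\<integral>y. (\<integral>t. (1 - t / T) * cos (t * y) \<partial>unif 0 T) \<partial>unif a b) =
     (\<integral>y. (\<integral>t. indicator {0<..T} t * ((1 - t / T) * cos (t * y)) \<partial>unif 0 T) \<partial>unif a b)"
    by (simp add: integral_unif_indicator)
  also have "\<dots> = (\<integral>t. (\<integral>y. indicator {0<..T} t * ((1 - t / T) * cos (t * y)) \<partial>unif a b) \<partial>unif 0 T)"
  proof (rule integral_swap_bounded[where C=1, OF finite_unif finite_unif])
    show "\<bar>indicator {0<..T} t * ((1 - t / T) * cos (t * y))\<bar> \<le> 1" for y t :: real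
    proof (cases "t \<in> {0<..T}")
      case True
      hence "\<bar>1 - t / T\<bar> \<le> 1" using T by (auto simp: field_simps)
      hence "\<bar>1 - t / T\<bar> * \<bar>cos (t * y)\<bar> \<le> 1 * 1" by (intro mult_mono) auto
      thus ?thesis using True by (simp add: abs_mult)
    qed auto
  qed measurable
  also have "\<dots> = (\<integral>t. (1 - t / T) * ((sin (t * b) - sin (t * a)) / t) \<partial>unif 0 T)"
  proof (rule integral_unif_cong)
    interpret U: finite_measure "unif a b" by (rule finite_unif)
    show "(\<lambda>t. \<integral>y. indicator {0<..T} t * ((1 - t / T) * cos (t * y)) \<partial>unif a b) \<in> borel_measurable borel"
      by measurable
  qed (auto simp: integral_unif_cos[OF ab])
  finally show ?thesis .
qed

section \<open>Smoothed distribution functions\<close>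

text \<open>
  The left side is the imaginary part of the integral of \<open>exp (i t (x - z))\<close>. Working with
  sines keeps the smoothing argument real.
\<close>

lemma integral_sin_char:
  assumes "real_distribution M"
  shows "(\<integral>z. sin (t * (x - z)) \<partial>M) = Im (iexp (t * x) * cnj (char M t))"
proof -
  interpret M: real_distribution M by fact
  have i: "integrable M (\<lambda>z. iexp (t * z))" by (rule M.integrable_iexp) auto
  have "iexp (t * x) * cnj (char M t) = (CLINT z|M. iexp (t * x) * cnj (iexp (t * z)))"
    unfolding char_def using i by (simp del: exp_of_real flip: integral_cnj)
  also have "\<dots> = (CLINT z|M. iexp (t * (x - z)))"
    by (intro Bochner_Integration.integral_cong) 
       (auto simp: exp_cnj algebra_simps exp_diff exp_minus divide_inverse simp flip: exp_add)
  finally have "Im (iexp (t * x) * cnj (char M t)) = Im (CLINT z|M. iexp (t * (x - z)))" by simp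
  also have "\<dots> = (\<integral>z. Im (iexp (t * (x - z))) \<partial>M)"
    by (rule integral_Im[symmetric], rule M.integrable_iexp) auto
  also have "\<dots> = (\<integral>z. sin (t * (x - z)) \<partial>M)"
    by (intro Bochner_Integration.integral_cong) (auto simp: Im_exp)
  finally show ?thesis by simp
qed

lemma abs_sin_diff_le: "\<bar>sin a - sin b\<bar> \<le> \<bar>a - b\<bar>" for a b :: real
proof -
  have "\<bar>sin a - sin b\<bar> = 2 * (\<bar>sin ((a - b) / 2)\<bar> * \<bar>cos ((a + b) / 2)\<bar>)"
    by (simp add: sin_diff_sin abs_mult)
  also have "\<dots> \<le> 2 * (\<bar>(a - b) / 2\<bar> * 1)"
    by (intro mult_left_mono mult_mono abs_sin_x_le_abs_x) auto
  finally show ?thesis by simp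
qed

text \<open>
  The increment of the smoothed distribution function only sees the characteristic function up to
  frequency \<open>T\<close>. An increment between two points is used instead of a value because \<open>1 / t\<close>
  is harmless there, the difference of the two sines being of order \<open>t\<close>.
\<close>

lemma smoothed_cdf_increment:
  assumes T: "T > 0" and M: "real_distribution M" and x: "x' \<le> x"
  shows "(\<integral>y. cdf M (x - y) - cdf M (x' - y) \<partial>fejer_measure T) = 
    (\<integral>t. (1 - t / T) * ((Im (iexp (t * x) * cnj (char M t)) - Im (iexp (t * x') * cnj (char M t))) / t) \<partial>unif 0 T) / pi"
proof -
  interpret M: real_distribution M by fact
  interpret K: prob_space "fejer_measure T" by (rule prob_fejer_measure[OF T])
  have int: "integrable M (\<lambda>z. sin (t * (c - z)))" for t c
    by (rule M.integrable_const_bound[where B=1]) auto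
  have "cdf M (x - y) - cdf M (x' - y) = (\<integral>z. indicator {x' - z<..x - z} y \<partial>M)" for y
  proof -
    have "cdf M (x - y) - cdf M (x' - y) = measure M {x' - y<..x - y}"
      by (cases "x' = x") (use x in \<open>auto simp: M.cdf_diff_eq\<close>)
    also have "\<dots> = (\<integral>z. indicator {x' - y<..x - y} z \<partial>M)" by simp
    also have "\<dots> = (\<integral>z. indicator {x' - z<..x - z} y \<partial>M)"
      by (intro Bochner_Integration.integral_cong) (auto simp: indicator_def)
    finally show ?thesis .
  qed
  hence "(\<integral>y. cdf M (x - y) - cdf M (x' - y) \<partial>fejer_measure T) =
      (\<integral>y. \<integral>z. indicator {x' - z<..x - z} y \<partial>M \<partial>fejer_measure T)" by simp
  also have "\<dots> = (\<integral>z. \<integral>y. indicator {x' - z<..x - z} y \<partial>fejer_measure T \<partial>M)"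
    by (rule integral_swap_bounded[where C=1]) 
       (unfold_locales, auto simp: indicator_def case_prod_beta)
  also have "\<dots> = (\<integral>z. (\<integral>t. (1 - t / T) * ((sin (t * (x - z)) - sin (t * (x' - z))) / t) \<partial>unif 0 T) \<partial>M) / pi"
    using x by (simp only: fejer_measure_interval[OF T] diff_right_mono Bochner_Integration.integral_divide_zero)
  also have "(\<integral>z. (\<integral>t. (1 - t / T) * ((sin (t * (x - z)) - sin (t * (x' - z))) / t) \<partial>unif 0 T) \<partial>M) =
     (\<integral>z. (\<integral>t. indicator {0<..T} t * ((1 - t / T) * ((sin (t * (x - z)) - sin (t * (x' - z))) / t)) \<partial>unif 0 T) \<partial>M)"
    by (subst integral_unif_indicator) auto
  also have "\<dots> = (\<integral>t. (\<integral>z. indicator {0<..T} t * ((1 - t / T) * ((sin (t * (x - z)) - sin (t * (x' - z))) / t)) \<partial>M) \<partial>unif 0 T)"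
  proof (rule integral_swap_bounded[where C="x - x'", OF _ finite_unif])
    show "\<bar>indicator {0<..T} t * ((1 - t / T) * ((sin (t * (x - z)) - sin (t * (x' - z))) / t))\<bar> \<le> x - x'" for z t :: real
    proof (cases "t \<in> {0<..T}")
      case True
      hence 1: "\<bar>1 - t / T\<bar> \<le> 1" using T by (auto simp: field_simps)
      have "\<bar>sin (t * (x - z)) - sin (t * (x' - z))\<bar> \<le> \<bar>t * (x - z) - t * (x' - z)\<bar>"
        by (rule abs_sin_diff_le)
      also have "\<dots> = \<bar>t * (x - x')\<bar>" by (simp add: algebra_simps)
      also have "\<dots> = t * (x - x')" using True x by simp
      finally have "\<bar>(sin (t * (x - z)) - sin (t * (x' - z))) / t\<bar> \<le> x - x'"
        using True by (simp add: field_simps)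
      with 1 have "\<bar>1 - t / T\<bar> * \<bar>(sin (t * (x - z)) - sin (t * (x' - z))) / t\<bar> \<le> 1 * (x - x')" 
        by (intro mult_mono) auto
      thus ?thesis using True by (simp add: abs_mult)
    qed (use x in auto)
  qed (unfold_locales, measurable)
  also have "\<dots> = (\<integral>t. (1 - t / T) * ((Im (iexp (t * x) * cnj (char M t)) - Im (iexp (t * x') * cnj (char M t))) / t) \<partial>unif 0 T)"
    by (simp only: int integral_sin_char[OF M] Bochner_Integration.integral_divide_zero Bochner_Integration.integral_mult_right_zero Bochner_Integration.integral_diff)
       (subst integral_unif_indicator, auto)
  finally show ?thesis .
qed

section \<open>Esseen's smoothing inequality\<close>

lemma AE_unif: "AE t in unif a b. a < t \<and> t \<le> b"
  unfolding unif_def by (subst AE_density) (auto simp: indicator_def)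

lemma norm_iexp_diff_le: "cmod (iexp a - iexp b) \<le> \<bar>a - b\<bar>"
proof -
  have "cmod (iexp a - iexp b) = cmod (iexp b * (iexp (a - b) - 1))"
    by (simp add: exp_diff exp_minus algebra_simps divide_inverse)
  also have "\<dots> \<le> \<bar>a - b\<bar>"
    using iexp_approx1[of "a - b" 0] by (simp add: norm_mult)
  finally show ?thesis .
qed

text \<open>
  The integral of \<open>sin (t (x - z)) - sin (t (x' - z))\<close> against a distribution whose characteristic
  function at \<open>t\<close> is \<open>c\<close>, see \<open>integral_sin_char\<close>; it is linear over the reals in \<open>c\<close>.
\<close>

definition char_increment :: "real \<Rightarrow> real \<Rightarrow> complex \<Rightarrow> real \<Rightarrow> real" where
  "char_increment x' x c t = Im (iexp (t * x) * cnj c) - Im (iexp (t * x') * cnj c)"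

lemma char_increment_le_lipschitz:
  "\<bar>char_increment x' x c t\<bar> \<le> \<bar>t * x - t * x'\<bar> * cmod c"
proof -
  have "char_increment x' x c t = Im ((iexp (t * x) - iexp (t * x')) * cnj c)"
    by (simp only: char_increment_def left_diff_distrib minus_complex.sel)
  also have "\<bar>\<dots>\<bar> \<le> cmod ((iexp (t * x) - iexp (t * x')) * cnj c)"
    by (rule abs_Im_le_cmod)
  also have "\<dots> \<le> \<bar>t * x - t * x'\<bar> * cmod c"
    unfolding norm_mult complex_mod_cnj by (intro mult_right_mono norm_iexp_diff_le) auto
  finally show ?thesis .
qed

lemma char_increment_le: "\<bar>char_increment x' x c t\<bar> \<le> 2 * cmod c"
proof -
  have "\<bar>Im (iexp (t * x) * cnj c)\<bar> \<le> cmod c" for x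
    using abs_Im_le_cmod[of "iexp (t * x) * cnj c"] by (simp add: norm_mult)
  from this[of x] this[of x'] show ?thesis unfolding char_increment_def by linarith
qed

lemma char_increment_diff:
  "char_increment x' x c t - char_increment x' x d t = char_increment x' x (c - d) t"
  by (simp add: char_increment_def algebra_simps)

lemma char_increment_integrable:
  assumes T: "T > 0" and M: "real_distribution M" and x: "x' \<le> x"
  shows "integrable (unif 0 T) (\<lambda>t. (1 - t / T) * (char_increment x' x (char M t) t / t))"
proof -
  interpret M: real_distribution M by fact
  interpret U: finite_measure "unif 0 T" by (rule finite_unif)
  show ?thesis
  proof (rule U.integrable_const_bound)
    show "AE t in unif 0 T. norm ((1 - t / T) * (char_increment x' x (char M t) t / t)) \<le> x - x'"
      using AE_unif
    proof eventually_elim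
      case (elim t)
      have "\<bar>char_increment x' x (char M t) t\<bar> \<le> \<bar>t * x - t * x'\<bar> * cmod (char M t)"
        by (rule char_increment_le_lipschitz)
      also have "\<dots> \<le> \<bar>t * x - t * x'\<bar> * 1" by (intro mult_left_mono M.cmod_char_le_1) auto
      also have "t * x - t * x' = t * (x - x')" by (simp add: algebra_simps)
      finally have "\<bar>char_increment x' x (char M t) t / t\<bar> \<le> x - x'"
        using elim x by (simp add: field_simps abs_mult)
      moreover have "\<bar>1 - t / T\<bar> \<le> 1" using elim T by (auto simp: field_simps)
      ultimately have "\<bar>1 - t / T\<bar> * \<bar>char_increment x' x (char M t) t / t\<bar> \<le> 1 * (x - x')"
        by (intro mult_mono) auto
      thus ?case by (simp add: abs_mult)
    qed
  qed (simp add: char_increment_def)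
qed

text \<open>
  For the increment between \<open>x'\<close> and \<open>x\<close> the bound is immediate from the Fourier representation, with
  \<open>\<bar>sin\<bar> \<le> 1\<close> at both ends. Letting \<open>x'\<close> tend to minus infinity removes the lower end point, as
  the bound does not depend on \<open>x'\<close>.
\<close>

lemma smoothed_cdf_diff_le:
  assumes T: "T > 0" and M: "real_distribution M" and N: "real_distribution N"
    and I: "integrable (unif 0 T) (\<lambda>t. cmod (char M t - char N t) / t)"
  shows "\<bar>\<integral>y. cdf M (x - y) - cdf N (x - y) \<partial>fejer_measure T\<bar>
     \<le> 2 / pi * (\<integral>t. cmod (char M t - char N t) / t \<partial>unif 0 T)" (is "_ \<le> ?B")
proof -
  interpret M: real_distribution M by fact
  interpret N: real_distribution N by fact
  interpret K: prob_space "fejer_measure T" by (rule prob_fejer_measure[OF T])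
  note [measurable] = cdf_measurable[OF M] cdf_measurable[OF N]
  define D where "D = (\<lambda>x. \<integral>y. cdf M (x - y) - cdf N (x - y) \<partial>fejer_measure T)"
  have cb: "\<bar>cdf M z\<bar> \<le> 1" "\<bar>cdf N z\<bar> \<le> 1" for z
    using M.cdf_nonneg[of z] M.cdf_bounded_prob[of z] N.cdf_nonneg[of z] N.cdf_bounded_prob[of z] by auto
  have int: "integrable (fejer_measure T) (\<lambda>y. cdf M (x - y))" "integrable (fejer_measure T) (\<lambda>y. cdf N (x - y))" for x
    by (rule K.integrable_const_bound[where B=1]; use cb in force)+
  have le: "\<bar>D x - D x'\<bar> \<le> ?B" if x: "x' \<le> x" for x'
  proof -
    have "D x - D x' = (\<integral>y. cdf M (x - y) - cdf M (x' - y) \<partial>fejer_measure T) -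
                        (\<integral>y. cdf N (x - y) - cdf N (x' - y) \<partial>fejer_measure T)"
      unfolding D_def by (simp add: int)
    also have "\<dots> = (\<integral>t. (1 - t / T) * (char_increment x' x (char M t) t / t) -
        (1 - t / T) * (char_increment x' x (char N t) t / t) \<partial>unif 0 T) / pi"
      by (simp only: smoothed_cdf_increment[OF T _ x] M N char_increment_def[symmetric]
         Bochner_Integration.integral_diff char_increment_integrable[OF T _ x] diff_divide_distrib)
    also have "\<dots> = (\<integral>t. (1 - t / T) * (char_increment x' x (char M t - char N t) t / t) \<partial>unif 0 T) / pi"
      by (simp only: char_increment_diff flip: right_diff_distrib diff_divide_distrib)
    also have "\<bar>\<dots>\<bar> \<le> (\<integral>t. 2 * (cmod (char M t - char N t) / t) \<partial>unif 0 T) / pi"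
      unfolding abs_divide abs_of_pos[OF pi_gt_zero]
    proof (intro divide_right_mono order.trans[OF integral_abs_bound] integral_mono_AE')
      show "integrable (unif 0 T) (\<lambda>t. 2 * (cmod (char M t - char N t) / t))"
        by (rule integrable_mult_right[OF I])
      show "AE t in unif 0 T. \<bar>(1 - t / T) * (char_increment x' x (char M t - char N t) t / t)\<bar>
              \<le> 2 * (cmod (char M t - char N t) / t)"
        using AE_unif
      proof eventually_elim
        case (elim t)
        have "\<bar>1 - t / T\<bar> \<le> 1" using elim T by (auto simp: field_simps)
        moreover have "\<bar>char_increment x' x (char M t - char N t) t / t\<bar> \<le> 2 * (cmod (char M t - char N t) / t)"
          using elim char_increment_le[of x' x "char M t - char N t" t] by (simp add: divide_right_mono)
        ultimately have "\<bar>1 - t / T\<bar> * \<bar>char_increment x' x (char M t - char N t) t / t\<bar>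
            \<le> 1 * (2 * (cmod (char M t - char N t) / t))" by (intro mult_mono) auto
        thus ?case by (simp add: abs_mult)
      qed
      show "AE t in unif 0 T. 0 \<le> 2 * (cmod (char M t - char N t) / t)"
        using AE_unif by eventually_elim auto
    qed auto
    also have "\<dots> = ?B" by (simp only: Bochner_Integration.integral_mult_right_zero times_divide_eq_left)
    finally show ?thesis .
  qed
  have lim: "(\<lambda>n. D (- real n)) \<longlonglongrightarrow> (\<integral>y. 0 - 0 \<partial>fejer_measure T)"
    unfolding D_def
  proof (rule integral_dominated_convergence[where w="\<lambda>_. 2"])
    show "AE y in fejer_measure T. (\<lambda>n. cdf M (- real n - y) - cdf N (- real n - y)) \<longlonglongrightarrow> 0 - 0"
    proof (intro AE_I2 tendsto_diff)
      fix y
      have "filterlim (\<lambda>n. - real n - y) at_bot sequentially" by real_asymp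
      thus "(\<lambda>n. cdf M (- real n - y)) \<longlonglongrightarrow> 0" "(\<lambda>n. cdf N (- real n - y)) \<longlonglongrightarrow> 0"
        by (auto intro: filterlim_compose[OF M.cdf_lim_at_bot] filterlim_compose[OF N.cdf_lim_at_bot])
    qed
    show "AE y in fejer_measure T. norm (cdf M (- real n - y) - cdf N (- real n - y)) \<le> 2" for n
    proof (rule AE_I2)
      fix y show "norm (cdf M (- real n - y) - cdf N (- real n - y)) \<le> 2"
        using cb[of "- real n - y"] by (simp add: abs_le_iff)
    qed
  qed auto
  hence "(\<lambda>n. \<bar>D x - D (- real n)\<bar>) \<longlonglongrightarrow> \<bar>D x - 0\<bar>"
    by (intro tendsto_intros) auto
  moreover have "eventually (\<lambda>n. \<bar>D x - D (- real n)\<bar> \<le> ?B) sequentially"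
    using eventually_ge_at_top[of "nat \<lceil>- x\<rceil>"] by eventually_elim (rule le, linarith)
  ultimately have "\<bar>D x - 0\<bar> \<le> ?B" by (rule tendsto_upperbound) auto
  thus ?thesis by (simp add: D_def)
qed

lemma integral_fejer_measure_reflect:
  fixes f :: "real \<Rightarrow> real"
  assumes [measurable]: "f \<in> borel_measurable borel" and T: "T > 0"
  shows "(\<integral>y. f (- y) \<partial>fejer_measure T) = integral\<^sup>L (fejer_measure T) f"
  using lborel_integral_real_affine[of "-1" "\<lambda>y. fejer T y * f y" 0]
  by (simp add: integral_fejer_measure T fejer_even)

text \<open>
  To the right of \<open>x\<close> the function \<open>\<Delta>\<close> decreases with slope at most \<open>m\<close>, so on an interval of radius \<open>h\<close>
  around \<open>x + h\<close> it is at least \<open>\<Delta> x - m h\<close> on average over points placed symmetrically. Averaging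
  at \<open>x + h\<close> hence recovers \<open>\<Delta> x\<close>, apart from the mass \<open>\<tau>\<close> of the kernel beyond distance \<open>h\<close>.
\<close>

lemma one_sided_smoothing:
  fixes \<Delta> :: "real \<Rightarrow> real"
  assumes [measurable]: "\<Delta> \<in> borel_measurable borel"
    and T: "T > 0" and h: "h > 0"
    and D: "\<And>x. \<bar>\<Delta> x\<bar> \<le> D"
    and lip: "\<And>x y. x \<le> y \<Longrightarrow> \<Delta> x - m * (y - x) \<le> \<Delta> y"
    and eta: "\<And>x. (\<integral>y. \<Delta> (x - y) \<partial>fejer_measure T) \<le> \<eta>"
  defines "\<tau> \<equiv> measure (fejer_measure T) {y. \<bar>y\<bar> > h}"
  shows "(\<Delta> x - m * h) * (1 - \<tau>) - D * \<tau> \<le> \<eta>"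
proof -
  interpret K: prob_space "fejer_measure T" by (rule prob_fejer_measure[OF T])
  have int: "integrable (fejer_measure T) (\<lambda>y. \<Delta> (c - y))" "integrable (fejer_measure T) (\<lambda>y. \<Delta> (c + y))" for c
    by (rule K.integrable_const_bound[where B=D]; use D in force)+
  have m1: "measure (fejer_measure T) {y. \<bar>y\<bar> \<le> h} = 1 - \<tau>"
  proof -
    have "{y. \<bar>y\<bar> \<le> h} = space (fejer_measure T) - {y. \<bar>y\<bar> > h}" by auto
    thus ?thesis unfolding \<tau>_def by (simp only:) (rule K.prob_compl, measurable)
  qed
  \<comment> \<open>Pairing \<open>y\<close> with \<open>- y\<close> cancels the linear term of the lower bound.\<close>
  have "2 * ((\<Delta> x - m * h) * (1 - \<tau>) - D * \<tau>) =
     (\<integral>y. 2 * (\<Delta> x - m * h) * indicator {y. \<bar>y\<bar> \<le> h} y - 2 * D * indicator {y. \<bar>y\<bar> > h} y \<partial>fejer_measure T)"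
    by (subst Bochner_Integration.integral_diff)
      (auto simp: m1 \<tau>_def[symmetric] K.emeasure_eq_measure intro!: integrable_mult_right integrable_real_indicator)
  also have "\<dots> \<le> (\<integral>y. \<Delta> (x + h - y) + \<Delta> (x + h + y) \<partial>fejer_measure T)"
  proof (rule integral_mono)
    fix y
    show "2 * (\<Delta> x - m * h) * indicator {y. \<bar>y\<bar> \<le> h} y - 2 * D * indicator {y. \<bar>y\<bar> > h} y
      \<le> \<Delta> (x + h - y) + \<Delta> (x + h + y)"
    proof (cases "\<bar>y\<bar> \<le> h")
      case True
      have "\<Delta> x - m * (h - y) \<le> \<Delta> (x + h - y)" "\<Delta> x - m * (h + y) \<le> \<Delta> (x + h + y)"
        using lip[of x "x + h - y"] lip[of x "x + h + y"] True by (auto simp: algebra_simps)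
      thus ?thesis using True by (simp add: algebra_simps)
    next
      case False
      thus ?thesis using D[of "x + h - y"] D[of "x + h + y"] by auto
    qed
  qed (auto intro!: integrable_mult_right integrable_real_indicator int Bochner_Integration.integrable_diff simp: K.emeasure_eq_measure)
  also have "\<dots> = (\<integral>y. \<Delta> (x + h - y) \<partial>fejer_measure T) + (\<integral>y. \<Delta> (x + h - (- y)) \<partial>fejer_measure T)"
    by (simp add: int)
  also have "(\<integral>y. \<Delta> (x + h - (- y)) \<partial>fejer_measure T) = (\<integral>y. \<Delta> (x + h - y) \<partial>fejer_measure T)"
    by (rule integral_fejer_measure_reflect[OF _ T, of "\<lambda>y. \<Delta> (x + h - y)"]) measurable
  also have "(\<integral>y. \<Delta> (x + h - y) \<partial>fejer_measure T) + (\<integral>y. \<Delta> (x + h - y) \<partial>fejer_measure T) \<le> 2 * \<eta>"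
    using eta[of "x + h"] by simp
  finally show ?thesis by (rule mult_left_le_imp_le) simp
qed

text \<open>
  Let \<open>D\<close> be the supremum of the deviation. Near a point where the deviation is almost \<open>D\<close>, its
  average against the kernel is almost as large, by the Lipschitz bound on the second distribution
  function; but this average is controlled by the characteristic functions. A negative deviation is
  reduced to a positive one by reflection. The distance \<open>h = 16 / (\<pi> T)\<close> is chosen so that the
  kernel has mass at most \<open>1/4\<close> beyond it.
\<close>

theorem esseen_smoothing:
  assumes T: "T > 0" and M: "real_distribution M" and N: "real_distribution N"
    and lip: "\<And>x y. x \<le> y \<Longrightarrow> cdf N y - cdf N x \<le> m * (y - x)"
    and I: "integrable (unif 0 T) (\<lambda>t. cmod (char M t - char N t) / t)"
  shows "\<bar>cdf M x - cdf N x\<bar>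
     \<le> 4 / pi * (\<integral>t. cmod (char M t - char N t) / t \<partial>unif 0 T) + 24 * m / (pi * T)"
proof -
  interpret M: real_distribution M by fact
  interpret N: real_distribution N by fact
  interpret K: prob_space "fejer_measure T" by (rule prob_fejer_measure[OF T])
  note [measurable] = cdf_measurable[OF M] cdf_measurable[OF N]
  define \<Delta> where "\<Delta> = (\<lambda>x. cdf M x - cdf N x)"
  define \<eta> where "\<eta> = 2 / pi * (\<integral>t. cmod (char M t - char N t) / t \<partial>unif 0 T)"
  have [measurable]: "\<Delta> \<in> borel_measurable borel" unfolding \<Delta>_def by measurable
  \<comment> \<open>The tail bound \<open>4 / (\<pi> T h)\<close> of the kernel equals \<open>1/4\<close> at this distance.\<close>
  define h where "h = 16 / (pi * T)"
  have h: "h > 0" using T by (simp add: h_def)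
  define \<tau> where "\<tau> = measure (fejer_measure T) {y. \<bar>y\<bar> > h}"
  have "\<tau> = (\<integral>y. indicator {y. \<bar>y\<bar> > h} y \<partial>fejer_measure T)"
    unfolding \<tau>_def by simp
  also have "\<dots> = (\<integral>y. indicator {y. \<bar>y\<bar> > h} y * fejer T y \<partial>lborel)"
    by (subst integral_fejer_measure) (auto simp: T mult.commute)
  also have "\<dots> \<le> 4 / (pi * T * h)" by (rule fejer_tail[OF T h])
  also have "\<dots> = 1 / 4" using T by (simp add: h_def)
  finally have tau: "\<tau> \<le> 1/4" .
  have bd: "\<bar>\<Delta> z\<bar> \<le> 1" for z
    using M.cdf_nonneg[of z] M.cdf_bounded_prob[of z] N.cdf_nonneg[of z] N.cdf_bounded_prob[of z]
    by (auto simp: \<Delta>_def)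
  define D where "D = (SUP x. \<bar>\<Delta> x\<bar>)"
  have bdd: "bdd_above (range (\<lambda>x. \<bar>\<Delta> x\<bar>))" using bd by (auto intro!: bdd_aboveI[of _ 1])
  have D: "\<bar>\<Delta> z\<bar> \<le> D" for z unfolding D_def by (rule cSUP_upper[OF _ bdd]) simp
  have lip': "\<Delta> a - m * (b - a) \<le> \<Delta> b" if "a \<le> b" for a b
    using lip[OF that] M.cdf_nondecreasing[OF that] by (simp add: \<Delta>_def)
  have eta: "\<bar>\<integral>y. \<Delta> (z - y) \<partial>fejer_measure T\<bar> \<le> \<eta>" for z
    unfolding \<Delta>_def \<eta>_def by (rule smoothed_cdf_diff_le[OF T M N I])
  have up: "(\<Delta> z - m * h) * (1 - \<tau>) - D * \<tau> \<le> \<eta>" for z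
    unfolding \<tau>_def
  proof (rule one_sided_smoothing[OF _ T h D lip'])
    show "(\<integral>y. \<Delta> (x - y) \<partial>fejer_measure T) \<le> \<eta>" for x using eta[of x] by linarith
  qed auto
  have lo: "(- \<Delta> z - m * h) * (1 - \<tau>) - D * \<tau> \<le> \<eta>" for z
  proof -
    have "(- \<Delta> (- (- z)) - m * h) * (1 - \<tau>) - D * \<tau> \<le> \<eta>"
      unfolding \<tau>_def
    proof (rule one_sided_smoothing[where \<Delta>="\<lambda>y. - \<Delta> (- y)", OF _ T h])
      show "(\<integral>y. - \<Delta> (- (x - y)) \<partial>fejer_measure T) \<le> \<eta>" for x
      proof -
        have "(\<integral>y. \<Delta> (- x - (- y)) \<partial>fejer_measure T) = (\<integral>y. \<Delta> (- x - y) \<partial>fejer_measure T)"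
          by (rule integral_fejer_measure_reflect[OF _ T, of "\<lambda>y. \<Delta> (- x - y)"]) measurable
        moreover have "(\<lambda>y. \<Delta> (- (x - y))) = (\<lambda>y. \<Delta> (- x - (- y)))" by (simp add: algebra_simps)
        ultimately have "(\<integral>y. \<Delta> (- (x - y)) \<partial>fejer_measure T) = (\<integral>y. \<Delta> (- x - y) \<partial>fejer_measure T)"
          by simp
        thus ?thesis using eta[of "- x"] by (simp del: minus_diff_eq)
      qed
      show "- \<Delta> (- a) - m * (b - a) \<le> - \<Delta> (- b)" if "a \<le> b" for a b
        using lip'[of "- b" "- a"] that by simp
    qed (use D in auto)
    thus ?thesis by simp
  qed
  have pos: "1 - \<tau> > 0" using tau by simp
  have each: "\<bar>\<Delta> z\<bar> \<le> m * h + (\<eta> + D * \<tau>) / (1 - \<tau>)" for z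
  proof -
    have "(\<bar>\<Delta> z\<bar> - m * h) * (1 - \<tau>) \<le> \<eta> + D * \<tau>" using up[of z] lo[of z] by (cases "\<Delta> z \<ge> 0") auto
    hence "\<bar>\<Delta> z\<bar> - m * h \<le> (\<eta> + D * \<tau>) / (1 - \<tau>)" using pos by (simp add: pos_le_divide_eq)
    thus ?thesis by simp
  qed
  have "D \<le> m * h + (\<eta> + D * \<tau>) / (1 - \<tau>)"
    unfolding D_def by (rule cSUP_least) (use each in \<open>auto simp: D_def\<close>)
  hence "(D - m * h) * (1 - \<tau>) \<le> \<eta> + D * \<tau>" using pos by (simp add: pos_le_divide_eq[symmetric])
  hence 1: "D * (1 - 2 * \<tau>) \<le> m * h * (1 - \<tau>) + \<eta>" by (simp add: algebra_simps)
  have m0: "m \<ge> 0" using lip[of 0 1] N.cdf_nondecreasing[of 0 1] by simp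
  have e0: "\<eta> \<ge> 0" using eta[of 0] by linarith
  have "0 \<le> (m * h / 2 + \<eta>) * (1 - 4 * \<tau>)" using m0 e0 h tau by auto
  also have "\<dots> = (3/2 * (m * h) + 2 * \<eta>) * (1 - 2 * \<tau>) - (m * h * (1 - \<tau>) + \<eta>)"
    by (simp add: field_simps)
  finally have "D * (1 - 2 * \<tau>) \<le> (3/2 * (m * h) + 2 * \<eta>) * (1 - 2 * \<tau>)" using 1
    by (simp only: diff_ge_0_iff_ge)
  hence "D \<le> 3/2 * (m * h) + 2 * \<eta>" using tau by (auto dest: mult_right_le_imp_le)
  with D[of x] show ?thesis by (simp add: \<Delta>_def \<eta>_def h_def)
qed

section \<open>Transition kernels and the Markov property\<close>

context transition_kernel begin

lemma kernel_subprob [measurable]: "M \<in> borel \<rightarrow>\<^sub>M subprob_algebra borel"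
  using kernel by (rule measurable_prob_algebraD)

lemma prob_space_kernel: "prob_space (M x)"
  using measurable_space[OF kernel, of x] by (auto simp: space_prob_algebra)

lemma sets_kernel [measurable_cong, simp]: "sets (M x) = sets borel"
  using measurable_space[OF kernel, of x] by (auto simp: space_prob_algebra)

lemma space_kernel [simp]: "space (M x) = UNIV"
  using sets_eq_imp_space_eq[OF sets_kernel] by simp

lemma integrable_kernel:
  fixes f :: "'a \<Rightarrow> 'b::{banach, second_countable_topology}"
  assumes [measurable]: "f \<in> borel_measurable borel" and "\<And>x. norm (f x) \<le> C"
  shows "integrable (M x) f"
proof -
  interpret prob_space "M x" by (rule prob_space_kernel)
  show ?thesis by (rule integrable_const_bound[where B=C]) (use assms in auto)
qed

lemma averaging_op_le:
  fixes f :: "'a \<Rightarrow> 'b::{banach, second_countable_topology}"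
  assumes [measurable]: "f \<in> borel_measurable borel" and C: "\<And>x. norm (f x) \<le> C"
  shows "norm (averaging_op M f x) \<le> C"
proof -
  interpret prob_space "M x" by (rule prob_space_kernel)
  have "norm (averaging_op M f x) \<le> (\<integral>y. norm (f y) \<partial>M x)"
    unfolding averaging_op_def by (rule integral_norm_bound)
  also have "\<dots> \<le> (\<integral>y. C \<partial>M x)"
    by (rule integral_mono) (auto intro!: integrable_norm integrable_kernel C)
  finally show ?thesis using prob_space by simp
qed

lemma averaging_op_measurable [measurable]:
  fixes f :: "'a \<Rightarrow> 'b::{banach, second_countable_topology}"
  assumes [measurable]: "f \<in> borel_measurable borel"
  shows "averaging_op M f \<in> borel_measurable borel"
  unfolding averaging_op_def by (rule measurable_compose[OF kernel_subprob integral_measurable_subprob_algebra]) measurable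

lemma averaging_op_Re_Im:
  fixes f :: "'a \<Rightarrow> complex"
  assumes "f \<in> borel_measurable borel" and "\<And>x. cmod (f x) \<le> C"
  shows "Re (averaging_op M f x) = averaging_op M (\<lambda>y. Re (f y)) x"
    and "Im (averaging_op M f x) = averaging_op M (\<lambda>y. Im (f y)) x"
  using integrable_kernel[OF assms] by (simp_all add: averaging_op_def)

lemma integral_bind_kernel:
  fixes f :: "'a \<Rightarrow> real"
  assumes [measurable]: "f \<in> borel_measurable borel" and C: "\<And>x. \<bar>f x\<bar> \<le> C"
    and \<nu>: "finite_measure \<nu>" "sets \<nu> = sets borel"
  shows "integral\<^sup>L (\<nu> \<bind> M) f = (\<integral>x. averaging_op M f x \<partial>\<nu>)"
  unfolding averaging_op_def
proof (rule integral_bind[where K=borel and B'=1 and B=C])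
  show "M \<in> \<nu> \<rightarrow>\<^sub>M subprob_algebra borel"
    using kernel_subprob by (simp cong: measurable_cong_sets add: \<nu>)
  show "AE x in \<nu>. emeasure (M x) (space (M x)) \<le> ennreal 1"
    using prob_space.emeasure_space_1[OF prob_space_kernel] by simp
qed (use \<nu> C in auto)

end

context markov_chain begin

lemma random_variable' [measurable]: "\<xi> k \<in> P \<rightarrow>\<^sub>M borel"
  by (rule random_variable)

lemma sets_past_algebra: "sets (past_algebra P \<xi> k) =
    sigma_sets (space P) {\<xi> i -` A \<inter> space P |i A. i \<le> k \<and> A \<in> sets borel}"
  unfolding past_algebra_def by (rule sets_measure_of) auto

lemma space_past_algebra [simp]: "space (past_algebra P \<xi> k) = space P"
  unfolding past_algebra_def by (rule space_measure_of) auto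

lemma subalgebra_past: "subalgebra P (past_algebra P \<xi> k)"
  unfolding subalgebra_def sets_past_algebra
proof (intro conjI sets.sigma_sets_subset)
  show "{\<xi> i -` A \<inter> space P |i A. i \<le> k \<and> A \<in> sets borel} \<subseteq> sets P"
    using measurable_sets[OF random_variable] by blast
qed simp

lemma measurable_past: "i \<le> k \<Longrightarrow> \<xi> i \<in> past_algebra P \<xi> k \<rightarrow>\<^sub>M borel"
  by (rule measurableI) (auto simp: sets_past_algebra)

text \<open>
  With \<open>Y\<close> as a density with respect to \<open>P\<close>, the law of the next state is the law of the present state
  followed by the kernel. On sets this is the definition of conditional
  expectation; comparing measures gives it for all bounded functions at once.
\<close>

lemma transition_expectation_nonneg:
  fixes f :: "'a \<Rightarrow> real" and Y :: "'w \<Rightarrow> real"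
  assumes Y [measurable]: "Y \<in> borel_measurable (past_algebra P \<xi> k)"
    and Y0: "\<And>w. 0 \<le> Y w" and YC: "\<And>w. Y w \<le> C"
    and [measurable]: "f \<in> borel_measurable borel" and D: "\<And>x. \<bar>f x\<bar> \<le> D"
  shows "(\<integral>w. Y w * f (\<xi> (Suc k) w) \<partial>P) = (\<integral>w. Y w * averaging_op M f (\<xi> k w) \<partial>P)"
proof -
  have YP [measurable]: "Y \<in> borel_measurable P"
    by (rule measurable_from_subalg[OF subalgebra_past Y])
  have CC: "0 \<le> C" using order.trans[OF Y0 YC] .
  interpret finite_measure_subalgebra P "past_algebra P \<xi> k"
    using subalgebra_past by unfold_locales
  define Q where "Q = density P (\<lambda>w. ennreal (Y w))"
  have [simp]: "sets Q = sets P" "space Q = space P" by (auto simp: Q_def)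
  have [measurable_cong]: "sets Q = sets P" by simp
  have Qfin: "finite_measure Q"
  proof (rule finite_measureI)
    have "emeasure Q (space Q) = (\<integral>\<^sup>+w. ennreal (Y w) \<partial>P)"
      by (simp add: Q_def emeasure_density)
    also have "\<dots> \<le> (\<integral>\<^sup>+w. ennreal C \<partial>P)" by (intro nn_integral_mono ennreal_leI YC)
    also have "\<dots> < \<infinity>" by (simp add: emeasure_space_1 ennreal_mult_less_top)
    finally show "emeasure Q (space Q) \<noteq> \<infinity>" by simp
  qed
  have dfin: "finite_measure (distr Q borel (\<xi> k))"
    by (rule finite_measure.finite_measure_distr[OF Qfin]) measurable
  have eq: "distr Q borel (\<xi> (Suc k)) = distr Q borel (\<xi> k) \<bind> M"
  proof (rule measure_eqI)
    fix B assume "B \<in> sets (distr Q borel (\<xi> (Suc k)))"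
    hence B [measurable]: "B \<in> sets borel" by simp
    define g where "g = (\<lambda>w. indicator (\<xi> (Suc k) -` B \<inter> space P) w :: real)"
    have [measurable]: "g \<in> borel_measurable P" unfolding g_def by measurable
    have mB: "(\<lambda>x. measure (M x) B) \<in> borel_measurable borel" by measurable
    have intg: "integrable P (\<lambda>w. Y w * g w)"
      by (rule integrable_const_bound[where B=C]) (use Y0 YC CC in \<open>auto simp: g_def indicator_def\<close>)
    have "emeasure (distr Q borel (\<xi> (Suc k))) B = emeasure Q (\<xi> (Suc k) -` B \<inter> space P)"
      by (simp add: emeasure_distr)
    also have "\<dots> = (\<integral>\<^sup>+w. ennreal (Y w * g w) \<partial>P)"
      unfolding Q_def by (subst emeasure_density) (auto simp: g_def indicator_def intro!: nn_integral_cong)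
    also have "\<dots> = ennreal (\<integral>w. Y w * g w \<partial>P)"
      by (rule nn_integral_eq_integral[OF intg]) (auto simp: Y0 g_def)
    also have "(\<integral>w. Y w * g w \<partial>P) = (\<integral>w. Y w * real_cond_exp P (past_algebra P \<xi> k) g w \<partial>P)"
      by (rule real_cond_exp_intg(2)[symmetric]) (auto simp: intg)
    also have "\<dots> = (\<integral>w. Y w * measure (M (\<xi> k w)) B \<partial>P)"
    proof (rule integral_cong_AE)
      show "AE w in P. Y w * real_cond_exp P (past_algebra P \<xi> k) g w = Y w * measure (M (\<xi> k w)) B"
        using transition[OF B, of k] unfolding g_def by eventually_elim simp
      show "(\<lambda>w. Y w * measure (M (\<xi> k w)) B) \<in> borel_measurable P"
        using mB by measurable
    qed measurable
    also have "ennreal \<dots> = (\<integral>\<^sup>+w. ennreal (Y w * measure (M (\<xi> k w)) B) \<partial>P)"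
    proof (rule nn_integral_eq_integral[symmetric])
      show "integrable P (\<lambda>w. Y w * measure (M (\<xi> k w)) B)"
      proof (rule integrable_const_bound[where B=C])
        show "AE w in P. norm (Y w * measure (M (\<xi> k w)) B) \<le> C"
        proof (rule AE_I2)
          fix w
          have "measure (M (\<xi> k w)) B \<le> 1"
            by (rule prob_space.prob_le_1[OF prob_space_kernel])
          hence "Y w * measure (M (\<xi> k w)) B \<le> C * 1"
            by (intro mult_mono YC) (use Y0 CC in auto)
          thus "norm (Y w * measure (M (\<xi> k w)) B) \<le> C" by (simp add: Y0)
        qed
        show "(\<lambda>w. Y w * measure (M (\<xi> k w)) B) \<in> borel_measurable P"
          using mB by measurable
      qed
    qed (auto simp: Y0)
    also have "\<dots> = (\<integral>\<^sup>+w. ennreal (Y w) * emeasure (M (\<xi> k w)) B \<partial>P)"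
      using finite_measure.emeasure_eq_measure[OF prob_space.finite_measure[OF prob_space_kernel]]
      by (simp add: ennreal_mult Y0)
    also have "\<dots> = (\<integral>\<^sup>+w. emeasure (M (\<xi> k w)) B \<partial>Q)"
      unfolding Q_def by (subst nn_integral_density) auto
    also have "\<dots> = (\<integral>\<^sup>+x. emeasure (M x) B \<partial>distr Q borel (\<xi> k))"
      by (subst nn_integral_distr) auto
    also have "\<dots> = emeasure (distr Q borel (\<xi> k) \<bind> M) B"
      by (rule emeasure_bind[symmetric, where N=borel]) 
        (auto simp: space_distr cong: measurable_cong_sets)
    finally show "emeasure (distr Q borel (\<xi> (Suc k))) B = emeasure (distr Q borel (\<xi> k) \<bind> M) B" .
  next
    show "sets (distr Q borel (\<xi> (Suc k))) = sets (distr Q borel (\<xi> k) \<bind> M)"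
      by (subst sets_bind[where N=borel]) auto
  qed
  have "(\<integral>w. Y w * f (\<xi> (Suc k) w) \<partial>P) = integral\<^sup>L Q (\<lambda>w. f (\<xi> (Suc k) w))"
    unfolding Q_def by (subst integral_density) (auto simp: Y0)
  also have "\<dots> = integral\<^sup>L (distr Q borel (\<xi> (Suc k))) f"
    by (rule integral_distr[symmetric]) measurable
  also have "\<dots> = (\<integral>x. averaging_op M f x \<partial>distr Q borel (\<xi> k))"
    unfolding eq by (rule integral_bind_kernel[OF _ D dfin]) auto
  also have "\<dots> = integral\<^sup>L Q (\<lambda>w. averaging_op M f (\<xi> k w))"
    by (rule integral_distr) measurable
  also have "\<dots> = (\<integral>w. Y w * averaging_op M f (\<xi> k w) \<partial>P)"
    unfolding Q_def by (subst integral_density) (auto simp: Y0)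
  finally show ?thesis .
qed

lemma integrable_past_times:
  fixes f :: "'a \<Rightarrow> 'b::{real_normed_algebra, banach, second_countable_topology}" and Y :: "'w \<Rightarrow> 'b"
  assumes Y [measurable]: "Y \<in> borel_measurable (past_algebra P \<xi> k)" and YC: "\<And>w. norm (Y w) \<le> C"
    and [measurable]: "f \<in> borel_measurable borel" and D: "\<And>x. norm (f x) \<le> D"
  shows "integrable P (\<lambda>w. Y w * f (\<xi> j w))"
proof (rule integrable_const_bound[where B="C * D"])
  have [measurable]: "Y \<in> borel_measurable P"
    by (rule measurable_from_subalg[OF subalgebra_past Y])
  show "(\<lambda>w. Y w * f (\<xi> j w)) \<in> borel_measurable P" by measurable
  show "AE w in P. norm (Y w * f (\<xi> j w)) \<le> C * D"
    by (intro AE_I2 order.trans[OF norm_mult_ineq] mult_mono YC D)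
       (use order.trans[OF norm_ge_zero YC] in auto)
qed

text \<open>
  Adding the constant \<open>C\<close> to \<open>Y\<close> reduces to a nonnegative weight.
\<close>

lemma transition_expectation_real:
  fixes f :: "'a \<Rightarrow> real" and Y :: "'w \<Rightarrow> real"
  assumes Y: "Y \<in> borel_measurable (past_algebra P \<xi> k)" and YC: "\<And>w. \<bar>Y w\<bar> \<le> C"
    and f: "f \<in> borel_measurable borel" and D: "\<And>x. \<bar>f x\<bar> \<le> D"
  shows "(\<integral>w. Y w * f (\<xi> (Suc k) w) \<partial>P) = (\<integral>w. Y w * averaging_op M f (\<xi> k w) \<partial>P)"
proof -
  have C0: "0 \<le> C" using order.trans[OF abs_ge_zero YC] .
  have C2: "0 \<le> Y w + C" "Y w + C \<le> 2 * C" and C3: "\<bar>Y w + C\<bar> \<le> 2 * C" for w using YC[of w] by auto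
  have Y': "(\<lambda>w. Y w + C) \<in> borel_measurable (past_algebra P \<xi> k)" using Y by measurable
  have split: "(\<integral>w. Y w * u (\<xi> j w) \<partial>P) = (\<integral>w. (Y w + C) * u (\<xi> j w) \<partial>P) - (\<integral>w. C * u (\<xi> j w) \<partial>P)"
    if u: "u \<in> borel_measurable borel" "\<And>x. \<bar>u x\<bar> \<le> D" for u :: "'a \<Rightarrow> real" and j
  proof -
    have "integrable P (\<lambda>w. (Y w + C) * u (\<xi> j w))"
      by (rule integrable_past_times[OF Y', of "2 * C" _ D]) (use C3 u in auto)
    moreover have "integrable P (\<lambda>w. C * u (\<xi> j w))"
      by (rule integrable_past_times[of "\<lambda>_. C" k "C" _ D]) (use C0 u in auto)
    ultimately show ?thesis
      by (subst Bochner_Integration.integral_diff[symmetric]) (auto simp: algebra_simps)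
  qed
  have L: "\<bar>averaging_op M f x\<bar> \<le> D" for x using averaging_op_le[OF f, of D] D by simp
  show ?thesis
    unfolding split[OF f D] split[OF averaging_op_measurable[OF f] L]
    using transition_expectation_nonneg[OF Y' C2 f D]
      transition_expectation_nonneg[of "\<lambda>_. C" k C f D] C0 f D by simp
qed

lemma transition_expectation:
  fixes f :: "'a \<Rightarrow> complex" and Y :: "'w \<Rightarrow> complex"
  assumes Y: "Y \<in> borel_measurable (past_algebra P \<xi> k)" and YC: "\<And>w. cmod (Y w) \<le> C"
    and f: "f \<in> borel_measurable borel" and D: "\<And>x. cmod (f x) \<le> D"
  shows "(\<integral>w. Y w * f (\<xi> (Suc k) w) \<partial>P) = (\<integral>w. Y w * averaging_op M f (\<xi> k w) \<partial>P)"
proof -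
  have Yb: "\<bar>Re (Y w)\<bar> \<le> C" "\<bar>Im (Y w)\<bar> \<le> C" for w
    using YC[of w] abs_Re_le_cmod[of "Y w"] abs_Im_le_cmod[of "Y w"] by linarith+
  have Ym: "(\<lambda>w. Re (Y w)) \<in> borel_measurable (past_algebra P \<xi> k)"
    "(\<lambda>w. Im (Y w)) \<in> borel_measurable (past_algebra P \<xi> k)" using Y by measurable
  have ub: "\<bar>Re (u x)\<bar> \<le> D" "\<bar>Im (u x)\<bar> \<le> D" if "\<And>x. cmod (u x) \<le> D" for u :: "'a \<Rightarrow> complex" and x
    using that[of x] abs_Re_le_cmod[of "u x"] abs_Im_le_cmod[of "u x"] by linarith+
  have um: "(\<lambda>w. Re (u w)) \<in> borel_measurable borel" "(\<lambda>w. Im (u w)) \<in> borel_measurable borel"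
    if "u \<in> borel_measurable borel" for u :: "'a \<Rightarrow> complex" using that by measurable
  have split: 
    "Re (\<integral>w. Y w * u (\<xi> j w) \<partial>P) = (\<integral>w. Re (Y w) * Re (u (\<xi> j w)) \<partial>P) - (\<integral>w. Im (Y w) * Im (u (\<xi> j w)) \<partial>P)"
    "Im (\<integral>w. Y w * u (\<xi> j w) \<partial>P) = (\<integral>w. Re (Y w) * Im (u (\<xi> j w)) \<partial>P) + (\<integral>w. Im (Y w) * Re (u (\<xi> j w)) \<partial>P)"
    if u: "u \<in> borel_measurable borel" "\<And>x. cmod (u x) \<le> D" for u :: "'a \<Rightarrow> complex" and j
  proof -
    have r: "norm (Re (u x)) \<le> D" "norm (Im (u x)) \<le> D" for x using ub[of u, OF u(2)] by simp_all
    have i: "integrable P (\<lambda>w. Y w * u (\<xi> j w))" by (rule integrable_past_times[OF Y YC u])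
    have i': "integrable P (\<lambda>w. Re (Y w) * Re (u (\<xi> j w)))" "integrable P (\<lambda>w. Im (Y w) * Im (u (\<xi> j w)))"
      "integrable P (\<lambda>w. Re (Y w) * Im (u (\<xi> j w)))" "integrable P (\<lambda>w. Im (Y w) * Re (u (\<xi> j w)))"
      using integrable_past_times[OF Ym(1) _ um(1)[OF u(1)] r(1), of C j] integrable_past_times[OF Ym(2) _ um(2)[OF u(1)] r(2), of C j]
        integrable_past_times[OF Ym(1) _ um(2)[OF u(1)] r(2), of C j] integrable_past_times[OF Ym(2) _ um(1)[OF u(1)] r(1), of C j] Yb
      by simp_all
    show "Re (\<integral>w. Y w * u (\<xi> j w) \<partial>P) = (\<integral>w. Re (Y w) * Re (u (\<xi> j w)) \<partial>P) - (\<integral>w. Im (Y w) * Im (u (\<xi> j w)) \<partial>P)"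
      using integral_Re[OF i] i' by simp
    show "Im (\<integral>w. Y w * u (\<xi> j w) \<partial>P) = (\<integral>w. Re (Y w) * Im (u (\<xi> j w)) \<partial>P) + (\<integral>w. Im (Y w) * Re (u (\<xi> j w)) \<partial>P)"
      using integral_Im[OF i] i' by simp
  qed
  have L: "cmod (averaging_op M f x) \<le> D" for x by (rule averaging_op_le[OF f D])
  have T: "(\<integral>w. y w * v (\<xi> (Suc k) w) \<partial>P) = (\<integral>w. y w * averaging_op M v (\<xi> k w) \<partial>P)"
    if "y \<in> {\<lambda>w. Re (Y w), \<lambda>w. Im (Y w)}" "v \<in> {\<lambda>x. Re (f x), \<lambda>x. Im (f x)}" for y v
    by (rule transition_expectation_real[where C=C and D=D]) (use that Ym Yb ub[OF D] um[OF f] in auto)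
  note split' = split[OF f D] split[OF averaging_op_measurable[OF f] L]
  show ?thesis
  proof (rule complex_eqI)
    show "Re (\<integral>w. Y w * f (\<xi> (Suc k) w) \<partial>P) = Re (\<integral>w. Y w * averaging_op M f (\<xi> k w) \<partial>P)"
      unfolding split' averaging_op_Re_Im[OF f D]
      using T[of "\<lambda>w. Re (Y w)" "\<lambda>x. Re (f x)"] T[of "\<lambda>w. Im (Y w)" "\<lambda>x. Im (f x)"] by simp
    show "Im (\<integral>w. Y w * f (\<xi> (Suc k) w) \<partial>P) = Im (\<integral>w. Y w * averaging_op M f (\<xi> k w) \<partial>P)"
      unfolding split' averaging_op_Re_Im[OF f D]
      using T[of "\<lambda>w. Re (Y w)" "\<lambda>x. Im (f x)"] T[of "\<lambda>w. Im (Y w)" "\<lambda>x. Re (f x)"] by simp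
  qed
qed

end

text \<open>
  The operator whose iterates generate the characteristic functions of the partial sums.
\<close>

definition tilted_op :: "('a \<Rightarrow> 'a measure) \<Rightarrow> real \<Rightarrow> ('a \<Rightarrow> real) \<Rightarrow> ('a \<Rightarrow> complex) \<Rightarrow> 'a \<Rightarrow> complex" where
  "tilted_op M s \<phi> h = averaging_op M (\<lambda>x. iexp (s * \<phi> x) * h x)"

context transition_kernel begin

lemma tilted_op_measurable:
  assumes [measurable]: "\<phi> \<in> borel_measurable borel" "h \<in> borel_measurable borel"
  shows "tilted_op M s \<phi> h \<in> borel_measurable borel"
  unfolding tilted_op_def by measurable

lemma tilted_op_le:
  assumes [measurable]: "\<phi> \<in> borel_measurable borel" "h \<in> borel_measurable borel"
    and "\<And>x. cmod (h x) \<le> D"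
  shows "cmod (tilted_op M s \<phi> h x) \<le> D"
  unfolding tilted_op_def by (rule averaging_op_le) (use assms in \<open>auto simp: norm_mult\<close>)

end

context markov_chain begin

text \<open>
  Conditioning on the past up to time \<open>n\<close> absorbs the last summand into the tilted operator. The
  function \<open>h\<close> of the last state is what makes the induction go through.
\<close>

lemma char_partial_sum:
  assumes \<phi> [measurable]: "\<phi> \<in> borel_measurable borel"
    and h: "h \<in> borel_measurable borel" and D: "\<And>x. cmod (h x) \<le> D"
  shows "(\<integral>w. iexp (s * (\<Sum>k=1..n. \<phi> (\<xi> k w))) * h (\<xi> n w) \<partial>P) = (\<integral>w. (tilted_op M s \<phi> ^^ n) h (\<xi> 0 w) \<partial>P)"
  using h D
proof (induction n arbitrary: h)
  case 0
  thus ?case by simp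
next
  case (Suc n)
  note [measurable] = Suc.prems(1)
  have "(\<integral>w. iexp (s * (\<Sum>k=1..Suc n. \<phi> (\<xi> k w))) * h (\<xi> (Suc n) w) \<partial>P)
      = (\<integral>w. iexp (s * (\<Sum>k=1..n. \<phi> (\<xi> k w))) * (\<lambda>x. iexp (s * \<phi> x) * h x) (\<xi> (Suc n) w) \<partial>P)"
    by (simp add: algebra_simps exp_add)
  also have "\<dots> = (\<integral>w. iexp (s * (\<Sum>k=1..n. \<phi> (\<xi> k w))) * averaging_op M (\<lambda>x. iexp (s * \<phi> x) * h x) (\<xi> n w) \<partial>P)"
  proof (rule transition_expectation[where C=1 and D=D])
    have "(\<lambda>w. \<phi> (\<xi> k w)) \<in> borel_measurable (past_algebra P \<xi> n)" if "k \<in> {1..n}" for k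
      by (rule measurable_compose[OF measurable_past \<phi>]) (use that in auto)
    hence [measurable]: "(\<lambda>w. \<Sum>k=1..n. \<phi> (\<xi> k w)) \<in> borel_measurable (past_algebra P \<xi> n)"
      by (rule borel_measurable_sum)
    show "(\<lambda>w. iexp (s * (\<Sum>k=1..n. \<phi> (\<xi> k w)))) \<in> borel_measurable (past_algebra P \<xi> n)"
      by measurable
  qed (use Suc.prems in \<open>auto simp: norm_mult\<close>)
  also have "\<dots> = (\<integral>w. (tilted_op M s \<phi> ^^ n) (tilted_op M s \<phi> h) (\<xi> 0 w) \<partial>P)"
    unfolding tilted_op_def[symmetric]
    by (rule Suc.IH) (use Suc.prems in \<open>auto intro!: tilted_op_measurable tilted_op_le\<close>)
  finally show ?case by (simp only: funpow_Suc_right o_apply)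
qed

end

section \<open>Complex functions over the algebra\<close>

context banach_function_algebra begin

lemma N_nonneg: "f \<in> X \<Longrightarrow> 0 \<le> N f"
  using norm_ge_uniform[of f undefined] norm_ge_zero order.trans by blast

lemma N_const: "N (\<lambda>x. c) = norm c"
  using norm_scale[OF const_closed[of 1], of c] norm_one by simp

text \<open>
  The scalar field has no real part function. Adding the bound \<open>N\<close> makes the function nonnegative, and
  then it can be read off from its norm.
\<close>

lemma real_measurable:
  assumes "(\<lambda>x. of_real (f x)) \<in> X"
  shows "f \<in> borel_measurable borel"
proof -
  let ?g = "\<lambda>x. of_real (f x) :: 'k"
  have [measurable]: "?g \<in> borel_measurable borel" using assms measurable by auto
  have "f x = norm (?g x + of_real (N ?g)) - N ?g" for x
    using norm_ge_uniform[OF assms, of x] by (simp flip: of_real_add)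
  hence "f = (\<lambda>x. norm (?g x + of_real (N ?g)) - N ?g)" by blast
  thus ?thesis by (rule ssubst) measurable
qed

lemma real_bound: "(\<lambda>x. of_real (f x)) \<in> X \<Longrightarrow> \<bar>f x\<bar> \<le> N (\<lambda>x. of_real (f x))"
  using norm_ge_uniform[of "\<lambda>x. of_real (f x)" x] by simp

text \<open>
  For a real algebra, this says that the Taylor complexification norm of \<open>h\<close>, the supremum over all
  rotations of the norm of the real part, is at most \<open>b\<close>. The predicate records
  membership in the complexification at the same time. The real part of a rotated function is
  again embedded in the scalars of the algebra, so that real and complex algebras are treated alike.
\<close>

definition bounded_by :: "('a \<Rightarrow> complex) \<Rightarrow> real \<Rightarrow> bool" where
  "bounded_by h b \<longleftrightarrow> (\<forall>\<theta>. (\<lambda>x. of_real (Re (cis \<theta> * h x))) \<in> X \<and>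
      N (\<lambda>x. of_real (Re (cis \<theta> * h x))) \<le> b)"

lemma bounded_byD:
  assumes "bounded_by h b"
  shows "(\<lambda>x. of_real (Re (cis \<theta> * h x))) \<in> X" "N (\<lambda>x. of_real (Re (cis \<theta> * h x))) \<le> b"
  using assms by (auto simp: bounded_by_def)

lemma bounded_by_norm: 
  assumes "bounded_by h b"
  shows "cmod (h x) \<le> b"
proof -
  have "cis (- Arg (h x)) * h x = of_real (cmod (h x))"
    by (metis cis_mult cis_zero left_minus mult.left_commute mult.right_neutral rcis_cmod_Arg rcis_def)
  hence "cmod (h x) = norm (of_real (Re (cis (- Arg (h x)) * h x)) :: 'k)" by simp
  also have "\<dots> \<le> N (\<lambda>y. of_real (Re (cis (- Arg (h x)) * h y)))"
    by (rule norm_ge_uniform[OF bounded_byD(1)[OF assms]])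
  also have "\<dots> \<le> b" by (rule bounded_byD(2)[OF assms])
  finally show ?thesis .
qed

lemma bounded_by_nonneg: "bounded_by h b \<Longrightarrow> 0 \<le> b"
  using bounded_by_norm[of h b undefined] norm_ge_zero order.trans by blast

lemma bounded_by_measurable: 
  assumes "bounded_by h b"
  shows "h \<in> borel_measurable borel"
proof -
  have "(\<lambda>x. Re (h x)) \<in> borel_measurable borel"
    using real_measurable[OF bounded_byD(1)[OF assms, of 0]] by simp
  moreover have "(\<lambda>x. Im (h x)) \<in> borel_measurable borel"
    using real_measurable[OF bounded_byD(1)[OF assms, of "- pi / 2"]] by simp
  ultimately show ?thesis using borel_measurable_complex_iff by blast
qed

lemma bounded_by_mono: "bounded_by h b \<Longrightarrow> b \<le> b' \<Longrightarrow> bounded_by h b'"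
  unfolding bounded_by_def by (meson order.trans)

lemma bounded_by_const: "bounded_by (\<lambda>_. c) (cmod c)"
  unfolding bounded_by_def
proof (intro allI conjI)
  fix \<theta>
  have "\<bar>Re (cis \<theta> * c)\<bar> \<le> cmod c" using abs_Re_le_cmod[of "cis \<theta> * c"] by (simp only: norm_mult norm_cis mult_1)
  thus "N (\<lambda>x. of_real (Re (cis \<theta> * c))) \<le> cmod c" by (simp only: N_const norm_of_real)
qed (rule const_closed)

lemma bounded_by_add:
  assumes "bounded_by g a" "bounded_by h b"
  shows "bounded_by (\<lambda>x. g x + h x) (a + b)"
proof -
  have "(\<lambda>x. of_real (Re (cis \<theta> * (g x + h x)))) = (\<lambda>x. of_real (Re (cis \<theta> * g x)) + (of_real (Re (cis \<theta> * h x)) :: 'k))" for \<theta>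
    by (simp add: algebra_simps)
  moreover have "N (\<lambda>x. of_real (Re (cis \<theta> * g x)) + of_real (Re (cis \<theta> * h x))) \<le> a + b" for \<theta>
    by (rule order.trans[OF norm_triangle add_mono]; rule bounded_byD[OF assms(1)] bounded_byD[OF assms(2)])
  ultimately show ?thesis 
    unfolding bounded_by_def using add_closed[OF bounded_byD(1)[OF assms(1)] bounded_byD(1)[OF assms(2)]] by simp
qed

lemma bounded_by_scale:
  assumes "bounded_by h b"
  shows "bounded_by (\<lambda>x. c * h x) (cmod c * b)"
  unfolding bounded_by_def
proof (intro allI)
  fix \<theta>
  have "cis \<theta> * (c * h x) = of_real (cmod c) * (cis (\<theta> + Arg c) * h x)" for x
    by (metis cis_mult mult.assoc mult.left_commute rcis_cmod_Arg rcis_def)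
  hence *: "(\<lambda>x. of_real (Re (cis \<theta> * (c * h x))) :: 'k) = (\<lambda>x. of_real (cmod c) * of_real (Re (cis (\<theta> + Arg c) * h x)))"
    by (simp only: Re_complex_of_real Im_complex_of_real times_complex.sel mult_zero_left diff_zero of_real_mult)
  show "(\<lambda>x. of_real (Re (cis \<theta> * (c * h x)))) \<in> X \<and> N (\<lambda>x. of_real (Re (cis \<theta> * (c * h x)))) \<le> cmod c * b"
    unfolding * using bounded_byD[OF assms, of "\<theta> + Arg c"]
    by (simp add: scale_closed norm_scale mult_left_mono)
qed

lemma bounded_by_diff:
  assumes "bounded_by g a" "bounded_by h b"
  shows "bounded_by (\<lambda>x. g x - h x) (a + b)"
  using bounded_by_add[OF assms(1) bounded_by_scale[OF assms(2), of "-1"]] by simp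

text \<open>
  Multiplication by a real function commutes with rotations and real parts, so the
  submultiplicativity of \<open>N\<close> carries over. The complex factor \<open>exp (i s \<phi>)\<close> is reached from here through its power
  series in the real function \<open>\<phi>\<close>.
\<close>

lemma bounded_by_real_mult:
  assumes f: "(\<lambda>x. of_real (f x)) \<in> X" "N (\<lambda>x. of_real (f x)) \<le> a" and h: "bounded_by h b"
  shows "bounded_by (\<lambda>x. of_real (f x) * h x) (a * b)"
  unfolding bounded_by_def
proof (intro allI)
  fix \<theta>
  have *: "(\<lambda>x. of_real (Re (cis \<theta> * (of_real (f x) * h x))) :: 'k) = (\<lambda>x. of_real (f x) * of_real (Re (cis \<theta> * h x)))"
    by (simp add: algebra_simps)
  note H = bounded_byD[OF h, of \<theta>]
  have "N (\<lambda>x. of_real (f x) * of_real (Re (cis \<theta> * h x))) \<le> a * b"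
    by (rule order.trans[OF norm_mult_le[OF f(1) H(1)]]) (intro mult_mono f(2) H(2) N_nonneg H(1) order.trans[OF N_nonneg[OF f(1)] f(2)])
  thus "(\<lambda>x. of_real (Re (cis \<theta> * (of_real (f x) * h x)))) \<in> X \<and> N (\<lambda>x. of_real (Re (cis \<theta> * (of_real (f x) * h x)))) \<le> a * b"
    unfolding * using mult_closed[OF f(1) H(1)] by simp
qed

lemma bounded_by_of_real:
  assumes "(\<lambda>x. of_real (f x)) \<in> X" "N (\<lambda>x. of_real (f x)) \<le> a"
  shows "bounded_by (\<lambda>x. of_real (f x)) a"
  using bounded_by_real_mult[OF assms bounded_by_const[of 1]] by simp

lemma bounded_by_sum:
  assumes "\<And>k. k \<in> A \<Longrightarrow> bounded_by (h k) (b k)"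
  shows "bounded_by (\<lambda>x. \<Sum>k\<in>A. h k x) (\<Sum>k\<in>A. b k)"
  using assms
proof (induction A rule: infinite_finite_induct)
  case (insert k A)
  thus ?case using bounded_by_add[of "h k" "b k"] by simp
qed (use bounded_by_const[of 0] in auto)

text \<open>
  Completeness of the algebra, applied to the partial sums of each rotation. Convergence in norm is
  uniform, which identifies the limit with the pointwise sum.
\<close>

lemma bounded_by_suminf:
  assumes h: "\<And>k. bounded_by (h k) (b k)" and b: "summable b"
    and H: "\<And>x. (\<lambda>k. h k x) sums H x"
  shows "bounded_by H (suminf b)"
  unfolding bounded_by_def
proof (intro allI)
  fix \<theta>
  define s where "s = (\<lambda>n x. of_real (Re (cis \<theta> * (\<Sum>k<n. h k x))) :: 'k)"
  have b0: "0 \<le> b k" for k by (rule bounded_by_nonneg[OF h])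
  have sX: "s n \<in> X" for n unfolding s_def by (rule bounded_byD(1)[OF bounded_by_sum]) (rule h)
  have sN: "N (s n) \<le> suminf b" for n
  proof -
    have "N (s n) \<le> (\<Sum>k<n. b k)" unfolding s_def by (rule bounded_byD(2)[OF bounded_by_sum]) (rule h)
    also have "\<dots> \<le> suminf b" by (rule sum_le_suminf[OF b]) (use b0 in auto)
    finally show ?thesis .
  qed
  have inc: "N (\<lambda>x. s m x - s n x) \<le> (\<Sum>k\<in>{n..<m}. b k)" if "n \<le> m" for m n
  proof -
    have "(\<lambda>x. s m x - s n x) = (\<lambda>x. of_real (Re (cis \<theta> * (\<Sum>k\<in>{n..<m}. h k x))))"
    proof
      fix x
      have "(\<Sum>k\<in>{n..<m}. h k x) = (\<Sum>k<m. h k x) - (\<Sum>k<n. h k x)"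
        using that by (simp add: sum_diff_nat_ivl[of 0 n m, symmetric] lessThan_atLeast0)
      thus "s m x - s n x = of_real (Re (cis \<theta> * (\<Sum>k\<in>{n..<m}. h k x)))"
        by (simp add: s_def right_diff_distrib)
    qed
    thus ?thesis using bounded_byD(2)[OF bounded_by_sum[of "{n..<m}" h b]] h by simp
  qed
  have sym: "N (\<lambda>x. s m x - s n x) = N (\<lambda>x. s n x - s m x)" for m n
  proof -
    have "(\<lambda>x. s m x - s n x) \<in> X"
      using add_closed[OF sX[of m] scale_closed[OF sX[of n], of "-1"]] by simp
    from norm_scale[OF this, of "-1"] show ?thesis by simp
  qed
  have "\<forall>e>0. \<exists>n0. \<forall>m\<ge>n0. \<forall>n\<ge>n0. N (\<lambda>x. s m x - s n x) < e"
  proof (intro allI impI)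
    fix e :: real assume "e > 0"
    then obtain n0 where n0: "\<And>m n. m \<ge> n0 \<Longrightarrow> norm (sum b {m..<n}) < e"
      using b unfolding summable_Cauchy by blast
    have "N (\<lambda>x. s m x - s n x) < e" if "m \<ge> n0" "n \<ge> n0" for m n
    proof (cases "n \<le> m")
      case True
      thus ?thesis using inc[OF True] n0[OF that(2), of m] by auto
    next
      case False
      hence "m \<le> n" by simp
      thus ?thesis using inc[of m n] n0[OF that(1), of n] sym[of m n] by auto
    qed
    thus "\<exists>n0. \<forall>m\<ge>n0. \<forall>n\<ge>n0. N (\<lambda>x. s m x - s n x) < e" by blast
  qed
  from complete[OF sX this] obtain f where f: "f \<in> X" "(\<lambda>n. N (\<lambda>x. s n x - f x)) \<longlonglongrightarrow> 0" by blast
  have dX: "(\<lambda>x. s n x - f x) \<in> X" for n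
    using add_closed[OF sX[of n] scale_closed[OF f(1), of "-1"]] by simp
  have "f x = of_real (Re (cis \<theta> * H x))" for x
  proof (rule LIMSEQ_unique)
    have "(\<lambda>n. s n x - f x) \<longlonglongrightarrow> 0"
      by (rule Lim_null_comparison[OF _ f(2)]) (auto intro!: always_eventually norm_ge_uniform[OF dX])
    thus "(\<lambda>n. s n x) \<longlonglongrightarrow> f x" by (simp add: LIM_zero_iff)
    show "(\<lambda>n. s n x) \<longlonglongrightarrow> of_real (Re (cis \<theta> * H x))"
      unfolding s_def using H[of x] unfolding sums_def by (intro tendsto_intros)
  qed
  hence fe: "(\<lambda>x. of_real (Re (cis \<theta> * H x))) = f" by auto
  have "N f \<le> suminf b + N (\<lambda>x. s n x - f x)" for n
  proof -
    have "N (\<lambda>x. s n x + (-1) * (s n x - f x)) \<le> N (s n) + N (\<lambda>x. (-1) * (s n x - f x))"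
      by (rule norm_triangle[OF sX scale_closed[OF dX]])
    also have "N (\<lambda>x. (-1) * (s n x - f x)) = N (\<lambda>x. s n x - f x)"
      using norm_scale[OF dX, of "-1"] by simp
    finally show ?thesis using sN[of n] by simp
  qed
  moreover have "(\<lambda>n. suminf b + N (\<lambda>x. s n x - f x)) \<longlonglongrightarrow> suminf b + 0"
    by (intro tendsto_intros f(2))
  ultimately have "N f \<le> suminf b + 0" by (intro LIMSEQ_le_const) auto
  thus "(\<lambda>x. of_real (Re (cis \<theta> * H x))) \<in> X \<and> N (\<lambda>x. of_real (Re (cis \<theta> * H x))) \<le> suminf b"
    unfolding fe using f(1) by simp
qed

lemma bounded_by_real_power_mult:
  assumes f: "(\<lambda>x. of_real (f x)) \<in> X" "N (\<lambda>x. of_real (f x)) \<le> a" and h: "bounded_by h b"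
  shows "bounded_by (\<lambda>x. of_real (f x) ^ k * h x) (a ^ k * b)"
proof (induction k)
  case (Suc k)
  thus ?case using bounded_by_real_mult[OF f Suc] by (simp add: mult.assoc)
qed (use h in simp)

text \<open>
  Term by term, the remainder of order \<open>m\<close> of the exponential series acts on \<open>h\<close> with norm at most the
  corresponding real remainder at \<open>\<bar>s\<bar> a\<close>.
\<close>

lemma bounded_by_iexp_remainder:
  assumes f: "(\<lambda>x. of_real (f x)) \<in> X" "N (\<lambda>x. of_real (f x)) \<le> a" and h: "bounded_by h b"
  shows "bounded_by (\<lambda>x. (iexp (s * f x) - (\<Sum>k<m. (\<i> * of_real (s * f x)) ^ k / fact k)) * h x)
     ((exp (\<bar>s\<bar> * a) - (\<Sum>k<m. (\<bar>s\<bar> * a) ^ k / fact k)) * b)"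
proof -
  define c where "c = (\<lambda>k. (\<i> * of_real s) ^ k / fact k :: complex)"
  define B where "B = (\<lambda>k. (\<bar>s\<bar> * a) ^ (k + m) / fact (k + m) * b)"
  have 1: "bounded_by (\<lambda>x. c (k + m) * (of_real (f x) ^ (k + m) * h x)) (B k)" for k
    using bounded_by_scale[OF bounded_by_real_power_mult[OF f h, of "k + m"], of "c (k + m)"]
    by (simp add: B_def c_def norm_divide norm_power norm_mult power_mult_distrib mult_ac)
  have expsums: "(\<lambda>k. z ^ (k + m) / fact (k + m)) sums (exp z - (\<Sum>k<m. z ^ k / fact k))" for z :: "'z :: {real_normed_field, banach}"
  proof -
    have "(\<lambda>k. z ^ k / fact k) sums exp z"
      using exp_converges[of z] by (simp add: scaleR_conv_of_real divide_inverse mult.commute)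
    thus ?thesis by (rule sums_iff_shift'[THEN iffD2])
  qed
  have 2: "B sums ((exp (\<bar>s\<bar> * a) - (\<Sum>k<m. (\<bar>s\<bar> * a) ^ k / fact k)) * b)"
    unfolding B_def by (rule sums_mult2[OF expsums])
  have 3: "(\<lambda>k. c (k + m) * (of_real (f x) ^ (k + m) * h x)) sums
     ((iexp (s * f x) - (\<Sum>k<m. (\<i> * of_real (s * f x)) ^ k / fact k)) * h x)" for x
    using sums_mult2[OF expsums[of "\<i> * of_real (s * f x)"], of "h x"]
    by (simp add: c_def power_mult_distrib mult_ac)
  show ?thesis using bounded_by_suminf[OF 1 sums_summable[OF 2] 3] sums_unique[OF 2] by simp
qed

end

section \<open>The averaging operator on complex functions\<close>

context spectral_gap_setting begin

lemma prob_space_stationary: "prob_space \<mu>0"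
  and sets_stationary [measurable_cong, simp]: "sets \<mu>0 = sets borel"
  using prob by (auto simp: space_prob_algebra)

lemma averaging_op_in:
  assumes "f \<in> X"
  shows "averaging_op M f \<in> X"
  using bounded assms by (simp add: bounded_operator_on_def)

text \<open>
  The operator norm is a supremum of quotients; its finiteness comes from the boundedness of
  the operator. A function of norm zero has quotient \<open>0\<close> and is treated through the
  boundedness constant.
\<close>

lemma N_averaging_op_le:
  assumes f: "f \<in> X"
  shows "N (averaging_op M f) \<le> N f"
proof -
  obtain C where C: "\<And>f. f \<in> X \<Longrightarrow> N (averaging_op M f) \<le> C * N f"
    using bounded by (auto simp: bounded_operator_on_def)
  show ?thesis
  proof (cases "N f = 0")
    case True
    thus ?thesis using C[OF f] by simp
  next
    case False
    have "bdd_above ((\<lambda>f. N (averaging_op M f) / N f) ` X)"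
    proof (rule bdd_aboveI2)
      fix g assume g: "g \<in> X"
      show "N (averaging_op M g) / N g \<le> max C 0"
      proof (cases "N g = 0")
        case False
        hence "N g > 0" using N_nonneg[OF g] by simp
        thus ?thesis using C[OF g] by (simp add: divide_le_eq le_max_iff_disj)
      qed simp
    qed
    hence "N (averaging_op M f) / N f \<le> operator_norm_on X N (averaging_op M)"
      unfolding operator_norm_on_def by (rule cSUP_upper[OF f])
    thus ?thesis using False N_nonneg[OF f] by (simp add: operator_norm divide_le_eq)
  qed
qed

lemma N_averaging_op_gap:
  assumes "f \<in> X" "(\<integral>x. f x \<partial>\<mu>0) = 0"
  shows "N (averaging_op M f) \<le> (1 - \<delta>0) * N f"
  by (rule contracting) (use assms in \<open>simp add: hyperplane_eq\<close>)

lemma integrable_stationary: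
  fixes f :: "'a \<Rightarrow> 'c::{banach, second_countable_topology}"
  assumes [measurable]: "f \<in> borel_measurable borel" and "\<And>x. norm (f x) \<le> C"
  shows "integrable \<mu>0 f"
proof -
  interpret prob_space \<mu>0 by (rule prob_space_stationary)
  show ?thesis by (rule integrable_const_bound[where B=C]) (use assms in auto)
qed

lemma integral_averaging_op:
  fixes f :: "'a \<Rightarrow> real"
  assumes f: "f \<in> borel_measurable borel" "\<And>x. \<bar>f x\<bar> \<le> C"
  shows "(\<integral>x. averaging_op M f x \<partial>\<mu>0) = (\<integral>x. f x \<partial>\<mu>0)"
  using integral_bind_kernel[OF f prob_space.finite_measure[OF prob_space_stationary] sets_stationary]
  by (simp add: stationary)

lemma averaging_op_of_real:
  fixes f :: "'a \<Rightarrow> real"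
  assumes "f \<in> borel_measurable borel" "\<And>x. \<bar>f x\<bar> \<le> C"
  shows "averaging_op M (\<lambda>x. of_real (f x) :: 'c::{banach, second_countable_topology, real_normed_algebra_1}) = (\<lambda>x. of_real (averaging_op M f x))"
  using integral_bounded_linear[OF bounded_linear_of_real integrable_kernel[of f C]] assms
  by (intro ext) (simp add: averaging_op_def)

lemma integral_stationary_of_real:
  fixes f :: "'a \<Rightarrow> real"
  assumes "f \<in> borel_measurable borel" "\<And>x. \<bar>f x\<bar> \<le> C"
  shows "(\<integral>x. of_real (f x) \<partial>\<mu>0) = (of_real (\<integral>x. f x \<partial>\<mu>0) :: 'c::{banach, second_countable_topology, real_normed_algebra_1})"
  using integral_bounded_linear[OF bounded_linear_of_real integrable_stationary[of f C]] assms
  by auto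

lemma bounded_by_integrable: "bounded_by h b \<Longrightarrow> integrable \<mu>0 h"
  by (rule integrable_stationary) (auto intro: bounded_by_measurable bounded_by_norm)

lemma bounded_by_integrable_kernel: "bounded_by h b \<Longrightarrow> integrable (M x) h"
  by (rule integrable_kernel) (auto intro: bounded_by_measurable bounded_by_norm)

lemma bounded_by_integral_le:
  assumes "bounded_by h b"
  shows "cmod (\<integral>x. h x \<partial>\<mu>0) \<le> b"
proof -
  interpret prob_space \<mu>0 by (rule prob_space_stationary)
  have "cmod (\<integral>x. h x \<partial>\<mu>0) \<le> (\<integral>x. cmod (h x) \<partial>\<mu>0)" by (rule integral_norm_bound)
  also have "\<dots> \<le> (\<integral>x. b \<partial>\<mu>0)"
    by (rule integral_mono) (auto intro!: integrable_norm bounded_by_integrable[OF assms] bounded_by_norm[OF assms])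
  finally show ?thesis using prob_space by simp
qed

lemma Re_cis_averaging_op:
  assumes "bounded_by h b"
  shows "Re (cis \<theta> * averaging_op M h x) = averaging_op M (\<lambda>y. Re (cis \<theta> * h y)) x"
  using bounded_by_integrable_kernel[OF bounded_by_scale[OF assms, of "cis \<theta>"], of x]
  unfolding averaging_op_def by (subst integral_mult_right_zero[symmetric]) (rule integral_Re[symmetric])

text \<open>
  Rotations and real parts commute with averaging and with integration, so every bound for
  the averaging operator on the algebra passes to complex functions.
\<close>

lemma bounded_by_rotation:
  assumes h: "bounded_by h b"
  shows "averaging_op M (\<lambda>x. of_real (Re (cis \<theta> * h x))) = (\<lambda>x. of_real (Re (cis \<theta> * averaging_op M h x)) :: 'k)"
    and "(\<integral>x. of_real (Re (cis \<theta> * h x)) \<partial>\<mu>0) = (of_real (Re (cis \<theta> * (\<integral>x. h x \<partial>\<mu>0))) :: 'k)"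
proof -
  note H = bounded_byD[OF h, of \<theta>]
  note m = real_measurable[OF H(1)] and b = order.trans[OF real_bound[OF H(1)] H(2)]
  show "averaging_op M (\<lambda>x. of_real (Re (cis \<theta> * h x))) = (\<lambda>x. of_real (Re (cis \<theta> * averaging_op M h x)) :: 'k)"
    unfolding averaging_op_of_real[OF m b] Re_cis_averaging_op[OF h] ..
  show "(\<integral>x. of_real (Re (cis \<theta> * h x)) \<partial>\<mu>0) = (of_real (Re (cis \<theta> * (\<integral>x. h x \<partial>\<mu>0))) :: 'k)"
    unfolding integral_stationary_of_real[OF m b]
    using bounded_by_integrable[OF bounded_by_scale[OF h, of "cis \<theta>"]]
    by (subst integral_mult_right_zero[symmetric]) (subst integral_Re, auto)
qed

lemma bounded_by_averaging_op:
  assumes h: "bounded_by h b"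
  shows "bounded_by (averaging_op M h) b"
  unfolding bounded_by_def bounded_by_rotation(1)[OF h, symmetric]
  using averaging_op_in[OF bounded_byD(1)[OF h]] 
    order.trans[OF N_averaging_op_le[OF bounded_byD(1)[OF h]] bounded_byD(2)[OF h]] by blast

lemma bounded_by_averaging_op_gap:
  assumes h: "bounded_by h b" and 0: "(\<integral>x. h x \<partial>\<mu>0) = 0"
  shows "bounded_by (averaging_op M h) ((1 - \<delta>0) * b)"
  unfolding bounded_by_def bounded_by_rotation(1)[OF h, symmetric]
proof (intro allI conjI averaging_op_in bounded_byD(1)[OF h])
  fix \<theta>
  have "N (averaging_op M (\<lambda>x. of_real (Re (cis \<theta> * h x)))) \<le> (1 - \<delta>0) * N (\<lambda>x. of_real (Re (cis \<theta> * h x)))"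
    by (rule N_averaging_op_gap[OF bounded_byD(1)[OF h]]) (simp only: bounded_by_rotation(2)[OF h] 0, simp)
  also have "\<dots> \<le> (1 - \<delta>0) * b"
    by (rule mult_left_mono[OF bounded_byD(2)[OF h]]) (use gap in simp)
  finally show "N (averaging_op M (\<lambda>x. of_real (Re (cis \<theta> * h x)))) \<le> (1 - \<delta>0) * b" .
qed

lemma integral_averaging_op_complex:
  assumes h: "bounded_by h b"
  shows "(\<integral>x. averaging_op M h x \<partial>\<mu>0) = (\<integral>x. h x \<partial>\<mu>0)"
proof (rule complex_eqI)
  note m = bounded_by_measurable[OF h] and b = bounded_by_norm[OF h]
  note i = bounded_by_integrable[OF h] and i' = bounded_by_integrable[OF bounded_by_averaging_op[OF h]]
  have rb: "\<bar>Re (h x)\<bar> \<le> b" "\<bar>Im (h x)\<bar> \<le> b" for x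
    using b[of x] abs_Re_le_cmod[of "h x"] abs_Im_le_cmod[of "h x"] by linarith+
  have rm: "(\<lambda>x. Re (h x)) \<in> borel_measurable borel" "(\<lambda>x. Im (h x)) \<in> borel_measurable borel"
    using m by measurable
  show "Re (\<integral>x. averaging_op M h x \<partial>\<mu>0) = Re (\<integral>x. h x \<partial>\<mu>0)"
    using integral_averaging_op[OF rm(1) rb(1)]
    by (simp only: integral_Re[OF i, symmetric] integral_Re[OF i', symmetric] averaging_op_Re_Im[OF m b])
  show "Im (\<integral>x. averaging_op M h x \<partial>\<mu>0) = Im (\<integral>x. h x \<partial>\<mu>0)"
    using integral_averaging_op[OF rm(2) rb(2)]
    by (simp only: integral_Im[OF i, symmetric] integral_Im[OF i', symmetric] averaging_op_Re_Im[OF m b])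
qed

lemma averaging_op_add:
  assumes "bounded_by g a" "bounded_by h b"
  shows "averaging_op M (\<lambda>x. g x + h x) = (\<lambda>x. averaging_op M g x + averaging_op M h x)"
  using assms[THEN bounded_by_integrable_kernel] by (auto simp: averaging_op_def)

lemma averaging_op_scale: 
  fixes c :: complex
  shows "averaging_op M (\<lambda>x. c * h x) = (\<lambda>x. c * averaging_op M h x)"
  by (auto simp: averaging_op_def)

lemma averaging_op_const:
  fixes c :: complex
  shows "averaging_op M (\<lambda>x. c) = (\<lambda>x. c)"
  using prob_space.prob_space[OF prob_space_kernel] by (auto simp: averaging_op_def)

lemma averaging_op_sum:
  assumes "\<And>k. k \<in> A \<Longrightarrow> bounded_by (h k) (b k)"
  shows "averaging_op M (\<lambda>x. \<Sum>k\<in>A. h k x) = (\<lambda>x. \<Sum>k\<in>A. averaging_op M (h k) x)"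
  unfolding averaging_op_def
  by (intro ext Bochner_Integration.integral_sum bounded_by_integrable_kernel) (rule assms)

text \<open>
  Constants are fixed by the averaging operator, so subtracting the mean before or after averaging is
  the same; the factor \<open>2\<close> is the cost of subtracting the mean.
\<close>

lemma bounded_by_averaging_op_centered:
  assumes h: "bounded_by h b"
  shows "bounded_by (\<lambda>x. averaging_op M h x - (\<integral>y. h y \<partial>\<mu>0)) (2 * (1 - \<delta>0) * b)"
proof -
  interpret prob_space \<mu>0 by (rule prob_space_stationary)
  let ?c = "\<integral>y. h y \<partial>\<mu>0"
  have hc: "bounded_by (\<lambda>x. h x - ?c) (2 * b)"
    by (rule bounded_by_mono[OF bounded_by_diff[OF h bounded_by_const]]) (use bounded_by_integral_le[OF h] in simp)
  have "(\<integral>x. h x - ?c \<partial>\<mu>0) = 0" using bounded_by_integrable[OF h] prob_space by simp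
  from bounded_by_averaging_op_gap[OF hc this]
  have "bounded_by (averaging_op M (\<lambda>x. h x - ?c)) (2 * (1 - \<delta>0) * b)" by (simp add: mult_ac)
  moreover have "averaging_op M (\<lambda>x. h x - ?c) = (\<lambda>x. averaging_op M h x - ?c)"
    using averaging_op_add[OF h bounded_by_const[of "- ?c"]] by (simp add: averaging_op_const)
  ultimately show ?thesis by simp
qed

end

text \<open>
  The last two bounds are the Lagrange form of the remainder, with \<open>exp (1/10) \<le> 1.11\<close>.
\<close>

lemma exp_remainder_le:
  fixes u :: real
  assumes "0 \<le> u" "u \<le> 1/10"
  shows "exp u - 1 \<le> 11/10 * u" "exp u - 1 - u \<le> 6/10 * u^2" "exp u - 1 - u - u^2 / 2 \<le> 2/10 * u^3"
proof -
  have e: "exp t \<le> 111/100" if "\<bar>t\<bar> \<le> u" for t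
  proof -
    have "exp t \<le> exp (1/10)" using that assms by simp
    also have "\<dots> \<le> 1 + 1/10 + (1/10)^2" by (rule exp_bound) auto
    finally show ?thesis by (simp add: power2_eq_square)
  qed
  have "exp u \<le> 1 + u + u^2" by (rule exp_bound) (use assms in auto)
  moreover have "u^2 \<le> 1/10 * u" using assms unfolding power2_eq_square by (intro mult_right_mono) auto
  ultimately show "exp u - 1 \<le> 11/10 * u" by simp
  obtain t where t: "\<bar>t\<bar> \<le> \<bar>u\<bar>" "exp u = (\<Sum>m<2. u ^ m / fact m) + exp t / fact 2 * u ^ 2" using Maclaurin_exp_le by blast
  have "exp u = 1 + u + exp t * u^2 / 2" using t(2) by (simp add: numeral_2_eq_2)
  moreover have "exp t * u^2 \<le> 111/100 * u^2" by (rule mult_right_mono[OF e]) (use t assms in auto)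
  moreover have "0 \<le> u^2" by simp
  ultimately show "exp u - 1 - u \<le> 6/10 * u^2" by linarith
  obtain t where t: "\<bar>t\<bar> \<le> \<bar>u\<bar>" "exp u = (\<Sum>m<3. u ^ m / fact m) + exp t / fact 3 * u ^ 3" using Maclaurin_exp_le by blast
  have "exp u = 1 + u + u^2 / 2 + exp t * u^3 / 6" using t(2) by (simp add: numeral_3_eq_3 numeral_2_eq_2)
  moreover have "exp t * u^3 \<le> 111/100 * u^3" by (rule mult_right_mono[OF e]) (use t assms in auto)
  moreover have "0 \<le> u^3" using assms by simp
  ultimately show "exp u - 1 - u - u^2 / 2 \<le> 2/10 * u^3" by linarith
qed

section \<open>Normalised iteration of the tilted operator\<close>

locale centered_observable = spectral_gap_setting M X N \<mu>0 G0 \<delta>0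
  for M :: "'a::polish_space \<Rightarrow> 'a measure"
    and X :: "('a \<Rightarrow> 'k::{real_normed_field, banach, second_countable_topology}) set"
    and N :: "('a \<Rightarrow> 'k) \<Rightarrow> real"
    and \<mu>0 :: "'a measure" and G0 :: "('a \<Rightarrow> 'k) set" and \<delta>0 :: real +
  fixes \<phi> :: "'a \<Rightarrow> real" and a :: real
  assumes observable: "(\<lambda>x. of_real (\<phi> x)) \<in> X"
    and observable_norm: "N (\<lambda>x. of_real (\<phi> x)) = a"
    and centered: "(\<integral>x. \<phi> x \<partial>\<mu>0) = 0"
begin

lemma a_nonneg: "0 \<le> a"
  using N_nonneg[OF observable] observable_norm by simp

lemma observable_measurable [measurable]: "\<phi> \<in> borel_measurable borel"
  by (rule real_measurable[OF observable])

lemmas bounded_by_mult_observable = bounded_by_real_mult[OF observable observable_norm[THEN eq_refl]]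
lemmas bounded_by_observable = bounded_by_of_real[OF observable observable_norm[THEN eq_refl]]

lemma iterate_facts:
  shows "(\<lambda>x. of_real ((averaging_op M ^^ j) \<phi> x)) \<in> X \<and>
     N (\<lambda>x. of_real ((averaging_op M ^^ j) \<phi> x)) \<le> (1 - \<delta>0) ^ j * a \<and>
     (\<integral>x. (averaging_op M ^^ j) \<phi> x \<partial>\<mu>0) = 0"
proof (induction j)
  case 0
  thus ?case using observable observable_norm centered by simp
next
  case (Suc j)
  let ?f = "(averaging_op M ^^ j) \<phi>"
  note m = real_measurable[OF conjunct1[OF Suc]] and b = real_bound[OF conjunct1[OF Suc]]
  have eq: "(\<lambda>x. of_real ((averaging_op M ^^ Suc j) \<phi> x) :: 'k) = averaging_op M (\<lambda>x. of_real (?f x))"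
    by (simp only: funpow.simps o_apply averaging_op_of_real[OF m b])
  have "(\<integral>x. of_real (?f x) \<partial>\<mu>0) = (0 :: 'k)" using integral_stationary_of_real[OF m b, where 'c='k] Suc by simp
  hence "N (averaging_op M (\<lambda>x. of_real (?f x))) \<le> (1 - \<delta>0) * N (\<lambda>x. of_real (?f x))"
    using Suc by (intro N_averaging_op_gap) auto
  also have "\<dots> \<le> (1 - \<delta>0) * ((1 - \<delta>0) ^ j * a)"
    using Suc gap by (intro mult_left_mono) auto
  finally have "N (averaging_op M (\<lambda>x. of_real (?f x))) \<le> (1 - \<delta>0) ^ Suc j * a" by simp
  thus ?case unfolding eq using Suc averaging_op_in integral_averaging_op[OF m b] by simp
qed

text \<open>
  The stationary autocovariance of the observable at lag \<open>j\<close>.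
\<close>

definition correlation :: "nat \<Rightarrow> real" where
  "correlation j = (\<integral>x. \<phi> x * (averaging_op M ^^ j) \<phi> x \<partial>\<mu>0)"

lemma bounded_by_iterate: "bounded_by (\<lambda>x. of_real ((averaging_op M ^^ j) \<phi> x)) ((1 - \<delta>0) ^ j * a)"
  using iterate_facts by (intro bounded_by_of_real) auto

lemma integral_iterate_complex: "(\<integral>x. of_real ((averaging_op M ^^ j) \<phi> x) \<partial>\<mu>0) = (0 :: complex)"
  using iterate_facts[of j] by simp

lemma integral_observable_complex: "(\<integral>x. of_real (\<phi> x) \<partial>\<mu>0) = (0 :: complex)"
  using centered by simp

lemma averaging_op_iterate_complex:
  "averaging_op M (\<lambda>x. of_real ((averaging_op M ^^ j) \<phi> x) :: complex) = (\<lambda>x. of_real ((averaging_op M ^^ Suc j) \<phi> x))"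
proof -
  have "of_real \<circ> (averaging_op M ^^ j) \<phi> \<in> X" using iterate_facts[of j] by (simp add: o_def)
  hence X: "(\<lambda>x. of_real ((averaging_op M ^^ j) \<phi> x)) \<in> X" by (simp add: o_def)
  show ?thesis using averaging_op_of_real[OF real_measurable[OF X] real_bound[OF X], where 'c=complex] by simp
qed

lemma correlation_complex:
  "(\<integral>x. of_real (\<phi> x) * of_real ((averaging_op M ^^ j) \<phi> x) \<partial>\<mu>0) = (of_real (correlation j) :: complex)"
  unfolding correlation_def by (subst integral_complex_of_real[symmetric]) simp

lemma correlation_le: "\<bar>correlation j\<bar> \<le> (1 - \<delta>0) ^ j * a\<^sup>2"
  using bounded_by_integral_le[OF bounded_by_mult_observable[OF bounded_by_iterate[of j]]]
  unfolding correlation_complex by (simp add: power2_eq_square mult_ac)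

lemma summable_correlation: "summable correlation"
proof (rule summable_comparison_test')
  show "summable (\<lambda>j. (1 - \<delta>0) ^ j * a\<^sup>2)"
    using gap by (intro summable_mult2 summable_geometric) auto
qed (use correlation_le in auto)

lemma suminf_correlation_tail:
  "\<bar>\<Sum>j. correlation (j + Suc k)\<bar> \<le> (1 - \<delta>0) ^ k * a\<^sup>2 / \<delta>0"
proof -
  have g: "(\<lambda>j. (1 - \<delta>0) ^ j * ((1 - \<delta>0) ^ k * a\<^sup>2)) sums (1 / (1 - (1 - \<delta>0)) * ((1 - \<delta>0) ^ k * a\<^sup>2))"
    using gap by (intro sums_mult2 geometric_sums) auto
  have "norm (\<Sum>j. correlation (j + Suc k)) \<le> (\<Sum>j. (1 - \<delta>0) ^ j * ((1 - \<delta>0) ^ k * a\<^sup>2))"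
  proof (rule norm_suminf_le[OF _ sums_summable[OF g]])
    fix j
    have "norm (correlation (j + Suc k)) \<le> (1 - \<delta>0) ^ (j + Suc k) * a\<^sup>2" using correlation_le[of "j + Suc k"] by (simp only: real_norm_def)
    also have "\<dots> \<le> (1 - \<delta>0) ^ (j + k) * a\<^sup>2"
      using gap by (intro mult_right_mono power_decreasing) auto
    finally show "norm (correlation (j + Suc k)) \<le> (1 - \<delta>0) ^ j * ((1 - \<delta>0) ^ k * a\<^sup>2)"
      by (simp add: power_add mult_ac)
  qed
  thus ?thesis using sums_unique[OF g] by simp
qed

text \<open>
  The dynamical variance of a centred observable.
\<close>

definition green_kubo :: real where
  "green_kubo = correlation 0 + 2 * (\<Sum>j. correlation (Suc j))"

text \<open>
  A variance bounded below forces the norm of the observable to be bounded below. This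
  is the only source of lower bounds for \<open>a\<close>.
\<close>

lemma green_kubo_le: "green_kubo \<le> 2 * a\<^sup>2 / \<delta>0"
proof -
  have g: "(\<lambda>j. (1 - \<delta>0) ^ j * ((1 - \<delta>0) * a\<^sup>2)) sums (1 / (1 - (1 - \<delta>0)) * ((1 - \<delta>0) * a\<^sup>2))"
    using gap by (intro sums_mult2 geometric_sums) auto
  have "(\<Sum>j. correlation (Suc j)) \<le> (\<Sum>j. (1 - \<delta>0) ^ j * ((1 - \<delta>0) * a\<^sup>2))"
  proof (rule suminf_le)
    show "correlation (Suc j) \<le> (1 - \<delta>0) ^ j * ((1 - \<delta>0) * a\<^sup>2)" for j
      using correlation_le[of "Suc j"] by (simp add: mult_ac)
  qed (use summable_correlation sums_summable[OF g] in \<open>simp_all add: summable_Suc_iff\<close>)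
  also have "\<dots> = (1 - \<delta>0) * a\<^sup>2 / \<delta>0" using sums_unique[OF g] by simp
  finally have "green_kubo \<le> a\<^sup>2 + 2 * ((1 - \<delta>0) * a\<^sup>2 / \<delta>0)"
    using correlation_le[of 0] by (simp add: green_kubo_def)
  also have "\<dots> \<le> 2 * a\<^sup>2 / \<delta>0" using gap by (simp add: field_simps)
  finally show ?thesis .
qed

end

locale small_frequency = centered_observable M X N \<mu>0 G0 \<delta>0 \<phi> a
  for M :: "'a::polish_space \<Rightarrow> 'a measure"
    and X :: "('a \<Rightarrow> 'k::{real_normed_field, banach, second_countable_topology}) set"
    and N :: "('a \<Rightarrow> 'k) \<Rightarrow> real"
    and \<mu>0 :: "'a measure" and G0 :: "('a \<Rightarrow> 'k) set" and \<delta>0 :: real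
    and \<phi> :: "'a \<Rightarrow> real" and a :: real +
  fixes s :: real
  assumes small: "\<bar>s\<bar> * a \<le> \<delta>0\<^sup>2 / 25"
begin

definition u where "u = \<bar>s\<bar> * a"

abbreviation eigen :: "('a \<Rightarrow> complex) \<Rightarrow> complex" where
  "eigen v \<equiv> (\<integral>x. iexp (s * \<phi> x) * v x \<partial>\<mu>0)"

text \<open>
  If \<open>1 + r\<close> represents a function up to a scalar, then \<open>1 + riccati r\<close> represents its image under the
  tilted operator, normalised to have mean \<open>1\<close> under \<open>\<mu>0\<close>.
\<close>

definition riccati :: "('a \<Rightarrow> complex) \<Rightarrow> 'a \<Rightarrow> complex" where
  "riccati r x = tilted_op M s \<phi> (\<lambda>y. 1 + r y) x / eigen (\<lambda>y. 1 + r y) - 1"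

lemma u_bounds: "0 \<le> u" "u \<le> \<delta>0 / 25" "u \<le> 1/10" "u \<le> \<delta>0\<^sup>2 / 25"
proof -
  show "0 \<le> u" using a_nonneg by (simp add: u_def)
  show "u \<le> \<delta>0\<^sup>2 / 25" using small by (simp add: u_def)
  also have "\<dots> \<le> \<delta>0 / 25" using gap by (simp add: power2_eq_square mult_left_le)
  finally show "u \<le> \<delta>0 / 25" .
  thus "u \<le> 1/10" using gap by simp
qed

lemma remainder1:
  assumes "bounded_by h b"
  shows "bounded_by (\<lambda>x. (iexp (s * \<phi> x) - 1) * h x) (11/10 * u * b)"
proof (rule bounded_by_mono)
  show "bounded_by (\<lambda>x. (iexp (s * \<phi> x) - 1) * h x) ((exp u - 1) * b)"
    using bounded_by_iexp_remainder[OF observable observable_norm[THEN eq_refl] assms, of s 1] by (simp add: u_def)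
qed (rule mult_right_mono[OF exp_remainder_le(1)[OF u_bounds(1,3)] bounded_by_nonneg[OF assms]])

lemma remainder2:
  assumes "bounded_by h b"
  shows "bounded_by (\<lambda>x. (iexp (s * \<phi> x) - 1 - \<i> * s * \<phi> x) * h x) (6/10 * u\<^sup>2 * b)"
proof (rule bounded_by_mono)
  show "bounded_by (\<lambda>x. (iexp (s * \<phi> x) - 1 - \<i> * s * \<phi> x) * h x) ((exp u - 1 - u) * b)"
    using bounded_by_iexp_remainder[OF observable observable_norm[THEN eq_refl] assms, of s 2]
    by (simp add: u_def numeral_2_eq_2 algebra_simps)
qed (rule mult_right_mono[OF exp_remainder_le(2)[OF u_bounds(1,3)] bounded_by_nonneg[OF assms]])

lemma remainder3:
  "bounded_by (\<lambda>x. iexp (s * \<phi> x) - 1 - \<i> * s * \<phi> x + s\<^sup>2 / 2 * (\<phi> x)\<^sup>2) (2/10 * u ^ 3)"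
proof (rule bounded_by_mono)
  show "bounded_by (\<lambda>x. iexp (s * \<phi> x) - 1 - \<i> * s * \<phi> x + s\<^sup>2 / 2 * (\<phi> x)\<^sup>2) (exp u - 1 - u - u\<^sup>2 / 2)"
    using bounded_by_iexp_remainder[OF observable observable_norm[THEN eq_refl] bounded_by_const[of 1], of s 3]
    by (simp add: u_def numeral_3_eq_3 numeral_2_eq_2 algebra_simps power2_eq_square)
qed (use exp_remainder_le(3)[OF u_bounds(1,3)] in auto)

text \<open>
  The radius of a ball of mean zero functions that \<open>riccati\<close> maps into itself.
\<close>

definition R where "R = 6/5 * u / \<delta>0"

text \<open>
  A bound for the total effect of \<open>exp (i s \<phi>)\<close> beyond the linear terms when \<open>r\<close> is in the ball
  of radius \<open>R\<close>; in particular the multiplier differs from \<open>1\<close> by at most \<open>E\<close>.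
\<close>

definition E where "E = 48/25 * u\<^sup>2 / \<delta>0"

lemma R_nonneg: "0 \<le> R"
  using u_bounds gap by (simp add: R_def)

lemma square_le: "u\<^sup>2 \<le> u\<^sup>2 / \<delta>0"
  using gap by (simp add: field_simps mult_left_le_one_le)

lemma error_le_E: "6/10 * u\<^sup>2 + 11/10 * u * R \<le> E"
proof -
  have "u\<^sup>2 \<le> u\<^sup>2 / \<delta>0" by (rule square_le)
  moreover have "u * R = 6/5 * (u\<^sup>2 / \<delta>0)" by (simp add: R_def power2_eq_square)
  moreover have "E = 48/25 * (u\<^sup>2 / \<delta>0)" by (simp add: E_def)
  ultimately show ?thesis by linarith
qed

lemma E_le: "E \<le> 48/625 * \<delta>0 * u" "E \<le> 1/10" "0 \<le> E"
proof -
  have "u\<^sup>2 / \<delta>0 \<le> (\<delta>0\<^sup>2 / 25) * u / \<delta>0"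
    unfolding power2_eq_square[of u] using u_bounds gap by (intro divide_right_mono mult_right_mono) auto
  also have "\<dots> = \<delta>0 * u / 25" using gap by (simp add: power2_eq_square)
  finally show 1: "E \<le> 48/625 * \<delta>0 * u" by (simp add: E_def)
  have "\<delta>0 * u \<le> 1 * (1 / 10)" using u_bounds gap by (intro mult_mono) auto
  with 1 show "E \<le> 1/10" by simp
  show "0 \<le> E" using gap by (simp add: E_def)
qed

lemma ER_le: "E * R \<le> 2304/15625 * u\<^sup>2"
proof -
  have "E * R \<le> (48/625 * \<delta>0 * u) * R" by (rule mult_right_mono[OF E_le(1) R_nonneg])
  also have "\<dots> = 288/3125 * u\<^sup>2" using gap by (simp add: R_def power2_eq_square)
  also have "\<dots> \<le> 2304/15625 * u\<^sup>2" by (rule mult_right_mono) auto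
  finally show ?thesis .
qed

text \<open>
  The left side bounds the numerator of \<open>riccati r\<close>, and \<open>1 - E\<close> its denominator from below. The gap
  contributes \<open>\<delta>0 R = 6/5 u\<close>, which exceeds the new term \<open>u\<close>; the surplus \<open>u / 5\<close> pays for the
  quadratic terms because \<open>u \<le> \<delta>0 / 25\<close>.
\<close>

lemma self_map: "((1 - \<delta>0) * (u + R) + 2 * (1 - \<delta>0) * E) \<le> R * (1 - E)"
proof -
  have "2 * (1 - \<delta>0) * E \<le> 2 * 1 * E" using gap E_le by (intro mult_right_mono) auto
  also have "\<dots> \<le> 96/625 * (\<delta>0 * u)" using E_le(1) by simp
  finally have 1: "2 * (1 - \<delta>0) * E \<le> 96/625 * (\<delta>0 * u)" .
  have 2: "\<delta>0 * R = 6/5 * u" using gap by (simp add: R_def)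
  have 3: "(1 - \<delta>0) * (u + R) = u + R - \<delta>0 * u - 6/5 * u" using 2 by (simp add: algebra_simps)
  have "u\<^sup>2 \<le> 1/10 * u" unfolding power2_eq_square using u_bounds by (intro mult_right_mono) auto
  hence 4: "R * E \<le> 2/10 * u" using ER_le u_bounds by (simp add: mult.commute)
  have "0 \<le> \<delta>0 * u" using gap u_bounds by simp
  thus ?thesis using 1 3 4 by (simp only: right_diff_distrib mult_1_right)
qed

text \<open>
  Expand \<open>exp (i s \<phi>) (1 + r)\<close> as \<open>1 + l + g\<close>, with the linear part \<open>l = i s \<phi> + r\<close> of mean zero and
  a remainder \<open>g\<close> of size \<open>E\<close>. Then the multiplier is \<open>1\<close> plus the mean of \<open>g\<close>, and multiplier times \<open>riccati r\<close>
  is the average of \<open>l\<close> plus the centred average of \<open>g\<close>. Both are contracted by the gap. The last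
  two claims are the first-order expansion of \<open>riccati r\<close> and the second-order expansion of the multiplier.
\<close>

lemma riccati_step:
  fixes r :: "'a \<Rightarrow> complex"
  assumes r: "bounded_by r R" and r0: "(\<integral>x. r x \<partial>\<mu>0) = 0"
  shows "eigen (\<lambda>y. 1 + r y) \<noteq> 0"
    and "bounded_by (riccati r) R"
    and "(\<integral>x. riccati r x \<partial>\<mu>0) = 0"
    and "bounded_by (\<lambda>x. riccati r x - (\<i> * s * of_real (averaging_op M \<phi> x) + averaging_op M r x)) (4 * u\<^sup>2 / \<delta>0)"
    and "cmod (eigen (\<lambda>y. 1 + r y) - (1 - s\<^sup>2 / 2 * correlation 0 + \<i> * s * (\<integral>x. \<phi> x * r x \<partial>\<mu>0)))
           \<le> 2/10 * u ^ 3 + 6/10 * u\<^sup>2 * R"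
proof -
  interpret prob_space \<mu>0 by (rule prob_space_stationary)
  define \<kappa> where "\<kappa> = eigen (\<lambda>y. 1 + r y)"
  define g where "g = (\<lambda>x. (iexp (s * \<phi> x) - 1 - \<i> * s * \<phi> x) * 1 + (iexp (s * \<phi> x) - 1) * r x)"
  define l where "l = (\<lambda>x. \<i> * s * of_real (\<phi> x) + r x)"
  have g: "bounded_by g E"
    unfolding g_def using bounded_by_add[OF remainder2[OF bounded_by_const[of 1]] remainder1[OF r]] error_le_E
    by (auto intro: bounded_by_mono)
  have sphi: "bounded_by (\<lambda>x. \<i> * s * of_real (\<phi> x)) u"
    using bounded_by_scale[OF bounded_by_observable, of "\<i> * s"] by (simp add: u_def norm_mult)
  have l: "bounded_by l (u + R)" unfolding l_def by (rule bounded_by_add[OF sphi r])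
  have l0: "(\<integral>x. l x \<partial>\<mu>0) = 0"
    unfolding l_def using bounded_by_integrable[OF sphi] bounded_by_integrable[OF r] r0 integral_observable_complex by simp
  note int = bounded_by_integrable[OF g] bounded_by_integrable[OF l] bounded_by_integrable[OF bounded_by_averaging_op[OF l]]
     bounded_by_integrable[OF bounded_by_averaging_op[OF g]]
  have dec: "(\<lambda>x. iexp (s * \<phi> x) * (1 + r x)) = (\<lambda>x. 1 + (l x + g x))"
    by (simp add: g_def l_def algebra_simps)
  have kappa_eq: "\<kappa> = 1 + (\<integral>x. g x \<partial>\<mu>0)"
    unfolding \<kappa>_def dec using int l0 prob_space by simp
  have lam1: "cmod (\<kappa> - 1) \<le> E" using bounded_by_integral_le[OF g] by (simp add: kappa_eq)
  have lamn: "cmod \<kappa> \<ge> 1 - E" using norm_triangle_ineq2[of 1 "1 - \<kappa>"] lam1 by (simp add: norm_minus_commute)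
  hence lampos: "cmod \<kappa> > 0" using E_le by linarith
  thus nz: "\<kappa> \<noteq> 0" by auto
  define d where "d = (\<lambda>x. averaging_op M l x + (averaging_op M g x - (\<integral>y. g y \<partial>\<mu>0)))"
  have top: "tilted_op M s \<phi> (\<lambda>y. 1 + r y) = (\<lambda>x. d x + \<kappa>)"
    unfolding tilted_op_def dec kappa_eq d_def
    using averaging_op_add[OF bounded_by_const[of 1] bounded_by_add[OF l g]] averaging_op_add[OF l g]
    by (simp add: averaging_op_const algebra_simps)
  have ric: "riccati r = (\<lambda>x. 1 / \<kappa> * d x)"
    unfolding riccati_def[abs_def] top \<kappa>_def[symmetric] using nz by (simp add: field_simps)
  note gc = bounded_by_averaging_op_centered[OF g]
  have d: "bounded_by d ((1 - \<delta>0) * (u + R) + 2 * (1 - \<delta>0) * E)"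
    unfolding d_def by (rule bounded_by_add[OF bounded_by_averaging_op_gap[OF l l0] gc])
  show ricb: "bounded_by (riccati r) R"
    unfolding ric
  proof (rule bounded_by_mono[OF bounded_by_scale[OF d]])
    have "(1 - \<delta>0) * (u + R) + 2 * (1 - \<delta>0) * E \<le> R * cmod \<kappa>"
      using self_map mult_left_mono[OF lamn R_nonneg] by linarith
    thus "cmod (1 / \<kappa>) * ((1 - \<delta>0) * (u + R) + 2 * (1 - \<delta>0) * E) \<le> R"
      using lampos by (simp add: norm_divide divide_le_eq)
  qed
  have "(\<integral>x. d x \<partial>\<mu>0) = 0"
    unfolding d_def using int l0 prob_space integral_averaging_op_complex[OF l] integral_averaging_op_complex[OF g] by simp
  thus "(\<integral>x. riccati r x \<partial>\<mu>0) = 0" unfolding ric by simp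
  have avl: "averaging_op M l x = \<i> * s * of_real (averaging_op M \<phi> x) + averaging_op M r x" for x
    unfolding l_def using averaging_op_add[OF sphi r] averaging_op_iterate_complex[of 0]
    by (simp add: averaging_op_scale)
  have "riccati r x - averaging_op M l x = (averaging_op M g x - (\<integral>y. g y \<partial>\<mu>0)) - (\<kappa> - 1) * riccati r x" for x
  proof -
    have "\<kappa> * riccati r x = d x" using nz by (simp add: ric)
    thus ?thesis by (simp add: d_def algebra_simps)
  qed
  moreover have "bounded_by (\<lambda>x. (averaging_op M g x - (\<integral>y. g y \<partial>\<mu>0)) - (\<kappa> - 1) * riccati r x) (4 * u\<^sup>2 / \<delta>0)"
  proof (rule bounded_by_mono[OF bounded_by_diff[OF gc bounded_by_scale[OF ricb]]])
    have "2 * (1 - \<delta>0) * E \<le> 2 * 1 * E" using gap E_le by (intro mult_right_mono) auto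
    moreover have "cmod (\<kappa> - 1) * R \<le> E * R" by (rule mult_right_mono[OF lam1 R_nonneg])
    moreover have "u\<^sup>2 \<le> u\<^sup>2 / \<delta>0" by (rule square_le)
    moreover have "E = 48/25 * (u\<^sup>2 / \<delta>0)" by (simp add: E_def)
    moreover have "E * R \<le> 4/25 * (u\<^sup>2 / \<delta>0)"
    proof -
      have "0 \<le> u\<^sup>2 / \<delta>0" using gap by simp
      thus ?thesis using ER_le square_le by linarith
    qed
    ultimately have "2 * (1 - \<delta>0) * E \<le> 96/25 * (u\<^sup>2 / \<delta>0)" "cmod (\<kappa> - 1) * R \<le> 4/25 * (u\<^sup>2 / \<delta>0)"
      by simp_all
    hence "2 * (1 - \<delta>0) * E + cmod (\<kappa> - 1) * R \<le> 4 * (u\<^sup>2 / \<delta>0)" by simp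
    thus "2 * (1 - \<delta>0) * E + cmod (\<kappa> - 1) * R \<le> 4 * u\<^sup>2 / \<delta>0" by simp
  qed
  ultimately show "bounded_by (\<lambda>x. riccati r x - (\<i> * s * of_real (averaging_op M \<phi> x) + averaging_op M r x)) (4 * u\<^sup>2 / \<delta>0)"
    by (simp add: avl)
  define r3 where "r3 = (\<lambda>x. iexp (s * \<phi> x) - 1 - \<i> * s * \<phi> x + s\<^sup>2 / 2 * (\<phi> x)\<^sup>2)"
  define r2 where "r2 = (\<lambda>x. (iexp (s * \<phi> x) - 1 - \<i> * s * \<phi> x) * r x)"
  define p2 where "p2 = (\<lambda>x. of_real (- (s\<^sup>2 / 2)) * (of_real (\<phi> x) * of_real (\<phi> x)) :: complex)"
  define pr where "pr = (\<lambda>x. \<i> * s * (of_real (\<phi> x) * r x))"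
  have r3: "bounded_by r3 (2/10 * u ^ 3)" unfolding r3_def by (rule remainder3)
  have r2: "bounded_by r2 (6/10 * u\<^sup>2 * R)" unfolding r2_def by (rule remainder2[OF r])
  have p2: "integrable \<mu>0 p2" unfolding p2_def
    by (rule bounded_by_integrable[OF bounded_by_scale[OF bounded_by_mult_observable[OF bounded_by_observable]]])
  have pr: "integrable \<mu>0 pr" unfolding pr_def
    by (rule bounded_by_integrable[OF bounded_by_scale[OF bounded_by_mult_observable[OF r]]])
  have dec2: "(\<lambda>x. iexp (s * \<phi> x) * (1 + r x)) = (\<lambda>x. r3 x + (r2 x + (1 + (l x + (p2 x + pr x)))))"
    by (simp add: l_def r3_def r2_def p2_def pr_def algebra_simps power2_eq_square)
  have "\<kappa> = (\<integral>x. r3 x \<partial>\<mu>0) + (\<integral>x. r2 x \<partial>\<mu>0) + 1 + (\<integral>x. p2 x \<partial>\<mu>0) + (\<integral>x. pr x \<partial>\<mu>0)"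
    unfolding \<kappa>_def dec2
    using bounded_by_integrable[OF r3] bounded_by_integrable[OF r2] int(2) p2 pr l0 prob_space by simp
  moreover have "(\<integral>x. p2 x \<partial>\<mu>0) = of_real (- (s\<^sup>2 / 2)) * correlation 0"
    unfolding p2_def using correlation_complex[of 0] by simp
  moreover have "(\<integral>x. pr x \<partial>\<mu>0) = \<i> * s * (\<integral>x. \<phi> x * r x \<partial>\<mu>0)"
    unfolding pr_def by simp
  ultimately have "\<kappa> - (1 - s\<^sup>2 / 2 * correlation 0 + \<i> * s * (\<integral>x. \<phi> x * r x \<partial>\<mu>0)) = 
     (\<integral>x. r3 x \<partial>\<mu>0) + (\<integral>x. r2 x \<partial>\<mu>0)" by simp
  also have "cmod \<dots> \<le> 2/10 * u ^ 3 + 6/10 * u\<^sup>2 * R"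
    by (intro norm_triangle_mono bounded_by_integral_le r3 r2)
  finally show "cmod (\<kappa> - (1 - s\<^sup>2 / 2 * correlation 0 + \<i> * s * (\<integral>x. \<phi> x * r x \<partial>\<mu>0))) \<le> 2/10 * u ^ 3 + 6/10 * u\<^sup>2 * R" .
qed

text \<open>
  The \<open>k\<close>-th iterate of the tilted operator on \<open>1\<close> is a scalar multiple of \<open>1 + defect k\<close>.
\<close>

abbreviation defect :: "nat \<Rightarrow> 'a \<Rightarrow> complex" where
  "defect k \<equiv> (riccati ^^ k) (\<lambda>_. 0)"

text \<open>
  The factor gained by the scalar in the step from \<open>k\<close> to \<open>k + 1\<close>, in other words the eigenvalue
  estimate after \<open>k\<close> steps of a power iteration for the tilted operator.
\<close>

definition multiplier :: "nat \<Rightarrow> complex" where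
  "multiplier k = eigen (\<lambda>x. 1 + defect k x)"

lemma defect_bounds: "bounded_by (defect k) R \<and> (\<integral>x. defect k x \<partial>\<mu>0) = 0"
proof (induction k)
  case 0
  show ?case using bounded_by_mono[OF bounded_by_const[of 0]] R_nonneg by simp
next
  case (Suc k)
  thus ?case using riccati_step(2,3)[of "defect k"] by simp
qed

lemmas defect_bound = defect_bounds[THEN conjunct1]
lemmas defect_integral = defect_bounds[THEN conjunct2]

lemma tilted_op_power:
  "(tilted_op M s \<phi> ^^ n) (\<lambda>_. 1) = (\<lambda>x. (\<Prod>k<n. multiplier k) * (1 + defect n x))"
proof (induction n)
  case (Suc n)
  have "tilted_op M s \<phi> (\<lambda>x. c * v x) = (\<lambda>x. c * tilted_op M s \<phi> v x)" for c v
    unfolding tilted_op_def averaging_op_scale[symmetric] by (simp add: mult_ac)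
  moreover have "tilted_op M s \<phi> (\<lambda>x. 1 + defect n x) = (\<lambda>x. multiplier n * (1 + defect (Suc n) x))"
    using riccati_step(1)[OF defect_bound[of n] defect_integral[of n]] by (auto simp: riccati_def multiplier_def)
  ultimately show ?case using Suc by (simp add: mult_ac)
qed simp

text \<open>
  To first order the Riccati map is affine, \<open>r \<mapsto> L0 (i s \<phi> + r)\<close>, and its iterates from \<open>0\<close> are the
  partial sums of a Neumann series. Each step commits an error \<open>4 u\<^sup>2 / \<delta>0\<close> of mean zero, and the
  gap sums these errors to \<open>4 u\<^sup>2 / \<delta>0\<^sup>2\<close>.
\<close>

lemma defect_expansion:
  fixes k :: nat
  defines "w \<equiv> \<lambda>k x. defect k x - \<i> * s * (\<Sum>j<k. of_real ((averaging_op M ^^ Suc j) \<phi> x))"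
  shows "bounded_by (w k) (4 * u\<^sup>2 / \<delta>0\<^sup>2) \<and> (\<integral>x. w k x \<partial>\<mu>0) = 0"
proof -
  define S where "S = (\<lambda>k x. \<i> * s * (\<Sum>j<k. of_real ((averaging_op M ^^ Suc j) \<phi> x)))"
  have S: "bounded_by (S k) (cmod (\<i> * s) * (\<Sum>j<k. (1 - \<delta>0) ^ Suc j * a))" for k
    unfolding S_def by (intro bounded_by_scale bounded_by_sum bounded_by_iterate)
  have S0: "(\<integral>x. S k x \<partial>\<mu>0) = 0" for k
    unfolding S_def using bounded_by_integrable[OF bounded_by_iterate] integral_iterate_complex
    by (simp del: funpow.simps integral_complex_of_real add: Bochner_Integration.integral_sum)
  have AS: "averaging_op M (S k) x + \<i> * s * of_real (averaging_op M \<phi> x) = S (Suc k) x" for k x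
  proof -
    have "averaging_op M (S k) = (\<lambda>x. \<i> * s * (\<Sum>j<k. of_real ((averaging_op M ^^ Suc (Suc j)) \<phi> x)))"
      unfolding S_def averaging_op_scale
      by (subst averaging_op_sum[OF bounded_by_iterate]) (simp only: averaging_op_iterate_complex)
    thus ?thesis unfolding S_def sum.lessThan_Suc_shift by (simp add: algebra_simps)
  qed
  have wS: "w k = (\<lambda>x. defect k x - S k x)" for k by (simp add: w_def S_def)
  have w0: "(\<integral>x. w k x \<partial>\<mu>0) = 0" for k
    unfolding wS using bounded_by_integrable[OF S] bounded_by_integrable[OF defect_bound] S0 defect_integral by simp
  have "bounded_by (w k) (4 * u\<^sup>2 / \<delta>0\<^sup>2)" for k
  proof (induction k)
    case 0
    show ?case using bounded_by_mono[OF bounded_by_const[of 0]] by (simp add: w_def)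
  next
    case (Suc k)
    have "averaging_op M (defect k) = (\<lambda>x. averaging_op M (S k) x + averaging_op M (w k) x)"
    proof -
      have "defect k = (\<lambda>x. S k x + w k x)" by (simp add: wS)
      thus ?thesis using averaging_op_add[OF S Suc] by simp
    qed
    hence eq: "w (Suc k) = (\<lambda>x. (riccati (defect k) x - (\<i> * s * of_real (averaging_op M \<phi> x) + averaging_op M (defect k) x)) + averaging_op M (w k) x)"
      unfolding wS[of "Suc k"] AS[symmetric] by auto
    show ?case
      unfolding eq
    proof (rule bounded_by_mono[OF bounded_by_add[OF riccati_step(4)[OF defect_bound defect_integral] bounded_by_averaging_op_gap[OF Suc w0]]])
      show "4 * u\<^sup>2 / \<delta>0 + (1 - \<delta>0) * (4 * u\<^sup>2 / \<delta>0\<^sup>2) \<le> 4 * u\<^sup>2 / \<delta>0\<^sup>2"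
        using gap by (simp add: field_simps power2_eq_square)
    qed
  qed
  thus ?thesis using w0 by blast
qed

text \<open>
  Inserting \<open>defect_expansion\<close> into the expansion of the multiplier, the coefficient of \<open>- s\<^sup>2 / 2\<close> becomes a
  partial sum of the Green--Kubo series. Its distance from \<open>1\<close> is twice the tail of the
  autocovariances, which accounts for the geometric term.
\<close>

lemma multiplier_expansion:
  assumes var: "green_kubo = 1"
  shows "cmod (multiplier k - (1 - s\<^sup>2 / 2)) \<le> 5 * u ^ 3 / \<delta>0\<^sup>2 + u\<^sup>2 / \<delta>0 * (1 - \<delta>0) ^ k"
proof -
  define w where "w = (\<lambda>x. defect k x - \<i> * s * (\<Sum>j<k. of_real ((averaging_op M ^^ Suc j) \<phi> x)))"
  define tail where "tail = (\<Sum>j. correlation (j + Suc k))"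
  have w: "bounded_by w (4 * u\<^sup>2 / \<delta>0\<^sup>2)" using defect_expansion[of k] by (simp add: w_def)
  have phiw: "bounded_by (\<lambda>x. of_real (\<phi> x) * w x) (a * (4 * u\<^sup>2 / \<delta>0\<^sup>2))" by (rule bounded_by_mult_observable[OF w])
  have phiL: "integrable \<mu>0 (\<lambda>x. of_real (\<phi> x) * of_real ((averaging_op M ^^ j) \<phi> x) :: complex)" for j
    by (rule bounded_by_integrable[OF bounded_by_mult_observable[OF bounded_by_iterate]])
  have "(\<integral>x. \<phi> x * defect k x \<partial>\<mu>0) = (\<integral>x. \<i> * s * (\<Sum>j<k. of_real (\<phi> x) * of_real ((averaging_op M ^^ Suc j) \<phi> x)) + of_real (\<phi> x) * w x \<partial>\<mu>0)"
    by (simp add: w_def algebra_simps sum_distrib_left)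
  also have "\<dots> = (\<integral>x. \<i> * s * (\<Sum>j<k. of_real (\<phi> x) * of_real ((averaging_op M ^^ Suc j) \<phi> x)) \<partial>\<mu>0) + (\<integral>x. of_real (\<phi> x) * w x \<partial>\<mu>0)"
    by (intro Bochner_Integration.integral_add integrable_mult_right Bochner_Integration.integrable_sum phiL bounded_by_integrable[OF phiw])
  also have "(\<integral>x. \<i> * s * (\<Sum>j<k. of_real (\<phi> x) * of_real ((averaging_op M ^^ Suc j) \<phi> x)) \<partial>\<mu>0) = \<i> * s * (\<Sum>j<k. of_real (correlation (Suc j)))"
    by (subst integral_mult_right_zero, subst Bochner_Integration.integral_sum[OF phiL]) (simp only: correlation_complex)
  finally have 1: "(\<integral>x. \<phi> x * defect k x \<partial>\<mu>0) = \<i> * s * (\<Sum>j<k. of_real (correlation (Suc j))) + (\<integral>x. of_real (\<phi> x) * w x \<partial>\<mu>0)" .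
  have 2: "(\<Sum>j<k. correlation (Suc j)) = (1 - correlation 0) / 2 - tail"
  proof -
    have "(\<Sum>j. correlation (Suc j)) = (\<Sum>j. correlation (Suc (j + k))) + (\<Sum>j<k. correlation (Suc j))"
      by (rule suminf_split_initial_segment) (use summable_correlation in \<open>simp add: summable_Suc_iff\<close>)
    moreover have "correlation 0 + 2 * (\<Sum>j. correlation (Suc j)) = 1" using var by (simp only: green_kubo_def)
    moreover have "tail = (\<Sum>j. correlation (Suc (j + k)))" by (simp add: tail_def)
    moreover have "y = (1 - c) / 2 - t" if "z = t' + y" "c + 2 * z = 1" "t = t'" for c y z t t' :: real
      using that by (simp add: field_simps)
    ultimately show ?thesis by blast
  qed
  define C where "C = 1 - s\<^sup>2 / 2 * correlation 0 + \<i> * s * (\<integral>x. \<phi> x * defect k x \<partial>\<mu>0)"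
  have "C - (1 - s\<^sup>2 / 2) = of_real (s\<^sup>2 * tail) + \<i> * s * (\<integral>x. of_real (\<phi> x) * w x \<partial>\<mu>0)"
    unfolding C_def 1 of_real_sum[symmetric] 2 
    by (simp add: algebra_simps power2_eq_square) (simp add: field_simps)
  hence "multiplier k - (1 - s\<^sup>2 / 2) = (multiplier k - C) + (of_real (s\<^sup>2 * tail) + \<i> * s * (\<integral>x. of_real (\<phi> x) * w x \<partial>\<mu>0))"
    by (simp add: algebra_simps)
  also have "cmod \<dots> \<le> (2/10 * u ^ 3 + 6/10 * u\<^sup>2 * R) + (s\<^sup>2 * ((1 - \<delta>0) ^ k * a\<^sup>2 / \<delta>0) + \<bar>s\<bar> * (a * (4 * u\<^sup>2 / \<delta>0\<^sup>2)))"
  proof (intro norm_triangle_mono)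
    show "cmod (multiplier k - C) \<le> 2/10 * u ^ 3 + 6/10 * u\<^sup>2 * R"
      unfolding multiplier_def C_def by (rule riccati_step(5)[OF defect_bound defect_integral])
    show "cmod (of_real (s\<^sup>2 * tail)) \<le> s\<^sup>2 * ((1 - \<delta>0) ^ k * a\<^sup>2 / \<delta>0)"
      using suminf_correlation_tail[of k] unfolding tail_def norm_of_real abs_mult by (intro mult_mono) auto
    show "cmod (\<i> * s * (\<integral>x. of_real (\<phi> x) * w x \<partial>\<mu>0)) \<le> \<bar>s\<bar> * (a * (4 * u\<^sup>2 / \<delta>0\<^sup>2))"
      using mult_left_mono[OF bounded_by_integral_le[OF phiw], of "\<bar>s\<bar>"] by (simp add: norm_mult)
  qed
  also have "s\<^sup>2 * ((1 - \<delta>0) ^ k * a\<^sup>2 / \<delta>0) = u\<^sup>2 / \<delta>0 * (1 - \<delta>0) ^ k"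
    by (simp add: u_def power_mult_distrib)
  also have "\<bar>s\<bar> * (a * (4 * u\<^sup>2 / \<delta>0\<^sup>2)) = 4 * (u ^ 3 / \<delta>0\<^sup>2)"
    by (simp add: u_def power_mult_distrib power2_eq_square power3_eq_cube)
  also have "6/10 * u\<^sup>2 * R = 72/100 * (u ^ 3 / \<delta>0)"
    by (simp add: R_def power2_eq_square power3_eq_cube)
  finally have 3: "cmod (multiplier k - (1 - s\<^sup>2 / 2)) \<le> 2/10 * u ^ 3 + 72/100 * (u ^ 3 / \<delta>0) + (u\<^sup>2 / \<delta>0 * (1 - \<delta>0) ^ k + 4 * (u ^ 3 / \<delta>0\<^sup>2))" .
  have d: "\<delta>0\<^sup>2 \<le> \<delta>0" "\<delta>0\<^sup>2 \<le> 1" "0 < \<delta>0\<^sup>2" using gap by (auto simp: power2_eq_square mult_le_one mult_left_le)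
  have "u ^ 3 / \<delta>0 \<le> u ^ 3 / \<delta>0\<^sup>2" "u ^ 3 / 1 \<le> u ^ 3 / \<delta>0\<^sup>2"
    using d gap u_bounds(1) by (intro divide_left_mono; simp)+
  moreover have "0 \<le> u ^ 3 / \<delta>0\<^sup>2" using u_bounds(1) by simp
  ultimately have "2/10 * u ^ 3 + 72/100 * (u ^ 3 / \<delta>0) + 4 * (u ^ 3 / \<delta>0\<^sup>2) \<le> 5 * (u ^ 3 / \<delta>0\<^sup>2)" by linarith
  with 3 show ?thesis by simp
qed

end

section \<open>The product of the multipliers\<close>

context small_frequency begin

text \<open>
  The accumulated relative error: the cubic terms of the multipliers, the transient of the first steps
  summed over all \<open>k\<close>, and the difference between \<open>1 - s\<^sup>2 / 2\<close> and \<open>exp (- s\<^sup>2 / 2)\<close>. The factor \<open>501/500\<close> bounds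
  \<open>exp (s\<^sup>2 / 2)\<close>.
\<close>

definition Z :: "nat \<Rightarrow> real" where
  "Z n = 501/500 * (5 * n * u ^ 3 / \<delta>0\<^sup>2 + u\<^sup>2 / \<delta>0\<^sup>2 + n * s ^ 4 / 8)"

text \<open>
  Each multiplier times \<open>exp (s\<^sup>2 / 2)\<close> is \<open>1 + \<zeta>\<close> with small \<open>\<zeta>\<close>. A product of such factors
  differs from \<open>1\<close> by at most \<open>exp Z - 1 \<le> Z exp Z\<close> when the \<open>\<zeta>\<close> are summed to \<open>Z\<close> in modulus.
\<close>

lemma prod_multiplier_approx:
  assumes var: "green_kubo = 1" and s: "s\<^sup>2 \<le> 32/10000"
  shows "cmod ((\<Prod>k<n. multiplier k) - exp (- (real n * s\<^sup>2 / 2))) \<le> exp (- (real n * s\<^sup>2 / 2)) * (Z n * exp (Z n))"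
    and "cmod (\<Prod>k<n. multiplier k) \<le> exp (- (real n * s\<^sup>2 / 2)) * exp (Z n)"
proof -
  define \<zeta> where "\<zeta> k = of_real (exp (s\<^sup>2 / 2)) * multiplier k - 1" for k
  define z where "z k = 501/500 * (5 * u ^ 3 / \<delta>0\<^sup>2 + u\<^sup>2 / \<delta>0 * (1 - \<delta>0) ^ k + s ^ 4 / 8)" for k
  have e1: "exp (s\<^sup>2 / 2) \<le> 501/500"
  proof -
    have "exp (s\<^sup>2 / 2) \<le> 1 + s\<^sup>2 / 2 + (s\<^sup>2 / 2)\<^sup>2" by (rule exp_bound) (use s in auto)
    also have "(s\<^sup>2 / 2)\<^sup>2 \<le> (32/20000)\<^sup>2" using s by (intro power_mono) auto
    finally show ?thesis using s by (simp add: power2_eq_square)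
  qed
  have g: "\<bar>exp (- (s\<^sup>2 / 2)) - (1 - s\<^sup>2 / 2)\<bar> \<le> s ^ 4 / 8"
  proof -
    define y where "y = s\<^sup>2 / 2"
    have y: "0 \<le> y" by (simp add: y_def)
    have "1 + y + y\<^sup>2 / 2 \<le> exp y" using exp_lower_Taylor_quadratic[OF y] by simp
    moreover have "0 \<le> 1 - y + y\<^sup>2 / 2"
    proof -
      have "1 - y + y\<^sup>2 / 2 = ((y - 1)\<^sup>2 + 1) / 2" by (simp add: power2_eq_square field_simps)
      moreover have "0 \<le> ((y - 1)\<^sup>2 + 1) / 2" by simp
      ultimately show ?thesis by (simp only:)
    qed
    ultimately have "(1 - y + y\<^sup>2 / 2) * (1 + y + y\<^sup>2 / 2) \<le> (1 - y + y\<^sup>2 / 2) * exp y" by (intro mult_left_mono)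
    moreover have "(1 - y + y\<^sup>2 / 2) * (1 + y + y\<^sup>2 / 2) = 1 + (y\<^sup>2 / 2)\<^sup>2" by (simp add: power2_eq_square algebra_simps)
    ultimately have "1 \<le> (1 - y + y\<^sup>2 / 2) * exp y" using zero_le_power2[of "y\<^sup>2 / 2"] by linarith
    hence "exp (- y) \<le> 1 - y + y\<^sup>2 / 2" by (simp add: exp_minus field_simps)
    moreover have "1 - y \<le> exp (- y)" using exp_ge_add_one_self[of "- y"] by simp
    moreover have "y\<^sup>2 / 2 = s ^ 4 / 8" by (simp add: y_def power2_eq_square power4_eq_xxxx)
    ultimately show ?thesis unfolding y_def[symmetric] by linarith
  qed
  have zk: "cmod (\<zeta> k) \<le> z k" for k
  proof -
    have "\<zeta> k = of_real (exp (s\<^sup>2 / 2)) * ((multiplier k - (1 - s\<^sup>2 / 2)) - of_real (exp (- (s\<^sup>2 / 2)) - (1 - s\<^sup>2 / 2)))"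
      by (simp add: \<zeta>_def algebra_simps exp_minus of_real_inverse flip: exp_of_real)
    also have "cmod \<dots> \<le> 501/500 * ((5 * u ^ 3 / \<delta>0\<^sup>2 + u\<^sup>2 / \<delta>0 * (1 - \<delta>0) ^ k) + s ^ 4 / 8)"
      unfolding norm_mult
    proof (intro mult_mono)
      show "cmod (of_real (exp (s\<^sup>2 / 2))) \<le> 501/500" using e1 by simp
      show "cmod ((multiplier k - (1 - s\<^sup>2 / 2)) - of_real (exp (- (s\<^sup>2 / 2)) - (1 - s\<^sup>2 / 2))) 
         \<le> (5 * u ^ 3 / \<delta>0\<^sup>2 + u\<^sup>2 / \<delta>0 * (1 - \<delta>0) ^ k) + s ^ 4 / 8"
        by (rule order.trans[OF norm_triangle_ineq4 add_mono[OF multiplier_expansion[OF var]]]) (simp only: norm_of_real g)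
    qed auto
    finally show ?thesis by (simp add: z_def)
  qed
  have "(\<Sum>k<n. z k) \<le> Z n"
  proof -
    have "(\<Sum>k<n. (1 - \<delta>0) ^ k) \<le> (\<Sum>k. (1 - \<delta>0) ^ k)"
      using gap by (intro sum_le_suminf summable_geometric) auto
    also have "\<dots> = 1 / \<delta>0" using gap by (subst suminf_geometric) auto
    finally have "u\<^sup>2 / \<delta>0 * (\<Sum>k<n. (1 - \<delta>0) ^ k) \<le> u\<^sup>2 / \<delta>0 * (1 / \<delta>0)"
      using gap by (intro mult_left_mono) auto
    hence "u\<^sup>2 / \<delta>0 * (\<Sum>k<n. (1 - \<delta>0) ^ k) \<le> u\<^sup>2 / \<delta>0\<^sup>2" by (simp add: power2_eq_square)
    moreover have "(\<Sum>k<n. z k) = 501/500 * (5 * n * u ^ 3 / \<delta>0\<^sup>2 + u\<^sup>2 / \<delta>0 * (\<Sum>k<n. (1 - \<delta>0) ^ k) + n * s ^ 4 / 8)"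
      unfolding z_def sum_distrib_left[symmetric] sum.distrib by (simp add: algebra_simps)
    ultimately show ?thesis by (simp add: Z_def)
  qed
  have z0: "0 \<le> z k" for k using norm_ge_zero zk order.trans by blast
  have prodz: "(\<Prod>k<n. 1 + cmod (\<zeta> k)) \<le> exp (Z n)"
  proof -
    have "(\<Prod>k<n. 1 + cmod (\<zeta> k)) \<le> (\<Prod>k<n. exp (z k))"
    proof (intro prod_mono conjI)
      fix k
      show "1 + cmod (\<zeta> k) \<le> exp (z k)" using exp_ge_add_one_self[of "z k"] zk[of k] by linarith
    qed auto
    also have "\<dots> = exp (\<Sum>k<n. z k)" by (simp add: exp_sum)
    finally show ?thesis using \<open>(\<Sum>k<n. z k) \<le> Z n\<close> by (meson exp_le_cancel_iff order.trans)
  qed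
  have Z0: "0 \<le> Z n" using \<open>(\<Sum>k<n. z k) \<le> Z n\<close> z0 by (meson order.trans sum_nonneg)
  have "(\<Prod>k<n. multiplier k) = (\<Prod>k<n. of_real (exp (- s\<^sup>2 / 2)) * (1 + \<zeta> k))"
    by (intro prod.cong) (auto simp: \<zeta>_def exp_minus field_simps)
  also have "\<dots> = of_real (exp (- (real n * s\<^sup>2 / 2))) * (\<Prod>k<n. 1 + \<zeta> k)"
    by (simp add: prod.distrib exp_of_nat_mult[symmetric] mult_ac flip: of_real_power)
  finally have eq: "(\<Prod>k<n. multiplier k) = of_real (exp (- (real n * s\<^sup>2 / 2))) * (\<Prod>k<n. 1 + \<zeta> k)" .
  have "cmod ((\<Prod>k<n. 1 + \<zeta> k) - 1) \<le> (\<Prod>k<n. 1 + cmod (\<zeta> k)) - 1"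
    by (rule norm_prod_minus1_le_prod_minus1)
  also have "\<dots> \<le> exp (Z n) - 1" using prodz by simp
  also have "\<dots> \<le> Z n * exp (Z n)"
  proof -
    have "(1 - Z n) * exp (Z n) \<le> exp (- Z n) * exp (Z n)"
      using exp_ge_add_one_self[of "- Z n"] by (intro mult_right_mono) auto
    thus ?thesis by (simp add: algebra_simps exp_minus)
  qed
  finally have m1: "cmod ((\<Prod>k<n. 1 + \<zeta> k) - 1) \<le> Z n * exp (Z n)" .
  have "(\<Prod>k<n. multiplier k) - exp (- (real n * s\<^sup>2 / 2)) = of_real (exp (- (real n * s\<^sup>2 / 2))) * ((\<Prod>k<n. 1 + \<zeta> k) - 1)"
    unfolding eq by (simp add: algebra_simps)
  thus "cmod ((\<Prod>k<n. multiplier k) - exp (- (real n * s\<^sup>2 / 2))) \<le> exp (- (real n * s\<^sup>2 / 2)) * (Z n * exp (Z n))"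
    using m1 by (simp add: norm_mult)
  have "cmod (\<Prod>k<n. 1 + \<zeta> k) \<le> (\<Prod>k<n. 1 + cmod (\<zeta> k))"
    unfolding prod_norm[symmetric] by (intro prod_mono conjI norm_ge_zero) (rule order.trans[OF norm_triangle_ineq], simp)
  thus "cmod (\<Prod>k<n. multiplier k) \<le> exp (- (real n * s\<^sup>2 / 2)) * exp (Z n)"
    unfolding eq norm_mult using prodz by (intro mult_mono) auto
qed

end

section \<open>The normal approximation for unit variance\<close>

text \<open>
  From \<open>sin x \<le> x\<close> at \<open>x = \<pi> / 6\<close>.
\<close>

lemma pi_ge_3: "3 \<le> pi"
proof -
  have "sin (pi / 6) \<le> pi / 6" by (rule sin_x_le_x) simp
  thus ?thesis by (simp add: sin_30)
qed

lemma cdf_std_normal_lipschitz: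
  assumes "x \<le> y"
  shows "cdf std_normal_distribution y - cdf std_normal_distribution x \<le> 1 / sqrt (2 * pi) * (y - x)"
proof -
  interpret real_distribution std_normal_distribution by (rule real_dist_normal_dist)
  have "emeasure std_normal_distribution {x<..y} = (\<integral>\<^sup>+t. ennreal (std_normal_density t) * indicator {x<..y} t \<partial>lborel)"
    by (subst emeasure_density) auto
  also have "\<dots> \<le> (\<integral>\<^sup>+t. ennreal (1 / sqrt (2 * pi)) * indicator {x<..y} t \<partial>lborel)"
  proof (intro nn_integral_mono mult_right_mono ennreal_leI)
    show "std_normal_density t \<le> 1 / sqrt (2 * pi)" for t
      using mult_left_mono[of "exp (- t\<^sup>2 / 2)" 1 "1 / sqrt (2 * pi)"] by (simp add: std_normal_density_def)
  qed auto
  also have "\<dots> = ennreal (1 / sqrt (2 * pi)) * ennreal (y - x)"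
    using assms by (simp add: nn_integral_cmult_indicator)
  also have "\<dots> = ennreal (1 / sqrt (2 * pi) * (y - x))"
    using assms by (subst ennreal_mult) auto
  finally have "measure std_normal_distribution {x<..y} \<le> 1 / sqrt (2 * pi) * (y - x)"
    unfolding emeasure_eq_measure using assms by (subst (asm) ennreal_le_iff) auto
  thus ?thesis using assms by (cases "x = y") (auto simp: cdf_diff_eq)
qed

lemma integral_unif_le_half:
  fixes f :: "real \<Rightarrow> real"
  assumes f: "integrable lborel f" and nn: "\<And>t. 0 \<le> f t" and even: "\<And>t. f (- t) = f t"
  shows "integral\<^sup>L (unif 0 T) f \<le> integral\<^sup>L lborel f / 2"
proof -
  have [measurable]: "f \<in> borel_measurable borel" using borel_measurable_integrable[OF f] by simp
  have i: "integrable lborel (\<lambda>t. indicator A t * f t)" if [measurable]: "A \<in> sets borel" for A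
    by (rule Bochner_Integration.integrable_bound[OF f]) (auto simp: indicator_def)
  have "integral\<^sup>L (unif 0 T) f = (\<integral>t. indicator {0<..T} t * f t \<partial>lborel)"
    by (rule integral_unif) measurable
  moreover have "\<dots> = (\<integral>t. indicator {-T..<0} t * f t \<partial>lborel)"
    using lborel_integral_real_affine[of "-1" "\<lambda>t. indicator {0<..T} t * f t" 0]
    by (simp add: even) (intro Bochner_Integration.integral_cong, auto simp: indicator_def)
  moreover have "(\<integral>t. indicator {0<..T} t * f t \<partial>lborel) + (\<integral>t. indicator {-T..<0} t * f t \<partial>lborel) \<le> integral\<^sup>L lborel f"
  proof -
    have "(\<integral>t. indicator {0<..T} t * f t \<partial>lborel) + (\<integral>t. indicator {-T..<0} t * f t \<partial>lborel)
        = (\<integral>t. indicator {0<..T} t * f t + indicator {-T..<0} t * f t \<partial>lborel)"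
      by (rule Bochner_Integration.integral_add[symmetric]; rule i; simp)
    also have "\<dots> \<le> integral\<^sup>L lborel f"
      by (rule integral_mono[OF Bochner_Integration.integrable_add[OF i i] f]) (auto simp: indicator_def nn)
    finally show ?thesis .
  qed
  ultimately show ?thesis by simp
qed

text \<open>
  The moments of the normal law with variance \<open>2\<close>.
\<close>

lemma gaussian_polynomial_integral:
  fixes c0 c2 c4 :: real
  shows "has_bochner_integral lborel (\<lambda>t. exp (- t\<^sup>2 / 4) * (c0 + c2 * t\<^sup>2 + c4 * t ^ 4)) (2 * sqrt pi * (c0 + 2 * c2 + 12 * c4))"
proof -
  have m: "has_bochner_integral lborel (\<lambda>x. normal_density 0 (sqrt 2) x * (x - 0) ^ (2 * k)) (fact (2 * k) / ((2 / (sqrt 2)\<^sup>2) ^ k * fact k))" for k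
    by (rule normal_moment_even) simp
  have "has_bochner_integral lborel (\<lambda>x. 2 * sqrt pi * (c0 * (normal_density 0 (sqrt 2) x * (x - 0) ^ (2 * 0)) + c2 * (normal_density 0 (sqrt 2) x * (x - 0) ^ (2 * 1))
     + c4 * (normal_density 0 (sqrt 2) x * (x - 0) ^ (2 * 2)))) (2 * sqrt pi * (c0 * (fact (2 * 0) / ((2 / (sqrt 2)\<^sup>2) ^ 0 * fact 0)) + c2 * (fact (2 * 1) / ((2 / (sqrt 2)\<^sup>2) ^ 1 * fact 1)) + c4 * (fact (2 * 2) / ((2 / (sqrt 2)\<^sup>2) ^ 2 * fact 2))))"
    by (intro has_bochner_integral_mult_right has_bochner_integral_add m)
  also have "(\<lambda>x. 2 * sqrt pi * (c0 * (normal_density 0 (sqrt 2) x * (x - 0) ^ (2 * 0)) + c2 * (normal_density 0 (sqrt 2) x * (x - 0) ^ (2 * 1))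
     + c4 * (normal_density 0 (sqrt 2) x * (x - 0) ^ (2 * 2)))) = (\<lambda>t. exp (- t\<^sup>2 / 4) * (c0 + c2 * t\<^sup>2 + c4 * t ^ 4))"
  proof
    fix x :: real
    have "2 * sqrt pi * normal_density 0 (sqrt 2) x = exp (- x\<^sup>2 / 4)"
      by (simp add: normal_density_def real_sqrt_mult)
    hence "exp (- x\<^sup>2 / 4) * (c0 + c2 * x\<^sup>2 + c4 * x ^ 4) = 2 * sqrt pi * normal_density 0 (sqrt 2) x * (c0 + c2 * x\<^sup>2 + c4 * x ^ 4)"
      by simp
    thus "2 * sqrt pi * (c0 * (normal_density 0 (sqrt 2) x * (x - 0) ^ (2 * 0)) + c2 * (normal_density 0 (sqrt 2) x * (x - 0) ^ (2 * 1))
     + c4 * (normal_density 0 (sqrt 2) x * (x - 0) ^ (2 * 2))) = exp (- x\<^sup>2 / 4) * (c0 + c2 * x\<^sup>2 + c4 * x ^ 4)"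
      by (simp add: algebra_simps power2_eq_square)
  qed
  also have "(2 * sqrt pi * (c0 * (fact (2 * 0) / ((2 / (sqrt 2)\<^sup>2) ^ 0 * fact 0)) + c2 * (fact (2 * 1) / ((2 / (sqrt 2)\<^sup>2) ^ 1 * fact 1)) + c4 * (fact (2 * 2) / ((2 / (sqrt 2)\<^sup>2) ^ 2 * fact 2)))) = 2 * sqrt pi * (c0 + 2 * c2 + 12 * c4)"
    by (simp add: fact_numeral)
  finally show ?thesis .
qed

context centered_observable begin

context
  fixes n :: nat and m A :: real
  assumes var: "green_kubo = 1" and n: "n \<ge> 1"
  defines "m \<equiv> max a (a ^ 3)" and "A \<equiv> max a (a ^ 3) / (sqrt n * \<delta>0\<^sup>2)"
begin

lemma a_sq_ge: "\<delta>0 / 2 \<le> a\<^sup>2"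
  using green_kubo_le var gap by (simp add: field_simps)

lemma a_pos: "0 < a"
  using a_sq_ge gap a_nonneg by (cases "a = 0") auto

text \<open>
  The maximum of \<open>a\<close> and \<open>a\<^sup>3\<close> dominates all powers of \<open>a\<close> that occur, and also constants, because
  \<open>a\<^sup>2 \<ge> \<delta>0 / 2\<close>.
\<close>

lemma m_ge: "a \<le> m" "a\<^sup>2 \<le> m" "a ^ 3 \<le> m" "0 < m" "\<delta>0\<^sup>2 / 2 \<le> m"
proof -
  show am: "a \<le> m" "a ^ 3 \<le> m" by (auto simp: m_def)
  show "0 < m" using am a_pos by simp
  show "a\<^sup>2 \<le> m"
  proof (cases "a \<le> 1")
    case True
    hence "a\<^sup>2 \<le> a" using a_pos by (simp add: power2_eq_square mult_left_le)
    thus ?thesis using am by simp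
  next
    case False
    hence "a\<^sup>2 \<le> a ^ 3" by (intro power_increasing) auto
    thus ?thesis using am by simp
  qed
  have "(\<delta>0\<^sup>2 / 2)\<^sup>2 \<le> \<delta>0 / 2"
  proof -
    have "\<delta>0 ^ 4 \<le> \<delta>0 ^ 1" using gap by (intro power_decreasing) auto
    moreover have "(\<delta>0\<^sup>2 / 2)\<^sup>2 = \<delta>0 ^ 4 / 4" by (simp add: power_divide)
    ultimately show ?thesis using gap by simp
  qed
  also have "\<dots> \<le> a\<^sup>2" by (rule a_sq_ge)
  finally have "\<delta>0\<^sup>2 / 2 \<le> a" using a_nonneg by (rule power2_le_imp_le)
  thus "\<delta>0\<^sup>2 / 2 \<le> m" using am by simp
qed

lemma frequency_bounds:
  assumes s: "0 < s" "s \<le> \<delta>0\<^sup>2 / (25 * m)"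
  shows "\<bar>s\<bar> * a \<le> \<delta>0\<^sup>2 / 25" "s * m \<le> \<delta>0\<^sup>2 / 25" "s\<^sup>2 \<le> 32/10000"
proof -
  show sm: "s * m \<le> \<delta>0\<^sup>2 / 25" using s m_ge(4) by (simp add: field_simps)
  have "s * a \<le> s * m" using s m_ge by simp
  hence "s * a \<le> \<delta>0\<^sup>2 / 25" using sm by (rule order.trans)
  thus sa: "\<bar>s\<bar> * a \<le> \<delta>0\<^sup>2 / 25" using s by simp
  have "s\<^sup>2 * (\<delta>0 / 2) \<le> s\<^sup>2 * a\<^sup>2" by (intro mult_left_mono a_sq_ge) auto
  also have "\<dots> = (\<bar>s\<bar> * a)\<^sup>2" by (simp add: power_mult_distrib)
  also have "\<dots> \<le> (\<delta>0\<^sup>2 / 25)\<^sup>2" using sa a_nonneg by (intro power_mono) auto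
  also have "\<dots> = \<delta>0 ^ 4 / 625" by (simp add: power_divide)
  also have "\<dots> \<le> \<delta>0 / 625" using gap power_decreasing[of 1 4 \<delta>0] by simp
  finally show "s\<^sup>2 \<le> 32/10000" using gap by (simp add: field_simps)
qed

text \<open>
  All error terms are linear in \<open>A\<close>, the target rate: the defect at time \<open>n\<close> contributes at most \<open>6/5 t A\<close>, whatever
  the initial law, and \<open>Z\<close> at most \<open>501/500 (5 t\<^sup>3 + t\<^sup>2 + t\<^sup>4 / 4) A\<close>. As \<open>Z \<le> t\<^sup>2 / 4 + 1/500\<close>
  in the admissible range, half of the Gaussian decay survives. The odd powers of \<open>t\<close> are
  bounded by even ones, whose Gaussian integrals are explicit.
\<close>

lemma char_estimate:
  fixes P :: "'w measure"
  assumes chain: "markov_chain P M \<mu> \<xi>"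
    and t: "0 < t" "t \<le> sqrt n * \<delta>0\<^sup>2 / (25 * m)"
  defines "D \<equiv> distr P borel (\<lambda>w. (\<Sum>k=1..n. \<phi> (\<xi> k w)) / sqrt n)"
  shows "cmod (char D t - char std_normal_distribution t) / t
     \<le> 1006/1000 * A * (exp (- t\<^sup>2 / 4) * (17/10 + 45/8 * t\<^sup>2 + 1/8 * t ^ 4))"
proof -
  interpret C: markov_chain P M \<mu> \<xi> by fact
  define s where "s = t / sqrt n"
  have n0: "0 < sqrt n" using n by simp
  have s: "0 < s" "s \<le> \<delta>0\<^sup>2 / (25 * m)" using t n0 by (auto simp: s_def field_simps)
  note fb = frequency_bounds[OF s]
  interpret S: small_frequency M X N \<mu>0 G0 \<delta>0 \<phi> a s by unfold_locales (rule fb)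
  have ns2: "real n * s\<^sup>2 = t\<^sup>2" using n by (simp add: s_def power_divide)
  define Q where "Q = (\<Prod>k<n. S.multiplier k)"
  have db: "bounded_by (S.defect n) S.R" by (rule S.defect_bound)
  have intd: "integrable P (\<lambda>w. S.defect n (\<xi> 0 w))"
    by (rule C.integrable_const_bound[where B=S.R])
       (use bounded_by_norm[OF db] measurable_compose[OF C.random_variable bounded_by_measurable[OF db]] in auto)
  have ch: "char D t = Q * (1 + (\<integral>w. S.defect n (\<xi> 0 w) \<partial>P))"
  proof -
    have [measurable]: "\<xi> k \<in> P \<rightarrow>\<^sub>M borel" for k by (rule C.random_variable)
    have "char D t = (\<integral>w. iexp (t * ((\<Sum>k=1..n. \<phi> (\<xi> k w)) / sqrt n)) \<partial>P)"
      unfolding char_def D_def by (rule integral_distr) measurable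
    also have "\<dots> = (\<integral>w. iexp (s * (\<Sum>k=1..n. \<phi> (\<xi> k w))) * 1 \<partial>P)" by (simp add: s_def)
    also have "\<dots> = (\<integral>w. (tilted_op M s \<phi> ^^ n) (\<lambda>_. 1) (\<xi> 0 w) \<partial>P)"
      by (rule C.char_partial_sum[where D=1]) auto
    also have "\<dots> = (\<integral>w. Q * (1 + S.defect n (\<xi> 0 w)) \<partial>P)" by (simp only: S.tilted_op_power Q_def)
    also have "\<dots> = Q * (1 + (\<integral>w. S.defect n (\<xi> 0 w) \<partial>P))"
      using intd by (simp add: C.prob_space)
    finally show ?thesis .
  qed
  have dint: "cmod (\<integral>w. S.defect n (\<xi> 0 w) \<partial>P) \<le> S.R"
  proof -
    have "cmod (\<integral>w. S.defect n (\<xi> 0 w) \<partial>P) \<le> (\<integral>w. cmod (S.defect n (\<xi> 0 w)) \<partial>P)" by (rule integral_norm_bound)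
    also have "\<dots> \<le> (\<integral>w. S.R \<partial>P)"
      by (rule integral_mono) (use intd bounded_by_norm[OF db] in auto)
    finally show ?thesis by (simp add: C.prob_space)
  qed
  define g where "g = exp (- (t\<^sup>2 / 2))"
  have pm: "cmod (Q - g) \<le> g * (S.Z n * exp (S.Z n))" "cmod Q \<le> g * exp (S.Z n)"
    using S.prod_multiplier_approx[OF var fb(3), of n] unfolding Q_def g_def ns2 by auto
  have "char D t - char std_normal_distribution t = (Q - g) + Q * (\<integral>w. S.defect n (\<xi> 0 w) \<partial>P)"
    unfolding ch char_std_normal_distribution by (simp add: g_def algebra_simps)
  also have "cmod \<dots> \<le> g * (S.Z n * exp (S.Z n)) + g * exp (S.Z n) * S.R"
    by (rule order.trans[OF norm_triangle_ineq add_mono[OF pm(1)]]) 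
       (unfold norm_mult, intro mult_mono pm dint, auto simp: g_def)
  also have "\<dots> = g * exp (S.Z n) * (S.Z n + S.R)" by (simp add: algebra_simps)
  finally have main: "cmod (char D t - char std_normal_distribution t) \<le> g * exp (S.Z n) * (S.Z n + S.R)" .
  have us: "S.u = s * a" using s by (simp add: S.u_def)
  \<comment> \<open>The range of \<open>t\<close> enters here: \<open>s a\<^sup>3 \<le> \<delta>0\<^sup>2 / 25\<close> turns the cubic terms into \<open>t\<^sup>2 / 5\<close>.\<close>
  have Zle: "S.Z n \<le> t\<^sup>2 / 4 + 2/1000"
  proof -
    have "S.u ^ 3 = s\<^sup>2 * (s * a ^ 3)" by (simp add: us power_mult_distrib power2_eq_square power3_eq_cube)
    also have "\<dots> \<le> s\<^sup>2 * (s * m)" using s m_ge by (intro mult_left_mono) auto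
    also have "\<dots> \<le> s\<^sup>2 * (\<delta>0\<^sup>2 / 25)" by (intro mult_left_mono fb) auto
    finally have "5 * real n * S.u ^ 3 / \<delta>0\<^sup>2 \<le> 5 * real n * (s\<^sup>2 * (\<delta>0\<^sup>2 / 25)) / \<delta>0\<^sup>2"
      by (intro divide_right_mono mult_left_mono) auto
    also have "\<dots> = t\<^sup>2 / 5" using gap ns2 by (simp add: field_simps)
    finally have 1: "5 * real n * S.u ^ 3 / \<delta>0\<^sup>2 \<le> t\<^sup>2 / 5" .
    have "S.u\<^sup>2 \<le> (\<delta>0 / 25)\<^sup>2" by (intro power_mono S.u_bounds)
    hence "S.u\<^sup>2 / \<delta>0\<^sup>2 \<le> (\<delta>0 / 25)\<^sup>2 / \<delta>0\<^sup>2" by (intro divide_right_mono) auto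
    also have "\<dots> = 1 / 625" using gap by (simp add: power_divide)
    finally have 2: "S.u\<^sup>2 / \<delta>0\<^sup>2 \<le> 1 / 625" .
    have "n * s ^ 4 / 8 = t\<^sup>2 * s\<^sup>2 / 8" unfolding ns2[symmetric] by (simp add: power2_eq_square power4_eq_xxxx)
    also have "\<dots> \<le> t\<^sup>2 * (32/10000) / 8" by (intro divide_right_mono mult_left_mono fb) auto
    finally have 3: "n * s ^ 4 / 8 \<le> t\<^sup>2 / 2500" by simp
    have "501/500 * (x + y + z) \<le> v / 4 + 2/1000" if "x \<le> v / 5" "y \<le> 1/625" "z \<le> v / 2500" "0 \<le> v" for x y z v :: real
    proof -
      have "501/500 * (x + y + z) \<le> 501/500 * (v / 5 + 1/625 + v / 2500)"
        using that by (intro mult_left_mono add_mono) auto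
      also have "\<dots> \<le> v / 4 + 2/1000" using that(4) by (simp add: field_simps)
      finally show ?thesis .
    qed
    from this[OF 1 2 3] show ?thesis unfolding S.Z_def by simp
  qed
  have "exp (S.Z n) \<le> exp (t\<^sup>2 / 4 + 2/1000)" using Zle by simp
  also have "\<dots> = exp (t\<^sup>2 / 4) * exp (2/1000)" by (simp only: exp_add)
  also have "\<dots> \<le> exp (t\<^sup>2 / 4) * (1003/1000)"
    using exp_bound[of "2/1000"] by (intro mult_left_mono) (auto simp: power2_eq_square)
  finally have "g * exp (S.Z n) \<le> g * (exp (t\<^sup>2 / 4) * (1003/1000))" by (intro mult_left_mono) (auto simp: g_def)
  also have "\<dots> = 1003/1000 * exp (- t\<^sup>2 / 4)" by (simp add: g_def flip: exp_add)
  finally have eZ: "g * exp (S.Z n) \<le> 1003/1000 * exp (- t\<^sup>2 / 4)" .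
  have A0: "0 \<le> A" using m_ge(4) n0 by (simp add: A_def m_def[symmetric])
  have Aeq: "A = m / (sqrt n * \<delta>0\<^sup>2)" by (simp add: A_def m_def)
  \<comment> \<open>Terms of the smaller order \<open>1 / n\<close> are weakened to the order of \<open>A\<close>.\<close>
  have nn: "1 / real n \<le> 1 / sqrt n"
  proof -
    have "sqrt n \<le> sqrt n * sqrt n" using n by (intro mult_le_cancel_left1[THEN iffD2]) auto
    hence "sqrt n \<le> real n" by simp
    thus ?thesis using n by (intro divide_left_mono) auto
  qed
  have s3: "real n * s ^ 3 = t ^ 3 / sqrt n" using n0 n
    by (simp add: s_def power_divide power3_eq_cube field_simps)
  have z1: "5 * real n * S.u ^ 3 / \<delta>0\<^sup>2 \<le> 5 * t ^ 3 * A"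
  proof -
    have "5 * real n * S.u ^ 3 / \<delta>0\<^sup>2 = 5 * (real n * s ^ 3) * (a ^ 3 / \<delta>0\<^sup>2)" by (simp add: us power_mult_distrib)
    also have "\<dots> = 5 * t ^ 3 * (a ^ 3 / (sqrt n * \<delta>0\<^sup>2))" unfolding s3 by (simp add: field_simps)
    also have "\<dots> \<le> 5 * t ^ 3 * A" unfolding Aeq using t n0 by (intro mult_left_mono divide_right_mono m_ge) auto
    finally show ?thesis .
  qed
  have z2: "S.u\<^sup>2 / \<delta>0\<^sup>2 \<le> t\<^sup>2 * A"
  proof -
    have "S.u\<^sup>2 / \<delta>0\<^sup>2 = t\<^sup>2 * (1 / n * (a\<^sup>2 / \<delta>0\<^sup>2))" using n unfolding us by (simp add: s_def power_mult_distrib power_divide)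
    also have "\<dots> \<le> t\<^sup>2 * (1 / sqrt n * (m / \<delta>0\<^sup>2))"
      using nn by (intro mult_left_mono mult_mono divide_right_mono m_ge) auto
    finally show ?thesis by (simp add: Aeq)
  qed
  have z3: "n * s ^ 4 / 8 \<le> t ^ 4 / 4 * A"
  proof -
    have "n * s ^ 4 / 8 = t ^ 4 / 8 * (1 / n)" using n
      by (simp add: s_def power_divide power4_eq_xxxx field_simps)
    also have "\<dots> \<le> t ^ 4 / 8 * (1 / sqrt n * (2 * (m / \<delta>0\<^sup>2)))"
    proof (intro mult_left_mono)
      have "1 \<le> 2 * (m / \<delta>0\<^sup>2)" using m_ge(5) gap by (simp add: field_simps)
      hence "1 / sqrt n * 1 \<le> 1 / sqrt n * (2 * (m / \<delta>0\<^sup>2))" using n0 by (intro mult_left_mono) auto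
      thus "1 / real n \<le> 1 / sqrt n * (2 * (m / \<delta>0\<^sup>2))" using nn by linarith
    qed auto
    finally show ?thesis by (simp add: Aeq)
  qed
  have z4: "S.R \<le> 6/5 * t * A"
  proof -
    have "S.R = 6/5 * t * (a / (sqrt n * \<delta>0))" unfolding S.R_def us by (simp add: s_def)
    moreover have "a / (sqrt n * \<delta>0) \<le> A"
    proof -
      have "\<delta>0\<^sup>2 \<le> \<delta>0" using gap by (simp add: power2_eq_square mult_left_le)
      hence "sqrt n * \<delta>0\<^sup>2 \<le> sqrt n * \<delta>0" by (intro mult_left_mono) auto
      thus ?thesis unfolding Aeq using m_ge n0 gap by (intro frac_le) auto
    qed
    ultimately show ?thesis using mult_left_mono[of "a / (sqrt n * \<delta>0)" A "6/5 * t"] t by simp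
  qed
  have "S.Z n + S.R \<le> 501/500 * (5 * t ^ 3 * A + t\<^sup>2 * A + t ^ 4 / 4 * A) + 501/500 * (6/5 * t * A)"
  proof -
    have gen: "501/500 * (x + y + z) + r \<le> 501/500 * (x' + y' + z') + 501/500 * r'"
      if "x \<le> x'" "y \<le> y'" "z \<le> z'" "r \<le> r'" "0 \<le> r'" for x y z r x' y' z' r' :: real
    proof (intro add_mono mult_left_mono that(1-3))
      show "r \<le> 501/500 * r'" using that(4,5) by linarith
    qed simp
    have "0 \<le> 6/5 * t * A" using t A0 by simp
    from gen[OF z1 z2 z3 z4 this] show ?thesis unfolding S.Z_def .
  qed
  also have "\<dots> = 501/500 * A * t * (6/5 + t + 5 * t\<^sup>2 + t ^ 3 / 4)"
    by (simp add: algebra_simps power2_eq_square power3_eq_cube power4_eq_xxxx)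
  also have "\<dots> \<le> 501/500 * A * t * (17/10 + 45/8 * t\<^sup>2 + 1/8 * t ^ 4)"
  proof (intro mult_left_mono)
    \<comment> \<open>That is, \<open>t \<le> (1 + t\<^sup>2) / 2\<close> and \<open>t\<^sup>3 \<le> (t\<^sup>2 + t\<^sup>4) / 2\<close>.\<close>
    have "0 \<le> (t - 1)\<^sup>2" "0 \<le> t\<^sup>2 * (t - 1)\<^sup>2" by auto
    thus "6/5 + t + 5 * t\<^sup>2 + t ^ 3 / 4 \<le> 17/10 + 45/8 * t\<^sup>2 + 1/8 * t ^ 4"
      by (simp add: algebra_simps power2_eq_square power3_eq_cube power4_eq_xxxx)
  qed (use A0 t in auto)
  finally have ZR: "S.Z n + S.R \<le> 501/500 * A * t * (17/10 + 45/8 * t\<^sup>2 + 1/8 * t ^ 4)" .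
  have ZR0: "0 \<le> S.Z n + S.R"
    using S.R_nonneg S.u_bounds(1) by (simp add: S.Z_def)
  define p where "p = 17/10 + 45/8 * t\<^sup>2 + 1/8 * t ^ 4"
  have p0: "0 \<le> p" by (simp add: p_def)
  have "cmod (char D t - char std_normal_distribution t) \<le> (1003/1000 * exp (- t\<^sup>2 / 4)) * (501/500 * A * t * p)"
    by (rule order.trans[OF main mult_mono[OF eZ ZR[folded p_def] _ ZR0]]) auto
  also have "\<dots> = (1003/1000 * (501/500)) * (A * (exp (- t\<^sup>2 / 4) * p)) * t" by simp
  also have "\<dots> \<le> 1006/1000 * (A * (exp (- t\<^sup>2 / 4) * p)) * t"
    using A0 p0 t by (intro mult_right_mono) auto
  finally show ?thesis using t unfolding p_def[symmetric] by (simp add: divide_le_eq mult_ac)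
qed

text \<open>
  The two contributions to the smoothing inequality: \<open>4 \<cdot> 1.006 \<cdot> 14.45 / sqrt \<pi> \<le> 34\<close> from the
  characteristic functions, where \<open>14.45\<close> is the normalised Gaussian integral of the polynomial in
  \<open>char_estimate\<close>, and \<open>24 \<cdot> 25 / (\<pi> sqrt (2 \<pi>)) \<le> 82\<close> from the truncation.
\<close>

lemma berry_esseen_unit_variance:
  fixes P :: "'w measure"
  assumes chain: "markov_chain P M \<mu> \<xi>"
  defines "D \<equiv> distr P borel (\<lambda>w. (\<Sum>k=1..n. \<phi> (\<xi> k w)) / sqrt n)"
  shows "\<bar>cdf D x - cdf std_normal_distribution x\<bar> \<le> 123 * A"
proof -
  interpret C: markov_chain P M \<mu> \<xi> by fact
  have [measurable]: "\<xi> k \<in> P \<rightarrow>\<^sub>M borel" for k by (rule C.random_variable)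
  have D: "real_distribution D" unfolding D_def by (rule C.real_distribution_distr) measurable
  interpret D: real_distribution D by (rule D)
  interpret G: real_distribution std_normal_distribution by (rule real_dist_normal_dist)
  define T where "T = sqrt n * \<delta>0\<^sup>2 / (25 * m)"
  have n0: "0 < sqrt n" using n by simp
  have T: "T > 0" using n0 gap m_ge by (simp add: T_def)
  have A0: "0 \<le> A" using m_ge(4) n0 by (simp add: A_def m_def[symmetric])
  define p where "p = (\<lambda>t::real. exp (- t\<^sup>2 / 4) * (17/10 + 45/8 * t\<^sup>2 + 1/8 * t ^ 4))"
  have p: "has_bochner_integral lborel p (2 * sqrt pi * (289/20))"
    using gaussian_polynomial_integral[of "17/10" "45/8" "1/8"] by (simp add: p_def)
  have p0: "0 \<le> p t" for t by (simp add: p_def)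
  have pm [measurable]: "p \<in> borel_measurable borel" unfolding p_def by measurable
  have pi: "integrable (unif 0 T) p"
  proof -
    have "integrable lborel (\<lambda>t. indicator {0<..T} t *\<^sub>R p t)"
      using p by (intro integrable_mult_indicator) (auto simp: has_bochner_integral_iff)
    thus ?thesis unfolding unif_def by (subst integrable_density) auto
  qed
  have est: "AE t in unif 0 T. cmod (char D t - char std_normal_distribution t) / t \<le> 1006/1000 * A * p t"
    using AE_unif
  proof eventually_elim
    case (elim t)
    thus ?case using char_estimate[OF chain, of t] by (simp add: D_def T_def p_def)
  qed
  have I: "integrable (unif 0 T) (\<lambda>t. cmod (char D t - char std_normal_distribution t) / t)"
  proof (rule Bochner_Integration.integrable_bound)
    show "integrable (unif 0 T) (\<lambda>t. 1006/1000 * A * p t)" by (rule integrable_mult_right[OF pi])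
    show "AE t in unif 0 T. norm (cmod (char D t - char std_normal_distribution t) / t) \<le> norm (1006/1000 * A * p t)"
      using est AE_unif by eventually_elim (use A0 p0 in auto)
  qed measurable
  have "(\<integral>t. cmod (char D t - char std_normal_distribution t) / t \<partial>unif 0 T) \<le> (\<integral>t. 1006/1000 * A * p t \<partial>unif 0 T)"
    by (rule integral_mono_AE[OF I integrable_mult_right[OF pi] est])
  also have "\<dots> = 1006/1000 * A * (\<integral>t. p t \<partial>unif 0 T)" by simp
  also have "\<dots> \<le> 1006/1000 * A * (integral\<^sup>L lborel p / 2)"
    using p A0 p0 by (intro mult_left_mono integral_unif_le_half) (auto simp: has_bochner_integral_iff p_def)
  also have "\<dots> = 1006/1000 * A * (sqrt pi * (289/20))" using p by (simp add: has_bochner_integral_iff)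
  finally have Ile: "(\<integral>t. cmod (char D t - char std_normal_distribution t) / t \<partial>unif 0 T) \<le> 1006/1000 * A * (sqrt pi * (289/20))" .
  have "\<bar>cdf D x - cdf std_normal_distribution x\<bar> \<le> 4 / pi * (\<integral>t. cmod (char D t - char std_normal_distribution t) / t \<partial>unif 0 T)
      + 24 * (1 / sqrt (2 * pi)) / (pi * T)"
    by (rule esseen_smoothing[OF T D real_dist_normal_dist cdf_std_normal_lipschitz I])
  also have "\<dots> \<le> 4 / pi * (1006/1000 * A * (sqrt pi * (289/20))) + 24 * (1 / sqrt (2 * pi)) / (pi * T)"
    using Ile by (intro add_right_mono mult_left_mono) auto
  also have "4 / pi * (1006/1000 * A * (sqrt pi * (289/20))) \<le> 34 * A"
  proof -
    have "173/100 \<le> sqrt pi" by (rule real_le_rsqrt) (use pi_ge_3 in \<open>simp add: power2_eq_square\<close>)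
    hence "4 * (1006/1000) * (289/20) / sqrt pi \<le> 4 * (1006/1000) * (289/20) / (173/100)"
      by (intro divide_left_mono) auto
    also have "\<dots> \<le> 34" by simp
    finally have "4 * (1006/1000) * (289/20) / sqrt pi * A \<le> 34 * A" using A0 by (rule mult_right_mono)
    moreover have "4 / pi * (1006/1000 * A * (sqrt pi * (289/20))) = 4 * (1006/1000) * (289/20) / sqrt pi * A"
    proof -
      have "4 / (q * q) * (1006/1000 * A * (q * (289/20))) = 4 * (1006/1000) * (289/20) / q * A" if "q > 0" for q
        using that by (simp add: field_simps)
      from this[of "sqrt pi"] show ?thesis by simp
    qed
    ultimately show ?thesis by simp
  qed
  also have "24 * (1 / sqrt (2 * pi)) / (pi * T) \<le> 82 * A"
  proof -
    have 1: "2449/1000 \<le> sqrt (2 * pi)" by (rule real_le_rsqrt) (use pi_ge_3 in \<open>simp add: power2_eq_square\<close>)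
    have "2449/1000 * 3 \<le> sqrt (2 * pi) * pi" by (intro mult_mono 1 pi_ge_3) auto
    hence "600 / (sqrt (2 * pi) * pi) \<le> 600 / (2449/1000 * 3)" by (intro divide_left_mono) auto
    also have "\<dots> \<le> 82" by simp
    finally have "600 / (sqrt (2 * pi) * pi) * A \<le> 82 * A" using A0 by (rule mult_right_mono)
    moreover have "24 * (1 / sqrt (2 * pi)) / (pi * T) = 600 / (sqrt (2 * pi) * pi) * A"
      by (simp add: T_def A_def m_def)
    ultimately show ?thesis by simp
  qed
  finally show ?thesis using A0 by simp
qed

end
end

section \<open>Normalisation of the observable\<close>

context spectral_gap_setting begin

lemma averaging_op_scaled_iterate:
  fixes c :: real
  shows "(averaging_op M ^^ j) (\<lambda>x. c * f x) = (\<lambda>x. c * (averaging_op M ^^ j) f x)"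
proof (induction j)
  case (Suc j)
  thus ?case by (auto simp: averaging_op_def)
qed simp

text \<open>
  Centring changes none of the covariances because the iterates of the centred observable have mean
  zero, and dividing by \<open>\<sigma>\<close> divides the Green--Kubo series by \<open>\<sigma>\<^sup>2\<close>.
\<close>

lemma normalized_observable:
  fixes \<phi> :: "'a \<Rightarrow> real"
  assumes phi: "(\<lambda>x. of_real (\<phi> x)) \<in> X" and pos: "dynamical_variance M \<mu>0 \<phi> > 0"
  defines "\<psi> \<equiv> normalized M \<mu>0 \<phi>"
  shows "centered_observable M X N \<mu>0 G0 \<delta>0 \<psi> (N (\<lambda>x. of_real (\<psi> x)))"
    and "centered_observable.green_kubo M \<mu>0 \<psi> = 1"
proof -
  interpret prob_space \<mu>0 by (rule prob_space_stationary)
  define m where "m = (\<integral>z. \<phi> z \<partial>\<mu>0)"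
  define \<sigma> where "\<sigma> = sqrt (dynamical_variance M \<mu>0 \<phi>)"
  have sig: "\<sigma> > 0" "\<sigma>\<^sup>2 = dynamical_variance M \<mu>0 \<phi>" using pos by (auto simp: \<sigma>_def)
  have psi: "\<psi> x = (\<phi> x - m) / \<sigma>" for x by (simp add: \<psi>_def normalized_def m_def \<sigma>_def)
  have phi_eq: "\<phi> x = m + \<sigma> * \<psi> x" for x using sig by (simp add: psi)
  have "(\<lambda>x. of_real (\<psi> x) :: 'k) = (\<lambda>x. of_real (1 / \<sigma>) * of_real (\<phi> x) + of_real (- m / \<sigma>))"
    by (simp add: psi diff_divide_distrib)
  also have "\<dots> \<in> X" by (intro add_closed scale_closed phi const_closed)
  finally have X: "(\<lambda>x. of_real (\<psi> x)) \<in> X" .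
  have iphi: "integrable \<mu>0 \<phi>"
    by (rule integrable_stationary[OF real_measurable[OF phi]]) (use real_bound[OF phi] in auto)
  have c0: "(\<integral>x. \<psi> x \<partial>\<mu>0) = 0"
    unfolding psi using iphi prob_space by (simp add: m_def)
  show co: "centered_observable M X N \<mu>0 G0 \<delta>0 \<psi> (N (\<lambda>x. of_real (\<psi> x)))"
    by unfold_locales (use X c0 in auto)
  interpret C: centered_observable M X N \<mu>0 G0 \<delta>0 \<psi> "N (\<lambda>x. of_real (\<psi> x))" by (rule co)
  let ?L = "\<lambda>j. (averaging_op M ^^ j) \<psi>"
  have Lb: "integrable \<mu>0 (?L j)" "integrable \<mu>0 (\<lambda>x. \<psi> x * ?L j x)" "(\<integral>x. ?L j x \<partial>\<mu>0) = 0" for j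
  proof -
    have L: "(\<lambda>x. of_real (?L j x)) \<in> X" using C.iterate_facts[of j] by simp
    show "integrable \<mu>0 (?L j)"
      by (rule integrable_stationary[OF real_measurable[OF L]]) (use real_bound[OF L] in auto)
    have LL: "(\<lambda>x. of_real (\<psi> x * ?L j x)) \<in> X" using mult_closed[OF X L] by simp
    show "integrable \<mu>0 (\<lambda>x. \<psi> x * ?L j x)"
      by (rule integrable_stationary[OF real_measurable[OF LL]]) (use real_bound[OF LL] in auto)
    show "(\<integral>x. ?L j x \<partial>\<mu>0) = 0" using C.iterate_facts[of j] by simp
  qed
  have cov: "(\<integral>x. \<phi> x * (averaging_op M ^^ Suc k) (\<lambda>y. \<phi> y - m) x \<partial>\<mu>0) = \<sigma>\<^sup>2 * C.correlation (Suc k)" for k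
  proof -
    have "(averaging_op M ^^ Suc k) (\<lambda>y. \<phi> y - m) = (\<lambda>x. \<sigma> * ?L (Suc k) x)"
      using averaging_op_scaled_iterate[of "Suc k" \<sigma> \<psi>] by (simp add: phi_eq)
    hence "(\<integral>x. \<phi> x * (averaging_op M ^^ Suc k) (\<lambda>y. \<phi> y - m) x \<partial>\<mu>0) = (\<integral>x. m * \<sigma> * ?L (Suc k) x + \<sigma>\<^sup>2 * (\<psi> x * ?L (Suc k) x) \<partial>\<mu>0)"
      unfolding phi_eq by (simp only:) (simp add: algebra_simps power2_eq_square del: funpow.simps)
    also have "\<dots> = \<sigma>\<^sup>2 * C.correlation (Suc k)"
      using Lb[of "Suc k"] by (simp add: C.correlation_def del: funpow.simps)
    finally show ?thesis .
  qed
  have sq: "(\<integral>x. (\<phi> x)\<^sup>2 \<partial>\<mu>0) - m\<^sup>2 = \<sigma>\<^sup>2 * C.correlation 0"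
  proof -
    have "(\<integral>x. (\<phi> x)\<^sup>2 \<partial>\<mu>0) = (\<integral>x. m\<^sup>2 + (2 * m * \<sigma> * ?L 0 x + \<sigma>\<^sup>2 * (\<psi> x * ?L 0 x)) \<partial>\<mu>0)"
      unfolding phi_eq by (simp add: algebra_simps power2_eq_square)
    also have "\<dots> = m\<^sup>2 + \<sigma>\<^sup>2 * C.correlation 0"
      using Lb[of 0] prob_space by (simp add: C.correlation_def)
    finally show ?thesis by simp
  qed
  have "\<sigma>\<^sup>2 = dynamical_variance M \<mu>0 \<phi>" by (rule sig(2))
  also have "\<dots> = \<sigma>\<^sup>2 * C.correlation 0 + 2 * (\<Sum>k. \<sigma>\<^sup>2 * C.correlation (Suc k))"
    unfolding dynamical_variance_def m_def[symmetric] cov sq ..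
  also have "\<dots> = \<sigma>\<^sup>2 * C.green_kubo"
  proof -
    have "(\<Sum>k. \<sigma>\<^sup>2 * C.correlation (Suc k)) = \<sigma>\<^sup>2 * (\<Sum>k. C.correlation (Suc k))"
      by (rule suminf_mult) (simp only: summable_Suc_iff C.summable_correlation)
    thus ?thesis unfolding C.green_kubo_def by (simp only: distrib_left)
  qed
  finally show "C.green_kubo = 1" using sig(1) by simp
qed

end

theorem theorem3:
  fixes M :: "'a::polish_space \<Rightarrow> 'a measure"
    and X :: "('a \<Rightarrow> 'k::{real_normed_field, banach, second_countable_topology}) set"
    and N :: "('a \<Rightarrow> 'k) \<Rightarrow> real"
    and \<mu>0 \<mu> :: "'a measure"
    and G0 :: "('a \<Rightarrow> 'k) set"
    and \<delta>0 :: real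
    and P :: "'w measure"
    and \<xi> :: "nat \<Rightarrow> 'w \<Rightarrow> 'a"
    and \<phi> \<phi>t :: "'a \<Rightarrow> real"
    and F :: "nat \<Rightarrow> real \<Rightarrow> real"
    and n :: nat
  assumes setting: "spectral_gap_setting M X N \<mu>0 G0 \<delta>0"
    and chain: "markov_chain P M \<mu> \<xi>"
    and phi_in: "(\<lambda>x. of_real (\<phi> x)) \<in> X"
    and variance_pos: "dynamical_variance M \<mu>0 \<phi> > 0"
    and phit_def: "\<phi>t = normalized M \<mu>0 \<phi>"
    and F_def: "\<And>n. F n = cdf (distr P borel (\<lambda>w. (\<Sum>k=1..n. \<phi>t (\<xi> k w)) / sqrt (real n)))"
    and n_ge: "n \<ge> 1"
  shows "(SUP x. \<bar>F n x - cdf std_normal_distribution x\<bar>)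
    \<le> (148 + 285 / \<delta>0 + 123 / \<delta>0 ^ 2)
        * max (N (\<lambda>x. of_real (\<phi>t x))) (N (\<lambda>x. of_real (\<phi>t x)) ^ 3) / sqrt (real n)"
proof -
  interpret spectral_gap_setting M X N \<mu>0 G0 \<delta>0 by (rule setting)
  note nrm = normalized_observable[OF phi_in variance_pos, folded phit_def]
  define m where "m = max (N (\<lambda>x. of_real (\<phi>t x))) (N (\<lambda>x. of_real (\<phi>t x)) ^ 3)"
  have m0: "0 \<le> m"
    using centered_observable.a_nonneg[OF nrm(1)] by (simp add: m_def)
  have "\<bar>F n x - cdf std_normal_distribution x\<bar> \<le> (148 + 285 / \<delta>0 + 123 / \<delta>0 ^ 2) * m / sqrt (real n)" for x
  proof -
    have "\<bar>F n x - cdf std_normal_distribution x\<bar> \<le> 123 * (m / (sqrt n * \<delta>0\<^sup>2))"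
      unfolding F_def m_def by (rule centered_observable.berry_esseen_unit_variance[OF nrm n_ge chain])
    also have "\<dots> = 123 / \<delta>0 ^ 2 * m / sqrt (real n)" by simp
    also have "\<dots> \<le> (148 + 285 / \<delta>0 + 123 / \<delta>0 ^ 2) * m / sqrt (real n)"
      using gap m0 by (intro divide_right_mono mult_right_mono) auto
    finally show ?thesis .
  qed
  thus ?thesis unfolding m_def by (intro cSUP_least) auto
qed

end
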